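(* Let $(\boldsymbol u,\boldsymbol B,P,T)$ be a smooth solution of the Taylor model (see context), and suppose that the magnetic flux is exact. Suppose that at some instant of time the magnetic field is nontrivial and dynamo action occurs, i.e. $\frac{\mathrm d}{\mathrm dt}\left(\frac12\int_V|\boldsymbol B|^2\,\mathrm dV\right)\ge 0$. Then at that instant, for every $3\le p\le\infty$, $$ Ra\,A_p\,\|\nabla_{x,y}\overline T\|_{L^p}\ \ge\ \frac1{Rm}. $$
   Context: Domain: $V=[0,L_x]\times[0,L_y]\times[0,1]$ with $L_x,L_y>0$; all fields are periodic in $x$ and $y$. $S_-=\{z=0\}$, $S_+=\{z=1\}$, $\boldsymbol n_\pm=\pm\boldsymbol e_z$. $L^p$ norms are over $V$. Taylor model (inviscid, inertialess), with positive parameters $\Lambda, Ra, Rm$: unknown velocity $\boldsymbol u$, magnetic field $\boldsymbol B$, pressure $P$, temperature $T$, satisfying $$\boldsymbol e_z\times\boldsymbol u+\nabla P=\Lambda(\nabla\times\boldsymbol B)\times\boldsymbol B+Ra\,T\boldsymbol e_z,\quad \nabla\cdot\boldsymbol u=0,\quad \partial_t\boldsymbol B-\nabla\times(\boldsymbol u\times\boldsymbol B)=\tfrac1{Rm}\nabla^2\boldsymbol B,\quad \nabla\cdot\boldsymbol B=0,$$ with boundary conditions $\boldsymbol u\cdot\boldsymbol n_\pm=0$ (no penetration) and $\boldsymbol B\times\boldsymbol n_\pm=0$ (ferromagnetic) on $S_\pm$. No evolution equation for $T$ is assumed; $T$ is a smooth function, periodic in $x,y$. Magnetic flux is exact if $\int_{S_\pm}\boldsymbol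 n_\pm\cdot\boldsymbol B\,\mathrm dS_\pm=0$. $\overline T(x,y,z)=\int_0^zT(x,y,z')\,\mathrm dz'$, and $\nabla_{x,y}=(\partial_x,\partial_y)$. Constants: $\lambda_1=\min\{\pi,2\pi/L_x,2\pi/L_y\}$, $C_{\mathrm P}=1/\lambda_1$, $C_3=\frac{2^{2/3}}{\pi^{2/3}\sqrt3}$, $C_{\mathrm S}=2\sqrt2\,C_3\Big(1+\frac{\sqrt{1+L_x^{-2}+L_y^{-2}}}{\lambda_1}\Big)$, and $A_p=C_{\mathrm P}^{(p-3)/p}C_{\mathrm S}^{3/p}$ for $3\le p\le\infty$ (so $A_3=C_{\mathrm S}$, $A_\infty=C_{\mathrm P}$). *)

theory Defs
  imports "HOL-Analysis.Analysis" "HOL-Probability.Essential_Supremum"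
begin

text \<open>
  \<open>C\<^sup>k\<close> regularity up to the boundary: all derivatives are derivatives within \<open>S\<close>, so they are
  one-sided at boundary points. This is meant for convex sets \<open>S\<close> with nonempty interior, where the
  derivative within \<open>S\<close> is unique.
\<close>

primrec Ck_on :: "nat \<Rightarrow> 'a::real_normed_vector set \<Rightarrow> ('a \<Rightarrow> 'b::real_normed_vector) \<Rightarrow> bool" where
  "Ck_on 0 S f \<longleftrightarrow> continuous_on S f"
| "Ck_on (Suc k) S f \<longleftrightarrow>
     (\<exists>f'. (\<forall>x\<in>S. (f has_derivative f' x) (at x within S)) \<and> (\<forall>v. Ck_on k S (\<lambda>x. f' x v)))"

definition smooth_on :: "'a::real_normed_vector set \<Rightarrow> ('a \<Rightarrow> 'b::real_normed_vector) \<Rightarrow> bool" where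
  "smooth_on S f \<longleftrightarrow> (\<forall>k. Ck_on k S f)"

text \<open>
  Fields that are periodic in \<open>x\<close> and \<open>y\<close> are functions on the layer \<open>slab\<close>; the domain \<open>V\<close> is one
  periodicity cell. Only values on \<open>slab\<close> matter.
\<close>

definition slab :: "(real^3) set" where
  "slab = {x. 0 \<le> x$3 \<and> x$3 \<le> 1}"

definition cell :: "real \<Rightarrow> real \<Rightarrow> (real^3) set" where
  "cell Lx Ly = cbox 0 (vector [Lx, Ly, 1])"

definition periodic_xy :: "real \<Rightarrow> real \<Rightarrow> (real^3 \<Rightarrow> 'b) \<Rightarrow> bool" where
  "periodic_xy Lx Ly f \<longleftrightarrow>
     (\<forall>x\<in>slab. f (x + Lx *\<^sub>R axis 1 1) = f x \<and> f (x + Ly *\<^sub>R axis 2 1) = f x)"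

abbreviation e_z :: "real^3" where
  "e_z \<equiv> axis 3 1"

text \<open>Spatial derivatives, one-sided in \<open>z\<close> on the two walls.\<close>

definition pd :: "3 \<Rightarrow> (real^3 \<Rightarrow> 'b::real_normed_vector) \<Rightarrow> real^3 \<Rightarrow> 'b" where
  "pd i f x = frechet_derivative f (at x within slab) (axis i 1)"

definition grad :: "(real^3 \<Rightarrow> real) \<Rightarrow> real^3 \<Rightarrow> real^3" where
  "grad f x = (\<chi> i. pd i f x)"

definition grad_xy :: "(real^3 \<Rightarrow> real) \<Rightarrow> real^3 \<Rightarrow> real^2" where
  "grad_xy f x = vector [pd 1 f x, pd 2 f x]"

definition divergence :: "(real^3 \<Rightarrow> real^3) \<Rightarrow> real^3 \<Rightarrow> real" where
  "divergence F x = (\<Sum>i\<in>UNIV. pd i (\<lambda>y. F y $ i) x)"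

definition curl :: "(real^3 \<Rightarrow> real^3) \<Rightarrow> real^3 \<Rightarrow> real^3" where
  "curl F x = vector
     [pd 2 (\<lambda>y. F y $ 3) x - pd 3 (\<lambda>y. F y $ 2) x,
      pd 3 (\<lambda>y. F y $ 1) x - pd 1 (\<lambda>y. F y $ 3) x,
      pd 1 (\<lambda>y. F y $ 2) x - pd 2 (\<lambda>y. F y $ 1) x]"

definition laplacian :: "(real^3 \<Rightarrow> 'b::real_normed_vector) \<Rightarrow> real^3 \<Rightarrow> 'b" where
  "laplacian F x = (\<Sum>i\<in>UNIV. pd i (pd i F) x)"

text \<open>
  Smooth solutions of the Taylor model on a time interval \<open>J\<close>. The interval may contain endpoints, at
  which the time derivative is one-sided. There is no evolution equation for the temperature \<open>T\<close>.
\<close>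

definition taylor_solution ::
  "real \<Rightarrow> real \<Rightarrow> real \<Rightarrow> real \<Rightarrow> real \<Rightarrow> real set \<Rightarrow> (real \<Rightarrow> real^3 \<Rightarrow> real^3) \<Rightarrow>
   (real \<Rightarrow> real^3 \<Rightarrow> real^3) \<Rightarrow> (real \<Rightarrow> real^3 \<Rightarrow> real) \<Rightarrow> (real \<Rightarrow> real^3 \<Rightarrow> real) \<Rightarrow> bool" where
  "taylor_solution Lx Ly \<Lambda> Ra Rm J u B P T \<longleftrightarrow>
     smooth_on (Sigma J (\<lambda>_. slab)) (\<lambda>(t, x). u t x) \<and>
     smooth_on (Sigma J (\<lambda>_. slab)) (\<lambda>(t, x). B t x) \<and>
     smooth_on (Sigma J (\<lambda>_. slab)) (\<lambda>(t, x). P t x) \<and>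
     smooth_on (Sigma J (\<lambda>_. slab)) (\<lambda>(t, x). T t x) \<and>
     (\<forall>t\<in>J. periodic_xy Lx Ly (u t) \<and> periodic_xy Lx Ly (B t) \<and>
            periodic_xy Lx Ly (P t) \<and> periodic_xy Lx Ly (T t)) \<and>
     (\<forall>t\<in>J. \<forall>x\<in>slab.
        cross3 e_z (u t x) + grad (P t) x
          = \<Lambda> *\<^sub>R cross3 (curl (B t) x) (B t x) + (Ra * T t x) *\<^sub>R e_z \<and>
        divergence (u t) x = 0 \<and>
        vector_derivative (\<lambda>s. B s x) (at t within J) - curl (\<lambda>y. cross3 (u t y) (B t y)) x
          = (1 / Rm) *\<^sub>R laplacian (B t) x \<and>
        divergence (B t) x = 0) \<and>
     (\<forall>t\<in>J. \<forall>x. x$3 = 1 \<longrightarrow> u t x \<bullet> e_z = 0 \<and> cross3 (B t x) e_z = 0) \<and>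
     (\<forall>t\<in>J. \<forall>x. x$3 = 0 \<longrightarrow> u t x \<bullet> (- e_z) = 0 \<and> cross3 (B t x) (- e_z) = 0)"

definition flux_exact :: "real \<Rightarrow> real \<Rightarrow> (real^3 \<Rightarrow> real^3) \<Rightarrow> bool" where
  "flux_exact Lx Ly b \<longleftrightarrow>
     integral (cbox 0 (vector [Lx, Ly]) :: (real^2) set)
       (\<lambda>w. e_z \<bullet> b (vector [w$1, w$2, 1])) = 0 \<and>
     integral (cbox 0 (vector [Lx, Ly]) :: (real^2) set)
       (\<lambda>w. (- e_z) \<bullet> b (vector [w$1, w$2, 0])) = 0"

definition magnetic_energy :: "real \<Rightarrow> real \<Rightarrow> (real^3 \<Rightarrow> real^3) \<Rightarrow> real" where
  "magnetic_energy Lx Ly b = 1 / 2 * integral (cell Lx Ly) (\<lambda>x. (norm (b x))\<^sup>2)"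

definition Tbar :: "(real^3 \<Rightarrow> real) \<Rightarrow> real^3 \<Rightarrow> real" where
  "Tbar T x = integral {0..x$3} (\<lambda>s. T (vector [x$1, x$2, s]))"

text \<open>
  Real-valued, hence meaningful only for functions whose norm is finite, such as functions that are
  continuous on a compact \<open>S\<close>.
\<close>

definition Lp_norm ::
  "ereal \<Rightarrow> 'a::euclidean_space set \<Rightarrow> ('a \<Rightarrow> 'b::real_normed_vector) \<Rightarrow> real" where
  "Lp_norm p S f =
     (if p = \<infinity> then real_of_ereal (esssup (lebesgue_on S) (\<lambda>x. ereal (norm (f x))))
      else (integral S (\<lambda>x. norm (f x) powr real_of_ereal p)) powr (1 / real_of_ereal p))"

definition lambda1 :: "real \<Rightarrow> real \<Rightarrow> real" where
  "lambda1 Lx Ly = Min {pi, 2 * pi / Lx, 2 * pi / Ly}"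

definition C_P :: "real \<Rightarrow> real \<Rightarrow> real" where
  "C_P Lx Ly = 1 / lambda1 Lx Ly"

definition C_3 :: real where
  "C_3 = 2 powr (2/3) / (pi powr (2/3) * sqrt 3)"

definition C_S :: "real \<Rightarrow> real \<Rightarrow> real" where
  "C_S Lx Ly = 2 * sqrt 2 * C_3 * (1 + sqrt (1 + 1 / Lx\<^sup>2 + 1 / Ly\<^sup>2) / lambda1 Lx Ly)"

definition A_const :: "real \<Rightarrow> real \<Rightarrow> ereal \<Rightarrow> real" where
  "A_const Lx Ly p =
     (if p = \<infinity> then C_P Lx Ly
      else C_P Lx Ly powr ((real_of_ereal p - 3) / real_of_ereal p) *
           C_S Lx Ly powr (3 / real_of_ereal p))"

end

theory Submission
  imports Defs
begin

text \<open>
  The Lorentz force does work \<open>Ra \<integral> T u\<^sub>z\<close> (up to \<open>\<Lambda>\<close>), and \<open>T = \<partial>\<^sub>z Tbar\<close> turns this into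
  \<open>- Ra \<integral> u \<bullet> g\<close> with \<open>g = \<nabla>\<^sub>x\<^sub>y Tbar\<close>, because \<open>u\<close> is solenoidal and does not penetrate the walls. The
  horizontal momentum balance expresses the horizontal velocity by the Lorentz force and the
  geostrophic velocity; the latter contributes the integral of a Jacobian of \<open>P\<close> and \<open>Tbar\<close>, which
  vanishes by periodicity. With \<open>j = curl B\<close> the magnetic energy therefore grows at most at the rate
  \<open>Ra \<integral> |j| |B| |g| - \<integral> |j|\<^sup>2 / Rm\<close>, and Hoelder's inequality together with
  \<open>\<parallel>B\<parallel>\<^sub>2 \<le> C\<^sub>P \<parallel>j\<parallel>\<^sub>2\<close> and \<open>\<parallel>B\<parallel>\<^sub>6 \<le> C\<^sub>S \<parallel>j\<parallel>\<^sub>2\<close> gives the claim.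

  Both inequalities are proved for each component of \<open>B\<close>. The horizontal components vanish on the
  walls, and the vertical one has mean zero on every horizontal plane by exactness of the flux. The
  constant \<open>C\<^sub>S\<close> stems from the sharp Sobolev inequality on the whole space and a cut-off; it is generous
  enough to be reached by the Gagliardo-Nirenberg argument (Loomis-Whitney applied to \<open>B\<^sub>i\<^sup>4\<close>) on the cell
  itself, without any extension.
\<close>

section \<open>Inequalities in one dimension\<close>

text \<open>The rotation term makes the momentum balance solvable for the horizontal velocity: with
  \<open>F = cross3 (curl B) B\<close> it reads \<open>u$1 = \<Lambda> * F$2 - pd 2 P\<close> and
  \<open>u$2 = pd 1 P - \<Lambda> * F$1\<close>. The vertical velocity admits no such formula, which
  is why the buoyancy work is moved to the horizontal derivatives of \<open>Tbar\<close>. Only first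
  derivatives of \<open>Tbar\<close> are at hand, so the second derivatives needed for the Jacobian
  are put on \<open>P\<close>. The obstacle is numerical. The Gagliardo-Nirenberg argument bounds
  the cube of the L6 norm by a product of three factors, one per coordinate, each made of a mean
  term and a variation term, and this product has to stay below \<open>C_S^3\<close> for all
  \<open>Lx\<close> and \<open>Ly\<close>. Since \<open>(2 * sqrt 2 * C_3)^3\<close> barely exceeds
  1.764, the line bounds must not be wasteful: equal end values halve the variation, and vanishing
  end values remove the mean as well. Only the vertical factor of the vertical component keeps the
  full variation. The mean terms are absorbed by Poincare's inequality, which is the origin of the
  summand with \<open>lambda1\<close> in the comparison with \<open>C_S\<close>.\<close>

lemma integral_abs_derivative_ge:
  fixes g g' :: "real \<Rightarrow> real"
  assumes g: "\<And>s. s \<in> {0..L} \<Longrightarrow> (g has_real_derivative g' s) (at s within {0..L})"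
    and c: "continuous_on {0..L} g'" and ab: "0 \<le> a" "a \<le> b" "b \<le> L"
  shows "\<bar>g b - g a\<bar> \<le> integral {a..b} (\<lambda>s. \<bar>g' s\<bar>)"
proof -
  have sub: "{a..b} \<subseteq> {0..L}" using ab by auto
  have "(g' has_integral (g b - g a)) {a..b}"
  proof (rule fundamental_theorem_of_calculus)
    fix s assume "s \<in> {a..b}"
    then show "(g has_vector_derivative g' s) (at s within {a..b})"
      using g[of s] sub DERIV_subset has_real_derivative_iff_has_vector_derivative by blast
  qed (use ab in auto)
  moreover have "norm (integral {a..b} g') \<le> integral {a..b} (\<lambda>s. norm (g' s))"
    by (intro integral_norm_bound_integral integrable_continuous_real continuous_intros
         continuous_on_subset[OF c sub]) auto
  ultimately show ?thesis by (simp add: integral_unique)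
qed

text \<open>Two values of \<open>g\<close> differ by at most the variation between the two points.
  If the end values agree, the interval closes up to a circle, and the shorter of the two arcs
  carries at most half of the variation. Averaging over the second point produces the mean; with
  vanishing end values the comparison with an end point replaces it.\<close>

lemma sup_le_mean_plus_variation:
  fixes g g' :: "real \<Rightarrow> real"
  assumes L: "L > 0"
    and g: "\<And>s. s \<in> {0..L} \<Longrightarrow> (g has_real_derivative g' s) (at s within {0..L})"
    and c: "continuous_on {0..L} g'" and s: "s \<in> {0..L}"
  shows "g s \<le> 1 / L * integral {0..L} g + integral {0..L} (\<lambda>s. \<bar>g' s\<bar>)"
    and "g 0 = g L \<Longrightarrow> g s \<le> 1 / L * integral {0..L} g + 1 / 2 * integral {0..L} (\<lambda>s. \<bar>g' s\<bar>)"
    and "g 0 = 0 \<Longrightarrow> g L = 0 \<Longrightarrow> g s \<le> 1 / 2 * integral {0..L} (\<lambda>s. \<bar>g' s\<bar>)"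
proof -
  let ?I = "\<lambda>a b. integral {a..b} (\<lambda>s. \<bar>g' s\<bar>)"
  have bd: "\<bar>g b - g a\<bar> \<le> ?I a b" if "0 \<le> a" "a \<le> b" "b \<le> L" for a b
    by (rule integral_abs_derivative_ge[where L = L]) (simp_all add: g c that)
  have int: "(\<lambda>s. \<bar>g' s\<bar>) integrable_on {0..L}"
    by (intro integrable_continuous_real continuous_intros c)
  have split: "?I 0 a + ?I a b + ?I b L = ?I 0 L" if "0 \<le> a" "a \<le> b" "b \<le> L" for a b
  proof -
    have "?I 0 a + ?I a L = ?I 0 L"
      by (rule Henstock_Kurzweil_Integration.integral_combine) (use that int in auto)
    moreover have "?I a b + ?I b L = ?I a L"
      by (rule Henstock_Kurzweil_Integration.integral_combine)
         (use that in \<open>auto intro!: integrable_on_subinterval[OF int]\<close>)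
    ultimately show ?thesis by simp
  qed
  have nonneg: "0 \<le> ?I a b" if "0 \<le> a" "b \<le> L" for a b
    by (rule Henstock_Kurzweil_Integration.integral_nonneg)
       (use that in \<open>auto intro!: integrable_on_subinterval[OF int]\<close>)
  have osc: "\<bar>g b - g a\<bar> \<le> ?I 0 L" if "0 \<le> a" "a \<le> b" "b \<le> L" for a b
    using bd[OF that] split[OF that] nonneg[of 0 a] nonneg[of b L] that by simp
  have osc2: "\<bar>g b - g a\<bar> \<le> 1 / 2 * ?I 0 L" if "g 0 = g L" "0 \<le> a" "a \<le> b" "b \<le> L" for a b
    using bd[OF that(2-4)] split[OF that(2-4)] bd[of 0 a] bd[of b L] that by linarith
  have avg: "g s \<le> 1 / L * integral {0..L} g + K" if K: "\<And>t. t \<in> {0..L} \<Longrightarrow> g s - g t \<le> K" for K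
  proof -
    have gi: "g integrable_on {0..L}"
      by (intro integrable_continuous_real DERIV_continuous_on[OF g])
    have "integral {0..L} (\<lambda>t. g s - K) \<le> integral {0..L} g"
      by (rule integral_le) (use gi K in \<open>auto simp: algebra_simps\<close>)
    then show ?thesis using L by (simp add: field_simps)
  qed
  show "g s \<le> 1 / L * integral {0..L} g + ?I 0 L"
  proof (rule avg)
    fix t assume t: "t \<in> {0..L}"
    show "g s - g t \<le> ?I 0 L" using osc[of s t] osc[of t s] s t by (cases "s \<le> t") auto
  qed
  show "g s \<le> 1 / L * integral {0..L} g + 1 / 2 * ?I 0 L" if "g 0 = g L"
  proof (rule avg)
    fix t assume t: "t \<in> {0..L}"
    show "g s - g t \<le> 1 / 2 * ?I 0 L" using osc2[OF that, of s t] osc2[OF that, of t s] s t unfolding atLeastAtMost_iff by linarith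
  qed
  show "g s \<le> 1 / 2 * ?I 0 L" if "g 0 = 0" "g L = 0"
    using osc2[of 0 s] s that by simp
qed

text \<open>Dividing numerator and denominator by \<open>s - c\<close> turns both into difference
  quotients. This removes the singularities of \<open>f / sin\<close> at the ends of the interval in
  the Dirichlet inequality below.\<close>

lemma tendsto_quotient_of_zeros:
  fixes f g :: "real \<Rightarrow> real"
  assumes f: "(f has_real_derivative f') (at c within S)" and g: "(g has_real_derivative g') (at c within S)"
    and z: "f c = 0" "g c = 0" "g' \<noteq> 0"
  shows "((\<lambda>s. f s / g s) \<longlongrightarrow> f' / g') (at c within S)"
proof -
  have "((\<lambda>s. (f s - f c) / (s - c) / ((g s - g c) / (s - c))) \<longlongrightarrow> f' / g') (at c within S)"
    using f g z(3) unfolding has_field_derivative_iff by (intro tendsto_divide)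
  then show ?thesis
    by (rule Lim_transform_within[OF _ zero_less_one]) (use z in auto)
qed

text \<open>
  With \<open>k = \<pi> / (b - a)\<close> and \<open>H s = k cot (k (s - a)) (f s)\<^sup>2\<close> one has
  \<open>(f')\<^sup>2 - k\<^sup>2 f\<^sup>2 = (f' - k cot (k (s - a)) f)\<^sup>2 + H'\<close>, and \<open>H\<close> vanishes at both ends
  (where \<open>cot\<close> has the junk value 0).
\<close>

lemma wirtinger_dirichlet:
  fixes f f' :: "real \<Rightarrow> real"
  assumes ab: "a < b"
    and f: "\<And>s. s \<in> {a..b} \<Longrightarrow> (f has_real_derivative f' s) (at s within {a..b})"
    and c: "continuous_on {a..b} f'" and z: "f a = 0" "f b = 0"
  shows "integral {a..b} (\<lambda>s. (f s)\<^sup>2) \<le> ((b - a) / pi)\<^sup>2 * integral {a..b} (\<lambda>s. (f' s)\<^sup>2)"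
proof -
  define k where "k = pi / (b - a)"
  have k: "k > 0" "k * (b - a) = pi" using ab by (auto simp: k_def)
  define H where "H s = k * (cos (k * (s - a)) * (f s * (f s / sin (k * (s - a)))))" for s
  \<comment> \<open>Inside the interval this is the derivative of \<open>H\<close>. At the end
    points the fundamental theorem leaves the value free, and the choice made here turns
    \<open>le\<close> below into an equality there.\<close>
  define h where "h s = (if s \<in> {a<..<b} then
     2 * k * cos (k * (s - a)) / sin (k * (s - a)) * f s * f' s - (k * f s / sin (k * (s - a)))\<^sup>2
     else (f' s)\<^sup>2 - (k * f s)\<^sup>2)" for s
  have pos: "sin (k * (s - a)) > 0" if "s \<in> {a<..<b}" for s
  proof (rule sin_gt_zero)
    show "0 < k * (s - a)" using that k by simp
    have "k * (s - a) < k * (b - a)" by (rule mult_strict_left_mono) (use that k in auto)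
    then show "k * (s - a) < pi" using k by simp
  qed
  have fc: "continuous_on {a..b} f" by (rule DERIV_continuous_on[OF f])
  have lim: "(H \<longlongrightarrow> 0) (at c within {a..b})" if "c = a \<or> c = b" for c
  proof -
    let ?S = "{a..b}"
    have cS: "c \<in> ?S" "f c = 0" using that z ab by auto
    have sc: "sin (k * (c - a)) = 0" and kc: "k * cos (k * (c - a)) \<noteq> 0" using that k by auto
    have ds: "((\<lambda>s. sin (k * (s - a))) has_real_derivative k * cos (k * (c - a))) (at c within ?S)"
      by (auto intro!: derivative_eq_intros)
    have q: "((\<lambda>s. f s / sin (k * (s - a))) \<longlongrightarrow> f' c / (k * cos (k * (c - a)))) (at c within ?S)"
      by (rule tendsto_quotient_of_zeros[OF f[OF cS(1)] ds cS(2) sc kc])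
    have f0: "(f \<longlongrightarrow> 0) (at c within ?S)" using fc cS by (metis continuous_on_def)
    have "(H \<longlongrightarrow> k * (cos (k * (c - a)) * (0 * (f' c / (k * cos (k * (c - a))))))) (at c within ?S)"
      unfolding H_def by (intro tendsto_intros q f0)
    then show ?thesis by simp
  qed
  have Hz: "H a = 0" "H b = 0" using z by (auto simp: H_def)
  have dH: "(H has_real_derivative h s) (at s)" if s: "s \<in> {a<..<b}" for s
  proof -
    have fs: "(f has_real_derivative f' s) (at s)"
    proof -
      have "(f has_real_derivative f' s) (at s within {a<..<b})"
        using f[of s] s by (auto intro: DERIV_subset)
      then show ?thesis by (metis at_within_open open_greaterThanLessThan s)
    qed
    have nz: "sin (k * (s - a)) \<noteq> 0" using pos[OF s] by simp
    \<comment> \<open>Writing \<open>r\<close> for the reciprocal of the sine makes the derivative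
      of \<open>H\<close> a polynomial identity modulo \<open>S * r = 1\<close> and
      \<open>C * C = 1 - S * S\<close>.\<close>
    define S C r where "S = sin (k * (s - a))" and "C = cos (k * (s - a))" and "r = 1 / S"
    have Sr: "S * r = 1" using nz by (simp add: S_def r_def)
    have SC: "C * C = 1 - S * S" using sin_cos_squared_add[of "k * (s - a)"]
      by (simp add: S_def C_def power2_eq_square)
    have "((\<lambda>s. cos (k * (s - a))) has_real_derivative - (k * S)) (at s)"
      "((\<lambda>s. sin (k * (s - a))) has_real_derivative k * C) (at s)"
      unfolding S_def C_def by (auto intro!: derivative_eq_intros)
    note dS = this
    have "((\<lambda>s. f s / sin (k * (s - a))) has_real_derivative (f' s * S - f s * (k * C)) / (S * S)) (at s)"
      using DERIV_divide[OF fs dS(2) nz] by (simp add: S_def)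
    from DERIV_cmult[OF DERIV_mult[OF dS(1) DERIV_mult[OF fs this]], of k]
    have "(H has_real_derivative k * (- (k * S) * (f s * (f s / S))
        + C * (f' s * (f s / S) + f s * ((f' s * S - f s * (k * C)) / (S * S))))) (at s)"
      by (simp add: H_def[abs_def] S_def C_def algebra_simps)
    moreover have "k * (- (k * S) * (f s * (f s / S))
        + C * (f' s * (f s / S) + f s * ((f' s * S - f s * (k * C)) / (S * S)))) =
        k * (- (k * S) * (f s * (f s * r)) + C * (f' s * (f s * r) + f s * ((f' s * S - f s * (k * C)) * (r * r))))"
      by (simp add: r_def)
    moreover have "\<dots> = 2 * (k * C * r * f s * f' s) - (k * f s * r) * (k * f s * r)"
    proof -
      have "k * (- (k * S) * (f s * (f s * r)) + C * (f' s * (f s * r) + f s * ((f' s * S - f s * (k * C)) * (r * r))))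
        = k * C * r * f s * f' s * (1 + S * r) - k * k * f s * f s * (S * r + (C * C) * (r * r))"
        by (simp add: algebra_simps)
      also have "(C * C) * (r * r) = r * r - (S * r) * (S * r)" unfolding SC by (simp add: algebra_simps)
      finally show ?thesis unfolding Sr by (simp add: algebra_simps)
    qed
    moreover have "h s = 2 * (k * C * r * f s * f' s) - (k * f s * r) * (k * f s * r)"
      using s by (simp add: h_def r_def S_def C_def power2_eq_square)
    ultimately show ?thesis by (simp only:)
  qed
  have Hc: "continuous_on {a..b} H"
    unfolding continuous_on_def
  proof
    fix s assume s: "s \<in> {a..b}"
    show "(H \<longlongrightarrow> H s) (at s within {a..b})"
    proof (cases "s = a \<or> s = b")
      case True then show ?thesis using lim[OF True] Hz by auto
    next
      case False
      then have "isCont H s" using dH[of s] s DERIV_isCont by force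
      then show ?thesis by (meson continuous_at_imp_continuous_within continuous_within)
    qed
  qed
  have "(h has_integral (H b - H a)) {a..b}"
    by (rule fundamental_theorem_of_calculus_interior)
       (use ab Hc dH in \<open>auto simp: has_real_derivative_iff_has_vector_derivative\<close>)
  then have h0: "(h has_integral 0) {a..b}" using Hz by simp
  have le: "h s \<le> (f' s)\<^sup>2 - (k * f s)\<^sup>2" for s
  proof (cases "s \<in> {a<..<b}")
    case True
    define S C where "S = sin (k * (s - a))" and "C = cos (k * (s - a))"
    have S: "S \<noteq> 0" using pos[OF True] by (simp add: S_def)
    have SC: "C\<^sup>2 = 1 - S\<^sup>2" by (simp add: S_def C_def cos_squared_eq)
    have eq: "(f' s)\<^sup>2 - (k * f s)\<^sup>2 - h s = (f' s - k * C / S * f s)\<^sup>2"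
    proof -
      have "(C / S)\<^sup>2 = (1 / S)\<^sup>2 - 1"
        using S SC by (simp add: power_divide field_simps)
      then have "(k * f s)\<^sup>2 * (C / S)\<^sup>2 = (k * f s)\<^sup>2 * ((1 / S)\<^sup>2 - 1)" by simp
      then have "(k * C / S * f s)\<^sup>2 = (k * f s / S)\<^sup>2 - (k * f s)\<^sup>2"
        by (simp add: power_mult_distrib power_divide right_diff_distrib mult.commute mult.left_commute)
      then show ?thesis using True
        by (simp add: h_def S_def[symmetric] C_def[symmetric] power2_diff)
    qed
    have "0 \<le> (f' s - k * C / S * f s)\<^sup>2" by simp
    then show ?thesis using eq by linarith
  qed (auto simp: h_def)
  have i1: "(\<lambda>s. (f' s)\<^sup>2) integrable_on {a..b}" and i2: "(\<lambda>s. (f s)\<^sup>2) integrable_on {a..b}"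
    by (intro integrable_continuous_real continuous_intros c fc)+
  have i3: "(\<lambda>s. k\<^sup>2 * (f s)\<^sup>2) integrable_on {a..b}"
    by (intro integrable_continuous_real continuous_intros fc)
  have "0 \<le> integral {a..b} (\<lambda>s. (f' s)\<^sup>2 - k\<^sup>2 * (f s)\<^sup>2)"
    by (rule has_integral_le[OF h0 integrable_integral[OF integrable_diff[OF i1 i3]]])
       (use le in \<open>simp add: power_mult_distrib\<close>)
  also have "\<dots> = integral {a..b} (\<lambda>s. (f' s)\<^sup>2) - k\<^sup>2 * integral {a..b} (\<lambda>s. (f s)\<^sup>2)"
    using integral_diff[OF i1 i3] by simp
  finally have "k\<^sup>2 * integral {a..b} (\<lambda>s. (f s)\<^sup>2) \<le> integral {a..b} (\<lambda>s. (f' s)\<^sup>2)" by simp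
  then have "(1 / k)\<^sup>2 * (k\<^sup>2 * integral {a..b} (\<lambda>s. (f s)\<^sup>2)) \<le> (1 / k)\<^sup>2 * integral {a..b} (\<lambda>s. (f' s)\<^sup>2)"
    by (rule mult_left_mono) simp
  moreover have "(1 / k)\<^sup>2 * k\<^sup>2 = 1" using k by (simp add: field_simps)
  moreover have "1 / k = (b - a) / pi" by (simp add: k_def)
  ultimately show ?thesis by (simp add: mult.assoc[symmetric])
qed

lemma integral_periodic_shift:
  fixes g :: "real \<Rightarrow> real"
  assumes c: "continuous_on UNIV g" and per: "\<And>s. g (s + L) = g s" and a: "0 \<le> a" "a \<le> L"
  shows "integral {a..a+L} g = integral {0..L} g"
proof -
  have i: "g integrable_on {x..y}" for x y
    by (rule integrable_continuous_real[OF continuous_on_subset[OF c]]) simp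
  have "integral {0..a} g + integral {a..L} g = integral {0..L} g"
    by (rule Henstock_Kurzweil_Integration.integral_combine) (use a i in auto)
  moreover have "integral {a..L} g + integral {L..a+L} g = integral {a..a+L} g"
    by (rule Henstock_Kurzweil_Integration.integral_combine) (use a i in auto)
  moreover have "integral {L..a+L} g = integral {0..a} (\<lambda>s. g (s + L))"
    using integral_shift_Icc_real[of 0 a g L] by (simp add: o_def add.commute[of L])
  ultimately show ?thesis using per by simp
qed

text \<open>By the intermediate value theorem \<open>f\<close> takes the same value at two points half a period apart;
  after subtracting this value the Dirichlet inequality applies to both half periods.\<close>

lemma wirtinger_periodic:
  fixes f f' :: "real \<Rightarrow> real"
  assumes L: "L > 0"
    and f: "\<And>s. (f has_real_derivative f' s) (at s)"
    and c: "continuous_on UNIV f'" and per: "\<And>s. f (s + L) = f s"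
  shows "integral {0..L} (\<lambda>s. (f s)\<^sup>2)
    \<le> (L / (2 * pi))\<^sup>2 * integral {0..L} (\<lambda>s. (f' s)\<^sup>2) + 1 / L * (integral {0..L} f)\<^sup>2"
proof -
  have fc: "continuous_on X f" for X using f DERIV_isCont continuous_at_imp_continuous_on by blast
  have fc': "continuous_on X f'" for X using c continuous_on_subset by blast
  have per': "f' (s + L) = f' s" for s
  proof -
    have "((\<lambda>x. f (x + L)) has_real_derivative f' (s + L)) (at s)"
      using f[of "s + L"] DERIV_shift by blast
    then show ?thesis using f[of s] per DERIV_unique by auto
  qed
  have "\<exists>a. 0 \<le> a \<and> a \<le> L / 2 \<and> f (a + L / 2) - f a = 0"
  proof -
    have c2: "continuous_on {0..L/2} (\<lambda>a. f (a + L / 2) - f a)"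
      by (intro continuous_intros continuous_on_compose2[OF fc[of UNIV]]) auto
    have e: "f (L / 2 + L / 2) = f 0" using per[of 0] by simp
    show ?thesis
    proof (cases "f (L / 2) - f 0 \<le> 0")
      case True
      then show ?thesis using IVT'[of "\<lambda>a. f (a + L / 2) - f a" 0 0 "L / 2"] L c2 e by auto
    next
      case False
      then show ?thesis using IVT2'[of "\<lambda>a. f (a + L / 2) - f a" "L / 2" 0 0] L c2 e by auto
    qed
  qed
  then obtain a where a: "0 \<le> a" "a \<le> L / 2" "f (a + L / 2) = f a" by auto
  define g where "g s = f s - f a" for s
  have g: "(g has_real_derivative f' s) (at s)" for s
    unfolding g_def by (auto intro!: derivative_eq_intros f)
  have half: "integral {x..x+L/2} (\<lambda>s. (g s)\<^sup>2) \<le> (L / (2 * pi))\<^sup>2 * integral {x..x+L/2} (\<lambda>s. (f' s)\<^sup>2)"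
    if "g x = 0" "g (x + L / 2) = 0" for x
    using wirtinger_dirichlet[of x "x + L / 2" g f'] that L g fc'
    by (simp add: has_field_derivative_at_within)
  have gz: "g a = 0" "g (a + L / 2) = 0" "g (a + L) = 0" using a per[of a] by (auto simp: g_def)
  have ci: "continuous_on X (\<lambda>s. (g s)\<^sup>2)" "continuous_on X (\<lambda>s. (f' s)\<^sup>2)" for X
    unfolding g_def by (intro continuous_intros fc fc')+
  have split: "integral {a..a+L/2} h + integral {a+L/2..a+L} h = integral {a..a+L} h"
    if "\<And>X. continuous_on X h" for h :: "real \<Rightarrow> real"
    by (rule Henstock_Kurzweil_Integration.integral_combine)
       (use L that in \<open>auto intro!: integrable_continuous_real\<close>)
  have "integral {a..a+L} (\<lambda>s. (g s)\<^sup>2) \<le> (L / (2 * pi))\<^sup>2 * integral {a..a+L} (\<lambda>s. (f' s)\<^sup>2)"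
  proof -
    have e2: "a + L / 2 + L / 2 = a + L" by simp
    show ?thesis
      using half[of a] half[of "a + L / 2", unfolded e2] gz split[OF ci(1)] split[OF ci(2)]
        distrib_left[of "(L / (2 * pi))\<^sup>2" "integral {a..a+L/2} (\<lambda>s. (f' s)\<^sup>2)" "integral {a+L/2..a+L} (\<lambda>s. (f' s)\<^sup>2)"]
      by simp
  qed
  moreover have "integral {a..a+L} (\<lambda>s. (g s)\<^sup>2) = integral {0..L} (\<lambda>s. (g s)\<^sup>2)"
    using a per L by (intro integral_periodic_shift ci) (auto simp: g_def)
  moreover have "integral {a..a+L} (\<lambda>s. (f' s)\<^sup>2) = integral {0..L} (\<lambda>s. (f' s)\<^sup>2)"
    using a per' L by (intro integral_periodic_shift ci) auto
  moreover have "integral {0..L} (\<lambda>s. (g s)\<^sup>2)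
      = integral {0..L} (\<lambda>s. (f s)\<^sup>2) - 2 * f a * integral {0..L} f + L * (f a)\<^sup>2"
  proof -
    have "integral {0..L} (\<lambda>s. (g s)\<^sup>2) = integral {0..L} (\<lambda>s. (f s)\<^sup>2 - 2 * f a * f s + (f a)\<^sup>2)"
      by (simp add: g_def power2_diff algebra_simps)
    also have "\<dots> = integral {0..L} (\<lambda>s. (f s)\<^sup>2) - integral {0..L} (\<lambda>s. 2 * f a * f s) + integral {0..L} (\<lambda>s. (f a)\<^sup>2)"
      by (subst integral_add integral_diff;
          (intro integrable_continuous_real continuous_intros fc)?)+ simp
    finally show ?thesis using L by simp
  qed
  \<comment> \<open>This square eliminates the unknown value \<open>f a\<close>: what remains after
    it is exactly the mean term of the claim.\<close>
  moreover have "0 \<le> 1 / L * (integral {0..L} f - L * f a)\<^sup>2" using L by simp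
  then have "0 \<le> 1 / L * (integral {0..L} f)\<^sup>2 - 2 * f a * integral {0..L} f + L * (f a)\<^sup>2"
    using L by (simp add: power2_diff field_simps power2_eq_square)
  ultimately have "integral {0..L} (\<lambda>s. (f s)\<^sup>2) - 2 * f a * integral {0..L} f + L * (f a)\<^sup>2
      \<le> (L / (2 * pi))\<^sup>2 * integral {0..L} (\<lambda>s. (f' s)\<^sup>2)"
    "0 \<le> 1 / L * (integral {0..L} f)\<^sup>2 - 2 * f a * integral {0..L} f + L * (f a)\<^sup>2"
    by simp_all
  then show ?thesis by linarith
qed

section \<open>Line integrals and Fubini's theorem on the cell\<close>

text \<open>The coordinate line through \<open>x\<close> is \<open>s \<mapsto> upd x i s\<close>.
  Slices, line integrals and their iterates thereby stay functions on \<open>real^3\<close>, with no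
  splitting of the space into factors.\<close>

definition upd :: "real^3 \<Rightarrow> 3 \<Rightarrow> real \<Rightarrow> real^3" where
  "upd x i s = (\<chi> j. if j = i then s else x $ j)"

lemma upd_nth [simp]: "upd x i s $ j = (if j = i then s else x $ j)"
  by (simp add: upd_def)

lemma upd_upd [simp]: "upd (upd x i a) i b = upd x i b"
  and upd_same [simp]: "upd x i (x $ i) = x"
  by (simp_all add: vec_eq_iff)

lemma upd_commute: "i \<noteq> j \<Longrightarrow> upd (upd x i a) j b = upd (upd x j b) i a"
  by (auto simp: vec_eq_iff)

lemma upd_add_axis: "x + h *\<^sub>R axis i 1 = upd x i (x $ i + h)"
  by (auto simp: vec_eq_iff axis_def)

lemma vector3_eq_upd: "vector [a, b, c] = upd (upd (upd x 3 c) 2 b) 1 a"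
  by (simp add: vec_eq_iff forall_3)

lemma continuous_on_upd [continuous_intros]:
  assumes "continuous_on X f" "continuous_on X g"
  shows "continuous_on X (\<lambda>p. upd (f p) i (g p))"
  unfolding upd_def
proof (rule continuous_on_vec_lambda)
  show "continuous_on X (\<lambda>p. if j = i then g p else f p $ j)" for j
    by (cases "j = i") (auto intro!: continuous_intros assms)
qed

lemma prod_UNIV_3: "prod f (UNIV :: 3 set) = (f 1 * f 2 * f 3 :: real)"
  unfolding UNIV_3 by (simp add: mult.assoc)

lemma exists_3: "(\<exists>i::3. P i) \<longleftrightarrow> P 1 \<or> P 2 \<or> P 3"
  by (metis exhaust_3)

text \<open>The coordinate bijection maps boxes to boxes of the same content. The transport to
  nested pairs opens the way to Fubini's theorem on product types.\<close>

lemma has_integral_vector3: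
  fixes f :: "real^3 \<Rightarrow> real"
  assumes "(f has_integral I) (cbox (vector [a1, a2, a3]) (vector [b1, b2, b3]))"
  shows "((\<lambda>(x, y, z). f (vector [x, y, z])) has_integral I) (cbox (a1, a2, a3) (b1, b2, b3))"
proof -
  let ?g = "\<lambda>(x, y, z). vector [x, y, z] :: real^3"
  let ?h = "\<lambda>v::real^3. (v $ 1, v $ 2, v $ 3)"
  have gi: "?g ` cbox u v = cbox (?g u) (?g v)" for u v :: "real \<times> real \<times> real"
  proof (intro equalityI subsetI)
    fix w assume "w \<in> cbox (?g u) (?g v)"
    then have "?h w \<in> cbox u v" "w = ?g (?h w)"
      by (cases u; cases v; auto simp: mem_box_cart forall_3 cbox_Pair_iff vec_eq_iff)+
    then show "w \<in> ?g ` cbox u v" by blast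
  qed (cases u; cases v; auto simp: mem_box_cart forall_3 cbox_Pair_iff)
  have hi: "?h ` cbox u v = cbox (?h u) (?h v)" for u v
  proof (intro equalityI subsetI)
    fix w assume "w \<in> cbox (?h u) (?h v)"
    then have "?g w \<in> cbox u v" "w = ?h (?g w)"
      by (cases w; auto simp: mem_box_cart forall_3 cbox_Pair_iff)+
    then show "w \<in> ?h ` cbox u v" by blast
  qed (auto simp: mem_box_cart forall_3 cbox_Pair_iff)
  have "((\<lambda>x. f (?g x)) has_integral (1 / 1) *\<^sub>R I) (?h ` cbox (vector [a1, a2, a3]) (vector [b1, b2, b3]))"
  proof (rule has_integral_twiddle[where h = ?h and g = ?g])
    have "continuous_on UNIV ?g"
      unfolding case_prod_beta
      by (intro continuous_on_componentwise[THEN iffD2]) (auto simp: Basis_vec_def inner_axis forall_3 intro!: continuous_intros)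
    then show "isCont ?g x" for x
      using continuous_on_eq_continuous_at[of UNIV ?g] by blast
    show "\<exists>w z. ?g ` cbox u v = cbox w z" for u v using gi by blast
    show "\<exists>w z. ?h ` cbox u v = cbox w z" for u v using hi by blast
    show "measure lborel (?g ` cbox u v) = 1 * measure lborel (cbox u v)" for u v
      unfolding gi by (cases u; cases v)
        (simp add: content_Pair content_cbox_if_cart interval_eq_empty_cart exists_3 prod_UNIV_3 content_real_if not_le not_less)
  qed (use assms in \<open>auto simp: vec_eq_iff forall_3\<close>)
  then show ?thesis by (simp add: hi case_prod_beta')
qed

lemma prod_UNIV_2: "prod f (UNIV :: 2 set) = (f 1 * f 2 :: real)"
  unfolding UNIV_2 by (simp add: mult.assoc)

lemma exists_2: "(\<exists>i::2. P i) \<longleftrightarrow> P 1 \<or> P 2"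
  by (metis exhaust_2)

lemma has_integral_vector2:
  fixes f :: "real^2 \<Rightarrow> real"
  assumes "(f has_integral I) (cbox (vector [a1, a2]) (vector [b1, b2]))"
  shows "((\<lambda>(x, y). f (vector [x, y])) has_integral I) (cbox (a1, a2) (b1, b2))"
proof -
  let ?g = "\<lambda>(x, y). vector [x, y] :: real^2"
  let ?h = "\<lambda>v::real^2. (v $ 1, v $ 2)"
  have gi: "?g ` cbox u v = cbox (?g u) (?g v)" for u v :: "real \<times> real"
  proof (intro equalityI subsetI)
    fix w assume "w \<in> cbox (?g u) (?g v)"
    then have "?h w \<in> cbox u v" "w = ?g (?h w)"
      by (cases u; cases v; auto simp: mem_box_cart forall_2 cbox_Pair_iff vec_eq_iff)+
    then show "w \<in> ?g ` cbox u v" by blast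
  qed (cases u; cases v; auto simp: mem_box_cart forall_2 cbox_Pair_iff)
  have hi: "?h ` cbox u v = cbox (?h u) (?h v)" for u v
  proof (intro equalityI subsetI)
    fix w assume "w \<in> cbox (?h u) (?h v)"
    then have "?g w \<in> cbox u v" "w = ?h (?g w)"
      by (cases w; auto simp: mem_box_cart forall_2 cbox_Pair_iff)+
    then show "w \<in> ?h ` cbox u v" by blast
  qed (auto simp: mem_box_cart forall_2 cbox_Pair_iff)
  have "((\<lambda>x. f (?g x)) has_integral (1 / 1) *\<^sub>R I) (?h ` cbox (vector [a1, a2]) (vector [b1, b2]))"
  proof (rule has_integral_twiddle[where h = ?h and g = ?g])
    have "continuous_on UNIV ?g"
      unfolding case_prod_beta
      by (intro continuous_on_componentwise[THEN iffD2]) (auto simp: Basis_vec_def inner_axis forall_2 intro!: continuous_intros)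
    then show "isCont ?g x" for x
      using continuous_on_eq_continuous_at[of UNIV ?g] by blast
    show "\<exists>w z. ?g ` cbox u v = cbox w z" for u v using gi by blast
    show "\<exists>w z. ?h ` cbox u v = cbox w z" for u v using hi by blast
    show "measure lborel (?g ` cbox u v) = 1 * measure lborel (cbox u v)" for u v
      unfolding gi by (cases u; cases v)
        (simp add: content_Pair content_cbox_if_cart interval_eq_empty_cart exists_2 prod_UNIV_2 content_real_if not_le not_less)
  qed (use assms in \<open>auto simp: vec_eq_iff forall_2\<close>)
  then show ?thesis by (simp add: hi case_prod_beta')
qed

section \<open>Iterated line integrals over the periodicity cell\<close>

locale layer =
  fixes Lx Ly :: real
  assumes Lx: "Lx > 0" and Ly: "Ly > 0"
begin

definition L :: "real^3" where "L = vector [Lx, Ly, 1]"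

abbreviation V :: "(real^3) set" where "V \<equiv> cell Lx Ly"

lemma L_nth [simp]: "L $ 1 = Lx" "L $ 2 = Ly" "L $ 3 = 1"
  by (simp_all add: L_def)

lemma L_pos: "L $ i > 0"
  using exhaust_3[of i] Lx Ly by auto

lemma mem_V: "x \<in> V \<longleftrightarrow> (\<forall>i. 0 \<le> x $ i \<and> x $ i \<le> L $ i)"
  by (simp add: cell_def L_def[symmetric] mem_box_cart)

lemma upd_V: "x \<in> V \<Longrightarrow> 0 \<le> s \<Longrightarrow> s \<le> L $ i \<Longrightarrow> upd x i s \<in> V"
  by (auto simp: mem_V)

lemma V_slab: "V \<subseteq> slab"
  by (auto simp: mem_V slab_def dest!: spec[of _ 3])

lemma zero_V: "0 \<in> V"
  using L_pos by (auto simp: mem_V less_imp_le)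

lemma integrable_V: "continuous_on V f \<Longrightarrow> (f :: real^3 \<Rightarrow> real) integrable_on V"
  unfolding cell_def by (rule integrable_continuous)

text \<open>The partial integral in direction \<open>i\<close> is again a function on
  \<open>real^3\<close>, constant along that direction, so iterated integrals in any order are
  compositions of these operators.\<close>

definition LI :: "3 \<Rightarrow> (real^3 \<Rightarrow> real) \<Rightarrow> real^3 \<Rightarrow> real" where
  "LI i f x = integral {0..L $ i} (\<lambda>s. f (upd x i s))"

lemma slice_continuous:
  assumes "continuous_on V f" "x \<in> V"
  shows "continuous_on {0..L $ i} (\<lambda>s. f (upd x i s))"
  by (rule continuous_on_compose2[OF assms(1)]) (auto intro!: continuous_intros upd_V assms)

lemma slice_integrable:
  assumes "continuous_on V f" "x \<in> V"
  shows "(\<lambda>s. f (upd x i s) :: real) integrable_on {0..L $ i}"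
  by (rule integrable_continuous_real[OF slice_continuous[OF assms]])

lemma LI_continuous:
  assumes "continuous_on V f"
  shows "continuous_on V (LI i f)"
proof -
  have "continuous_on V (\<lambda>x. integral (cbox 0 (L $ i)) (\<lambda>s. f (upd x i s)))"
    by (rule integral_continuous_on_param)
       (auto simp: case_prod_beta' intro!: continuous_on_compose2[OF assms] continuous_intros upd_V)
  then show ?thesis by (simp add: LI_def[abs_def])
qed

lemma LI_cong: "x \<in> V \<Longrightarrow> (\<And>y. y \<in> V \<Longrightarrow> f y = g y) \<Longrightarrow> LI i f x = LI i g x"
  unfolding LI_def by (rule integral_cong) (auto intro: upd_V)

lemma LI_mono:
  assumes "continuous_on V f" "continuous_on V g" "x \<in> V" "\<And>y. y \<in> V \<Longrightarrow> f y \<le> g y"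
  shows "LI i f x \<le> LI i g x"
  unfolding LI_def by (rule integral_le) (use assms in \<open>auto intro: slice_integrable upd_V\<close>)

lemma LI_nonneg: "continuous_on V f \<Longrightarrow> x \<in> V \<Longrightarrow> (\<And>y. y \<in> V \<Longrightarrow> 0 \<le> f y) \<Longrightarrow> 0 \<le> LI i f x"
  using LI_mono[of "\<lambda>_. 0" f x i] by (simp add: LI_def)

lemma LI_add:
  assumes "continuous_on V f" "continuous_on V g" "x \<in> V"
  shows "LI i (\<lambda>y. f y + g y) x = LI i f x + LI i g x"
  unfolding LI_def by (rule integral_add) (use assms in \<open>auto intro: slice_integrable\<close>)

lemma LI_cmult: "LI i (\<lambda>y. c * f y) = (\<lambda>x. c * LI i f x)"
  by (simp add: LI_def[abs_def])

lemma LI_indep: "LI i f (upd x i a) = LI i f x"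
  by (simp add: LI_def)

lemma LI_mult_indep:
  assumes "\<And>y s. y \<in> V \<Longrightarrow> s \<in> {0..L $ i} \<Longrightarrow> g (upd y i s) = g y" "x \<in> V"
  shows "LI i (\<lambda>y. g y * f y) x = g x * LI i f x"
proof -
  have "LI i (\<lambda>y. g y * f y) x = integral {0..L $ i} (\<lambda>s. g x * f (upd x i s))"
    unfolding LI_def by (rule integral_cong) (use assms in auto)
  then show ?thesis by (simp add: LI_def)
qed

lemma LI_const:
  assumes "\<And>y s. y \<in> V \<Longrightarrow> s \<in> {0..L $ i} \<Longrightarrow> g (upd y i s) = g y" "x \<in> V"
  shows "LI i g x = L $ i * g x"
  using LI_mult_indep[where f = "\<lambda>_. 1", OF assms] L_pos[of i] by (simp add: LI_def)

lemma LI_commute: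
  assumes f: "continuous_on V f" and x: "x \<in> V"
  shows "LI i (LI j f) x = LI j (LI i f) x"
proof (cases "i = j")
  case False
  have "integral (cbox 0 (L $ i)) (\<lambda>a. integral (cbox 0 (L $ j)) (\<lambda>b. f (upd (upd x i a) j b)))
      = integral (cbox 0 (L $ j)) (\<lambda>b. integral (cbox 0 (L $ i)) (\<lambda>a. f (upd (upd x i a) j b)))"
    by (rule integral_swap_continuous)
       (auto simp: case_prod_beta' intro!: continuous_on_compose2[OF f] continuous_intros upd_V x)
  then show ?thesis using False by (simp add: LI_def upd_commute)
qed simp

text \<open>The point \<open>x\<close> is arbitrary because each of its three coordinates is
  overwritten by one of the integrations.\<close>

lemma fubini:
  assumes f: "continuous_on V f"
  shows "integral V f = LI 1 (LI 2 (LI 3 f)) x"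
proof -
  have "(f has_integral integral V f) (cbox (vector [0, 0, 0]) (vector [Lx, Ly, 1]))"
  proof -
    have "vector [0, 0, 0] = (0 :: real^3)" by (simp add: vec_eq_iff forall_3)
    then show ?thesis using integrable_integral[OF integrable_V[OF f]] by (simp add: cell_def)
  qed
  from has_integral_vector3[OF this]
  have "integral V f = integral (cbox (0, 0, 0) (Lx, Ly, 1)) (\<lambda>(x, y, z). f (vector [x, y, z]))"
    by (rule integral_unique[symmetric])
  also have "\<dots> = integral (cbox 0 Lx) (\<lambda>x. integral (cbox (0, 0) (Ly, 1)) (\<lambda>(y, z). f (vector [x, y, z])))"
  proof (subst integral_prod_continuous)
    show "continuous_on (cbox (0, 0, 0) (Lx, Ly, 1)) (\<lambda>(x, y, z). f (vector [x, y, z]))"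
      unfolding vector3_eq_upd[of _ _ _ 0] case_prod_beta'
      by (rule continuous_on_compose2[OF f]) (auto intro!: continuous_intros simp: cbox_Pair_iff mem_V forall_3)
  qed simp
  also have "\<dots> = integral (cbox 0 Lx) (\<lambda>x. integral (cbox 0 Ly) (\<lambda>y. integral (cbox 0 1) (\<lambda>z. f (vector [x, y, z]))))"
  proof (rule integral_cong, subst integral_prod_continuous)
    fix a assume "a \<in> cbox 0 Lx"
    then show "continuous_on (cbox (0, 0) (Ly, 1)) (\<lambda>(y, z). f (vector [a, y, z]))"
      unfolding vector3_eq_upd[of _ _ _ 0] case_prod_beta'
      by (intro continuous_on_compose2[OF f]) (auto intro!: continuous_intros simp: cbox_Pair_iff mem_V forall_3)
  qed simp
  also have "\<dots> = LI 1 (LI 2 (LI 3 f)) x"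
    unfolding LI_def vector3_eq_upd[of _ _ _ x] by (simp add: upd_commute[of 3 2] upd_commute[of 3 1] upd_commute[of 2 1])
  finally show ?thesis .
qed

lemma fubini_perm:
  assumes f: "continuous_on V f" and x: "x \<in> V"
  shows "integral V f = LI 3 (LI 2 (LI 1 f)) x" "integral V f = LI 2 (LI 3 (LI 1 f)) x"
    "integral V f = LI 3 (LI 1 (LI 2 f)) x"
proof -
  note c = f LI_continuous
  have 1: "integral V f = LI 1 (LI 3 (LI 2 f)) x"
    unfolding fubini[OF f, of x] by (rule LI_cong[OF x]) (rule LI_commute[OF f])
  show 3: "integral V f = LI 3 (LI 1 (LI 2 f)) x"
    unfolding 1 by (rule LI_commute) (use c x in auto)
  show 4: "integral V f = LI 3 (LI 2 (LI 1 f)) x"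
    unfolding 3 by (rule LI_cong[OF x]) (rule LI_commute[OF f])
  show "integral V f = LI 2 (LI 3 (LI 1 f)) x"
    unfolding 4 by (rule LI_commute) (use c x in auto)
qed

text \<open>Since \<open>LI i f\<close> is constant in direction \<open>i\<close>, applying
  \<open>LI i\<close> once more only multiplies by \<open>L $ i\<close>; in each case the order of
  integration is chosen with this direction innermost. Inequalities and identities that hold on
  every line are lifted to the cell in this way.\<close>

lemma integral_LI:
  assumes f: "continuous_on V f"
  shows "integral V (LI i f) = L $ i * integral V f"
proof -
  have const: "integral V (\<lambda>_. 1 :: real) = L $ 1 * (L $ 2 * L $ 3)"
    unfolding fubini[OF continuous_on_const, of _ 0] LI_def using L_pos Lx Ly by simp
  note c = f LI_continuous
  have cc: "LI i (LI i g) x = L $ i * LI i g x" if "x \<in> V" for g x i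
    by (rule LI_const) (simp_all add: LI_indep that)
  consider "i = 1" | "i = 2" | "i = 3" using exhaust_3 by blast
  then show ?thesis
  proof cases
    case 1
    have "integral V (LI 1 f) = LI 1 (LI 2 (LI 3 (LI 1 f))) 0" by (rule fubini) (rule LI_continuous[OF f])
    also have "\<dots> = LI 2 (LI 3 (LI 1 (LI 1 f))) 0"
      using fubini[OF LI_continuous[OF f], of 1 0] fubini_perm(2)[OF LI_continuous[OF f] zero_V] by simp
    also have "\<dots> = LI 2 (LI 3 (\<lambda>x. L $ 1 * LI 1 f x)) 0"
      by (rule LI_cong[OF zero_V], rule LI_cong, assumption, rule cc)
    also have "\<dots> = L $ 1 * integral V f"
      unfolding fubini_perm(2)[OF f zero_V] by (simp only: LI_cmult)
    finally show ?thesis using 1 by simp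
  next
    case 2
    have "integral V (LI 2 f) = LI 3 (LI 1 (LI 2 (LI 2 f))) 0"
      by (rule fubini_perm(3)) (use zero_V LI_continuous[OF f] in auto)
    also have "\<dots> = LI 3 (LI 1 (\<lambda>x. L $ 2 * LI 2 f x)) 0"
      by (rule LI_cong[OF zero_V], rule LI_cong, assumption, rule cc)
    also have "\<dots> = L $ 2 * integral V f"
      unfolding fubini_perm(3)[OF f zero_V] by (simp only: LI_cmult)
    finally show ?thesis using 2 by simp
  next
    case 3
    have "integral V (LI 3 f) = LI 1 (LI 2 (LI 3 (LI 3 f))) 0"
      by (rule fubini) (use LI_continuous[OF f] in auto)
    also have "\<dots> = LI 1 (LI 2 (\<lambda>x. L $ 3 * LI 3 f x)) 0"
      by (rule LI_cong[OF zero_V], rule LI_cong, assumption, rule cc)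
    also have "\<dots> = L $ 3 * integral V f"
      unfolding fubini[OF f, of 0] by (simp only: LI_cmult)
    finally show ?thesis using 3 by simp
  qed
qed

lemma integral_le_of_slices:
  assumes f: "continuous_on V f" and g: "continuous_on V g"
    and le: "\<And>x. x \<in> V \<Longrightarrow> LI i f x \<le> LI i g x"
  shows "integral V f \<le> integral V g"
proof -
  have "integral V (LI i f) \<le> integral V (LI i g)"
    by (rule integral_le) (use le in \<open>auto intro: integrable_V LI_continuous f g\<close>)
  then show ?thesis using L_pos[of i] by (simp add: integral_LI f g)
qed

lemma integral_V_mono:
  assumes "continuous_on V f" "continuous_on V g" "\<And>y. y \<in> V \<Longrightarrow> f y \<le> (g y :: real)"
  shows "integral V f \<le> integral V g"
  by (rule integral_le) (use assms in \<open>auto intro: integrable_V\<close>)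

lemma integral_V_nonneg:
  assumes "continuous_on V f" "\<And>y. y \<in> V \<Longrightarrow> 0 \<le> (f y :: real)"
  shows "0 \<le> integral V f"
  using integral_V_mono[OF continuous_on_const assms(1), of 0] assms(2) by simp

lemma integral_V_add:
  assumes "continuous_on V f" "continuous_on V g"
  shows "integral V (\<lambda>x. f x + g x :: real) = integral V f + integral V g"
  by (rule integral_add) (use assms in \<open>auto intro: integrable_V\<close>)

lemma integral_V_diff:
  assumes "continuous_on V f" "continuous_on V g"
  shows "integral V (\<lambda>x. f x - g x :: real) = integral V f - integral V g"
  by (rule integral_diff) (use assms in \<open>auto intro: integrable_V\<close>)

end

section \<open>Partial derivatives along coordinate lines\<close>

text \<open>The parameters for which a coordinate line stays in \<open>slab\<close>: unbounded
  horizontally, stopped by the walls vertically, where derivatives become one-sided.\<close>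

definition axis_range :: "3 \<Rightarrow> real set" where
  "axis_range i = (if i = 3 then {0..1} else UNIV)"

text \<open>Only the restrictions to lines in direction \<open>i\<close> enter. Line integrals and
  vertical primitives can therefore be given partial derivatives one direction at a time.\<close>

definition has_pd :: "3 \<Rightarrow> (real^3 \<Rightarrow> real) \<Rightarrow> (real^3 \<Rightarrow> real) \<Rightarrow> bool" where
  "has_pd i f f' \<longleftrightarrow> (\<forall>x\<in>slab.
     ((\<lambda>s. f (upd x i s)) has_real_derivative f' x) (at (x $ i) within axis_range i))"

lemma upd_slab: "x \<in> slab \<Longrightarrow> s \<in> axis_range i \<Longrightarrow> upd x i s \<in> slab"
  by (auto simp: slab_def axis_range_def split: if_splits)

lemma slab_nth: "x \<in> slab \<Longrightarrow> x $ i \<in> axis_range i"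
  by (auto simp: slab_def axis_range_def)

lemma convex_axis_range: "convex (axis_range i)"
  by (simp add: axis_range_def)

lemma axis_range_limpt: "s \<in> axis_range i \<Longrightarrow> at s within axis_range i \<noteq> bot"
  unfolding trivial_limit_within axis_range_def
  by (auto simp: islimpt_UNIV islimpt_Icc)

lemma has_real_derivative_transform:
  assumes "x \<in> S" "\<And>y. y \<in> S \<Longrightarrow> g y = f y" "(f has_real_derivative d) (at x within S)"
  shows "(g has_real_derivative d) (at x within S)"
  using has_derivative_transform[of x S g f "(*) d"] assms unfolding has_field_derivative_def by blast

lemma has_pd_slice:
  assumes "has_pd i f f'" "x \<in> slab" "s \<in> axis_range i"
  shows "((\<lambda>s. f (upd x i s)) has_real_derivative f' (upd x i s)) (at s within axis_range i)"
  using assms(1)[unfolded has_pd_def, rule_format, OF upd_slab[OF assms(2,3)]] by simp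

lemma has_pd_unique:
  assumes "has_pd i f f'" "has_pd i f f''" "x \<in> slab"
  shows "f' x = f'' x"
  using assms has_field_derivative_unique[OF _ _ axis_range_limpt[OF slab_nth[OF assms(3)]]]
  unfolding has_pd_def by blast

lemma has_pd_cong:
  assumes "has_pd i f f'" "\<And>x. x \<in> slab \<Longrightarrow> f x = g x" "\<And>x. x \<in> slab \<Longrightarrow> f' x = g' x"
  shows "has_pd i g g'"
  unfolding has_pd_def
proof
  fix x assume x: "x \<in> slab"
  show "((\<lambda>s. g (upd x i s)) has_real_derivative g' x) (at (x $ i) within axis_range i)"
    by (rule has_real_derivative_transform[of "x $ i" _ _ "\<lambda>s. f (upd x i s)"])
       (use x assms slab_nth in \<open>auto simp: has_pd_def upd_slab\<close>)
qed

lemma has_pd_mult: "has_pd i f f' \<Longrightarrow> has_pd i g g' \<Longrightarrow> has_pd i (\<lambda>x. f x * g x) (\<lambda>x. f' x * g x + f x * g' x)"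
  unfolding has_pd_def by (auto intro!: derivative_eq_intros)

lemma has_pd_diff: "has_pd i f f' \<Longrightarrow> has_pd i g g' \<Longrightarrow> has_pd i (\<lambda>x. f x - g x) (\<lambda>x. f' x - g' x)"
  unfolding has_pd_def by (auto intro!: derivative_eq_intros)

lemma has_pd_power: "has_pd i f f' \<Longrightarrow> has_pd i (\<lambda>x. f x ^ n) (\<lambda>x. of_nat n * f x ^ (n - 1) * f' x)"
  unfolding has_pd_def by (auto intro!: derivative_eq_intros)

text \<open>Integrating \<open>fj\<close> along direction \<open>j\<close> recovers differences of
  \<open>f\<close>. Differentiating this identity in direction \<open>i\<close> under the integral
  sign shows that \<open>fi\<close> is a primitive of \<open>fji\<close> along \<open>j\<close>, so
  existence of the other mixed derivative is part of the conclusion.\<close>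

lemma mixed_pd_commute:
  assumes f: "has_pd i f fi" "has_pd j f fj" "has_pd i fj fji"
    and c: "continuous_on slab fj" "continuous_on slab fji" and ij: "i \<noteq> j" "j \<noteq> 3"
  shows "has_pd j fi fji"
  unfolding has_pd_def
proof
  fix x assume x: "x \<in> slab"
  define a b where "a = x $ i" and "b = x $ j"
  let ?p = "\<lambda>s t. upd (upd x i s) j t"
  have a: "a \<in> axis_range i" and Aj: "axis_range j = UNIV"
    using slab_nth[OF x] ij by (simp_all add: a_def) (simp add: axis_range_def)
  have ps: "?p s t \<in> slab" if "s \<in> axis_range i" for s t
    using x that by (auto intro!: upd_slab simp: Aj)
  have comp: "continuous_on X (\<lambda>q. g (?p (u q) (v q)))"
    if "continuous_on slab g" "continuous_on X u" "continuous_on X v" "u ` X \<subseteq> axis_range i" for X g and u v :: "'b::topological_space \<Rightarrow> real"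
    by (rule continuous_on_compose2[OF that(1)]) (use that ps in \<open>auto intro!: continuous_intros\<close>)
  \<comment> \<open>The base point \<open>b - 1\<close> lies strictly below \<open>b\<close>, so
    that \<open>key\<close> covers a full neighbourhood of \<open>b\<close> and the resulting
    derivative there is two-sided.\<close>
  have ftc: "integral {b-1..y} (\<lambda>t. fj (?p s t)) = f (?p s y) - f (?p s (b - 1))"
    if "s \<in> axis_range i" "b - 1 \<le> y" for s y
  proof (rule integral_unique, rule fundamental_theorem_of_calculus)
    fix t
    have "((\<lambda>t. f (?p s t)) has_real_derivative fj (?p s t)) (at t)"
      using has_pd_slice[OF f(2), of "upd x i s" t] that x by (simp add: Aj upd_slab)
    then show "((\<lambda>t. f (?p s t)) has_vector_derivative fj (?p s t)) (at t within {b - 1..y})"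
      using has_field_derivative_at_within has_real_derivative_iff_has_vector_derivative by blast
  qed (use that in auto)
  have key: "fi (?p a y) = fi (?p a (b - 1)) + integral {b-1..y} (\<lambda>t. fji (?p a t))" if y: "b - 1 \<le> y" for y
  proof -
    have "((\<lambda>s. integral (cbox (b-1) y) (\<lambda>t. fj (?p s t))) has_real_derivative
        integral (cbox (b-1) y) (\<lambda>t. fji (?p a t))) (at a within axis_range i)"
    proof (rule leibniz_rule_field_derivative)
      show "((\<lambda>s. fj (?p s t)) has_real_derivative fji (?p s t)) (at s within axis_range i)"
        if "s \<in> axis_range i" for s t
        using has_pd_slice[OF f(3), of "upd x j t" s] that ij x
        by (simp add: upd_slab Aj upd_commute[of j i])
      show "(\<lambda>t. fj (?p s t)) integrable_on cbox (b - 1) y" if "s \<in> axis_range i" for s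
        by (rule integrable_continuous, rule comp[OF c(1)]) (use that in \<open>auto intro: continuous_intros\<close>)
      show "continuous_on (axis_range i \<times> cbox (b - 1) y) (\<lambda>(s, t). fji (?p s t))"
        unfolding case_prod_beta' by (rule comp[OF c(2)]) (auto intro!: continuous_intros)
    qed (use a convex_axis_range in auto)
    then have "((\<lambda>s. f (?p s y) - f (?p s (b - 1))) has_real_derivative
        integral {b-1..y} (\<lambda>t. fji (?p a t))) (at a within axis_range i)"
      unfolding cbox_interval by (rule has_real_derivative_transform[OF a, rotated]) (use ftc y in auto)
    moreover have "((\<lambda>s. f (?p s y)) has_real_derivative fi (?p a y)) (at a within axis_range i)" for y
      using has_pd_slice[OF f(1), of "upd x j y" a] a ij x by (simp add: upd_slab Aj upd_commute[of j i])
    then have "((\<lambda>s. f (?p s y) - f (?p s (b - 1))) has_real_derivative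
        fi (?p a y) - fi (?p a (b - 1))) (at a within axis_range i)"
      by (intro DERIV_diff)
    ultimately show ?thesis
      using has_field_derivative_unique[OF _ _ axis_range_limpt[OF a]] by fastforce
  qed
  have "((\<lambda>y. integral {b-1..y} (\<lambda>t. fji (?p a t))) has_real_derivative fji (?p a b)) (at b within {b-1..b+1})"
    by (rule integral_has_real_derivative, rule comp[OF c(2)]) (use a in \<open>auto intro: continuous_intros\<close>)
  then have "((\<lambda>y. fi (?p a (b - 1)) + integral {b-1..y} (\<lambda>t. fji (?p a t))) has_real_derivative fji (?p a b))
      (at b within {b-1..b+1})"
    by (auto intro!: derivative_eq_intros)
  then have "((\<lambda>y. fi (?p a y)) has_real_derivative fji (?p a b)) (at b within {b-1..b+1})"
    by (rule has_real_derivative_transform[rotated 2]) (auto intro: key)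
  then have "((\<lambda>y. fi (?p a y)) has_real_derivative fji (?p a b)) (at b)"
    using at_within_Icc_at[of "b - 1" b "b + 1"] by simp
  then show "((\<lambda>s. fi (upd x j s)) has_real_derivative fji x) (at (x $ j) within axis_range j)"
    by (simp add: Aj a_def b_def)
qed

section \<open>Periodicity, boundary terms and integration by parts on the cell\<close>

context layer
begin

lemma L_axis_range: "{0..L $ i} \<subseteq> axis_range i"
  by (auto simp: axis_range_def)

lemma axis_rangeI: "0 \<le> s \<Longrightarrow> s \<le> L $ i \<Longrightarrow> s \<in> axis_range i"
  by (rule subsetD[OF L_axis_range]) simp

lemma continuous_V: "continuous_on slab f \<Longrightarrow> continuous_on V f"
  using continuous_on_subset V_slab by blast

lemma has_pd_slice_V:
  assumes "has_pd i f f'" "x \<in> V" "s \<in> {0..L $ i}"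
  shows "((\<lambda>s. f (upd x i s)) has_real_derivative f' (upd x i s)) (at s within {0..L $ i})"
proof -
  have "x \<in> slab" "s \<in> axis_range i" using assms V_slab L_axis_range by blast+
  then show ?thesis by (rule DERIV_subset[OF has_pd_slice[OF assms(1)] L_axis_range])
qed

lemma LI_pd:
  assumes "has_pd i f f'" "x \<in> V"
  shows "LI i f' x = f (upd x i (L $ i)) - f (upd x i 0)"
  unfolding LI_def
proof (rule integral_unique, rule fundamental_theorem_of_calculus)
  show "((\<lambda>s. f (upd x i s)) has_vector_derivative f' (upd x i s)) (at s within {0..L $ i})"
    if "s \<in> {0..L $ i}" for s
    using has_pd_slice_V[OF assms that] has_real_derivative_iff_has_vector_derivative by blast
qed (use L_pos in \<open>auto simp: less_imp_le\<close>)

definition periodic :: "3 \<Rightarrow> (real^3 \<Rightarrow> real) \<Rightarrow> bool" where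
  "periodic i f \<longleftrightarrow> (\<forall>x\<in>slab. f (upd x i (x $ i + L $ i)) = f x)"

text \<open>This is what makes the boundary terms of an integration by parts cancel. Periodic
  functions have it in the horizontal directions, functions vanishing on the walls in the vertical
  one.\<close>

definition matching :: "3 \<Rightarrow> (real^3 \<Rightarrow> real) \<Rightarrow> bool" where
  "matching i f \<longleftrightarrow> (\<forall>x\<in>V. f (upd x i (L $ i)) = f (upd x i 0))"

lemma periodic_mult: "periodic i f \<Longrightarrow> periodic i g \<Longrightarrow> periodic i (\<lambda>x. f x * g x)"
  by (simp add: periodic_def)

lemma periodic_matching:
  assumes "periodic i f" shows "matching i f"
  unfolding matching_def
proof
  fix x assume "x \<in> V"
  then have "upd x i 0 \<in> slab" using V_slab upd_V[of x 0 i] L_pos[of i] by auto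
  then show "f (upd x i (L $ i)) = f (upd x i 0)" using assms unfolding periodic_def by force
qed

text \<open>Translation by a period does not change the values of \<open>f\<close>, so uniqueness of
  line derivatives carries the periodicity over. For \<open>j = i\<close> the translation acts along
  the line itself, otherwise it moves the line to a parallel one.\<close>

lemma periodic_pd:
  assumes f: "has_pd j f f'" and p: "periodic i f" and i: "i \<noteq> 3"
  shows "periodic i f'"
  unfolding periodic_def
proof
  fix x assume x: "x \<in> slab"
  let ?y = "upd x i (x $ i + L $ i)"
  have y: "?y \<in> slab" using x i by (auto intro!: upd_slab simp: axis_range_def)
  have "((\<lambda>s. f (upd x j s)) has_real_derivative f' ?y) (at (x $ j) within axis_range j)"
  proof (cases "j = i")
    case True
    have "((\<lambda>s. f (upd x i s)) has_real_derivative f' ?y) (at (x $ i + L $ i))"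
      using f[unfolded has_pd_def, rule_format, OF y] True i by (simp add: axis_range_def)
    then have "((\<lambda>s. f (upd x i (s + L $ i))) has_real_derivative f' ?y) (at (x $ i))"
      by (simp only: DERIV_shift)
    moreover have "f (upd x i (s + L $ i)) = f (upd x i s)" for s
      using p[unfolded periodic_def, rule_format, of "upd x i s"] x i by (simp add: upd_slab axis_range_def)
    ultimately show ?thesis using True i by (simp add: axis_range_def)
  next
    case False
    have "((\<lambda>s. f (upd ?y j s)) has_real_derivative f' ?y) (at (x $ j) within axis_range j)"
      using f[unfolded has_pd_def, rule_format, OF y] False by simp
    then show ?thesis
    proof (rule has_real_derivative_transform[rotated 2])
      show "f (upd x j s) = f (upd ?y j s)" if "s \<in> axis_range j" for s
        using p[unfolded periodic_def, rule_format, of "upd x j s"] x that False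
        by (simp add: upd_slab upd_commute[of j i])
    qed (use x in \<open>simp add: slab_nth\<close>)
  qed
  then show "f' ?y = f' x"
    using f[unfolded has_pd_def, rule_format, OF x]
      has_field_derivative_unique[OF _ _ axis_range_limpt[OF slab_nth[OF x]]] by blast
qed

lemma integral_pd_zero:
  assumes "has_pd i f f'" "continuous_on V f'" "matching i f"
  shows "integral V f' = 0"
proof -
  have "integral V (LI i f') = integral V (\<lambda>_. 0 :: real)"
    by (rule integral_cong) (use LI_pd[OF assms(1)] assms(3) in \<open>auto simp: matching_def\<close>)
  then show ?thesis using integral_LI[OF assms(2), of i] L_pos[of i] by simp
qed

lemma integral_by_parts_V:
  assumes "has_pd i f f'" "has_pd i g g'" "matching i (\<lambda>x. f x * g x)"
    and c: "continuous_on slab f" "continuous_on slab f'" "continuous_on slab g" "continuous_on slab g'"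
  shows "integral V (\<lambda>x. f x * g' x) = - integral V (\<lambda>x. f' x * g x)"
proof -
  note c = c[THEN continuous_V]
  have "integral V (\<lambda>x. f' x * g x + f x * g' x) = 0"
    by (rule integral_pd_zero[OF has_pd_mult[OF assms(1,2)] _ assms(3)]) (intro continuous_intros c)
  then show ?thesis
    by (subst (asm) integral_V_add) (auto intro!: continuous_intros c)
qed

text \<open>\<open>f\<^sub>i g\<^sub>j - f\<^sub>j g\<^sub>i\<close> is the divergence \<open>(f g\<^sub>j)\<^sub>i - (f g\<^sub>i)\<^sub>j\<close>, because the mixed derivatives of \<open>g\<close> agree.\<close>

lemma integral_jacobian_zero:
  assumes f: "has_pd i f fi" "has_pd j f fj"
    and g: "has_pd i g gi" "has_pd j g gj" "has_pd i gj gij"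
    and c: "continuous_on slab f" "continuous_on slab fi" "continuous_on slab fj"
      "continuous_on slab gi" "continuous_on slab gj" "continuous_on slab gij"
    and ij: "i \<noteq> j" "j \<noteq> 3"
    and m: "matching i (\<lambda>x. f x * gj x)" "matching j (\<lambda>x. f x * gi x)"
  shows "integral V (\<lambda>x. fi x * gj x - fj x * gi x) = 0"
proof -
  have gi: "has_pd j gi gij" by (rule mixed_pd_commute[OF g c(5,6) ij])
  note cV = c[THEN continuous_V]
  have "integral V (\<lambda>x. fi x * gj x) = - integral V (\<lambda>x. f x * gij x)"
    using integral_by_parts_V[OF f(1) g(3) m(1) c(1,2,5,6)] by simp
  moreover have "integral V (\<lambda>x. fj x * gi x) = - integral V (\<lambda>x. f x * gij x)"
    using integral_by_parts_V[OF f(2) gi m(2) c(1,3,4,6)] by simp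
  ultimately show ?thesis
    by (subst integral_V_diff) (auto intro!: continuous_intros cV)
qed

lemma LI_continuous_slab:
  assumes "continuous_on slab f"
  shows "continuous_on slab (LI i f)"
proof -
  have "continuous_on slab (\<lambda>x. integral (cbox 0 (L $ i)) (\<lambda>s. f (upd x i s)))"
    by (rule integral_continuous_on_param)
       (auto simp: case_prod_beta' intro!: continuous_on_compose2[OF assms] continuous_intros upd_slab axis_rangeI)
  then show ?thesis by (simp add: LI_def[abs_def])
qed

lemma has_pd_LI:
  assumes f: "has_pd j f f'" and c: "continuous_on slab f" "continuous_on slab f'" and ij: "i \<noteq> j"
  shows "has_pd j (LI i f) (LI i f')"
  unfolding has_pd_def
proof
  fix x assume x: "x \<in> slab"
  have mem: "upd (upd x j s) i t \<in> slab" if "s \<in> axis_range j" "t \<in> {0..L $ i}" for s t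
    using x that L_axis_range by (blast intro: upd_slab)
  have "((\<lambda>s. integral (cbox 0 (L $ i)) (\<lambda>t. f (upd (upd x j s) i t))) has_real_derivative
      integral (cbox 0 (L $ i)) (\<lambda>t. f' (upd (upd x j (x $ j)) i t))) (at (x $ j) within axis_range j)"
  proof (rule leibniz_rule_field_derivative)
    show "((\<lambda>s. f (upd (upd x j s) i t)) has_real_derivative f' (upd (upd x j s) i t)) (at s within axis_range j)"
      if "s \<in> axis_range j" "t \<in> cbox 0 (L $ i)" for s t
    proof -
      have "upd x i t \<in> slab" using x that L_axis_range[of i] by (auto intro: upd_slab)
      from has_pd_slice[OF f this that(1)] show ?thesis using ij by (simp add: upd_commute[of i j])
    qed
    show "(\<lambda>t. f (upd (upd x j s) i t)) integrable_on cbox 0 (L $ i)" if "s \<in> axis_range j" for s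
      by (rule integrable_continuous, rule continuous_on_compose2[OF c(1)])
         (use mem that in \<open>auto intro!: continuous_intros\<close>)
    show "continuous_on (axis_range j \<times> cbox 0 (L $ i)) (\<lambda>(s, t). f' (upd (upd x j s) i t))"
      unfolding case_prod_beta'
      by (rule continuous_on_compose2[OF c(2)]) (use mem in \<open>auto intro!: continuous_intros\<close>)
  qed (use x in \<open>auto simp: slab_nth convex_axis_range\<close>)
  then show "((\<lambda>s. LI i f (upd x j s)) has_real_derivative LI i f' x) (at (x $ j) within axis_range j)"
    by (simp add: LI_def)
qed

end

section \<open>Poincare and Gagliardo-Nirenberg inequalities on the cell\<close>

lemma discriminant_le_zero:
  fixes a b c :: real
  assumes "\<And>t. 0 \<le> a * t\<^sup>2 + 2 * b * t + c" "0 \<le> a"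
  shows "b\<^sup>2 \<le> a * c"
proof (cases "a = 0")
  case True
  have "b = 0"
  proof (rule ccontr)
    assume "b \<noteq> 0"
    \<comment> \<open>At this point the affine function takes the value -1.\<close>
    then show False using assms(1)[of "- (c + 1) / (2 * b)"] True by simp
  qed
  then show ?thesis using True by simp
next
  case False
  then show ?thesis using assms(1)[of "- b / a"] assms(2)
    by (simp add: field_simps power2_eq_square)
qed

section \<open>Cauchy-Schwarz, Loomis-Whitney and the passage from lines to the cell\<close>

context layer
begin

lemma LI_cauchy_schwarz:
  assumes c: "continuous_on V f" "continuous_on V g" and x: "x \<in> V"
  shows "(LI i (\<lambda>y. f y * g y) x)\<^sup>2 \<le> LI i (\<lambda>y. (f y)\<^sup>2) x * LI i (\<lambda>y. (g y)\<^sup>2) x"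
proof (rule discriminant_le_zero)
  fix t :: real
  have "0 \<le> LI i (\<lambda>y. (f y * t + g y)\<^sup>2) x"
    by (rule LI_nonneg) (auto intro!: continuous_intros c x)
  also have "(\<lambda>y. (f y * t + g y)\<^sup>2) = (\<lambda>y. (t\<^sup>2 * (f y)\<^sup>2 + (2 * t) * (f y * g y)) + (g y)\<^sup>2)"
    by (simp add: fun_eq_iff power2_sum power_mult_distrib algebra_simps)
  also have "LI i \<dots> x = t\<^sup>2 * LI i (\<lambda>y. (f y)\<^sup>2) x + (2 * t) * LI i (\<lambda>y. f y * g y) x + LI i (\<lambda>y. (g y)\<^sup>2) x"
    by (subst LI_add LI_cmult; (intro continuous_intros c x)?)+ simp
  finally show "0 \<le> LI i (\<lambda>y. (f y)\<^sup>2) x * t\<^sup>2 + 2 * LI i (\<lambda>y. f y * g y) x * t + LI i (\<lambda>y. (g y)\<^sup>2) x"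
    by (simp add: algebra_simps)
qed (auto intro!: LI_nonneg continuous_intros c x)

lemma LI_sqrt_mult_le:
  assumes c: "continuous_on V f" "continuous_on V g" and x: "x \<in> V"
    and n: "\<And>y. y \<in> V \<Longrightarrow> 0 \<le> f y" "\<And>y. y \<in> V \<Longrightarrow> 0 \<le> g y"
  shows "LI i (\<lambda>y. sqrt (f y) * sqrt (g y)) x \<le> sqrt (LI i f x) * sqrt (LI i g x)"
proof -
  have e: "LI i (\<lambda>y. (sqrt (h y))\<^sup>2) x = LI i h x" if "\<And>y. y \<in> V \<Longrightarrow> 0 \<le> h y" for h
    by (rule LI_cong[OF x]) (simp add: that)
  have "(LI i (\<lambda>y. sqrt (f y) * sqrt (g y)) x)\<^sup>2 \<le> LI i f x * LI i g x"
    using LI_cauchy_schwarz[OF continuous_on_real_sqrt[OF c(1)] continuous_on_real_sqrt[OF c(2)] x, of i]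
    by (simp add: e[OF n(1)] e[OF n(2)])
  then show ?thesis by (metis real_le_rsqrt real_sqrt_mult)
qed

lemma integral_cauchy_schwarz:
  assumes c: "continuous_on V f" "continuous_on V g"
  shows "integral V (\<lambda>y. \<bar>f y\<bar> * \<bar>g y\<bar>) \<le> sqrt (integral V (\<lambda>y. (f y)\<^sup>2)) * sqrt (integral V (\<lambda>y. (g y)\<^sup>2))"
proof -
  have "(integral V (\<lambda>y. \<bar>f y\<bar> * \<bar>g y\<bar>))\<^sup>2 \<le> integral V (\<lambda>y. (f y)\<^sup>2) * integral V (\<lambda>y. (g y)\<^sup>2)"
  proof (rule discriminant_le_zero)
    fix t :: real
    have "0 \<le> integral V (\<lambda>y. (\<bar>f y\<bar> * t + \<bar>g y\<bar>)\<^sup>2)"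
      by (rule integral_V_nonneg) (auto intro!: continuous_intros c)
    also have "(\<lambda>y. (\<bar>f y\<bar> * t + \<bar>g y\<bar>)\<^sup>2) = (\<lambda>y. (t\<^sup>2 * (f y)\<^sup>2 + (2 * t) * (\<bar>f y\<bar> * \<bar>g y\<bar>)) + (g y)\<^sup>2)"
      by (simp add: fun_eq_iff power2_sum power_mult_distrib algebra_simps)
    also have "integral V \<dots> = t\<^sup>2 * integral V (\<lambda>y. (f y)\<^sup>2) + (2 * t) * integral V (\<lambda>y. \<bar>f y\<bar> * \<bar>g y\<bar>) + integral V (\<lambda>y. (g y)\<^sup>2)"
    proof -
      have "integral V (\<lambda>y. (t\<^sup>2 * (f y)\<^sup>2 + (2 * t) * (\<bar>f y\<bar> * \<bar>g y\<bar>)) + (g y)\<^sup>2)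
          = integral V (\<lambda>y. t\<^sup>2 * (f y)\<^sup>2 + (2 * t) * (\<bar>f y\<bar> * \<bar>g y\<bar>)) + integral V (\<lambda>y. (g y)\<^sup>2)"
        by (rule integral_V_add) (intro continuous_intros c)+
      also have "integral V (\<lambda>y. t\<^sup>2 * (f y)\<^sup>2 + (2 * t) * (\<bar>f y\<bar> * \<bar>g y\<bar>))
          = integral V (\<lambda>y. t\<^sup>2 * (f y)\<^sup>2) + integral V (\<lambda>y. (2 * t) * (\<bar>f y\<bar> * \<bar>g y\<bar>))"
        by (rule integral_V_add) (intro continuous_intros c)+
      finally show ?thesis by (simp only: integral_mult_right)
    qed
    finally show "0 \<le> integral V (\<lambda>y. (f y)\<^sup>2) * t\<^sup>2 + 2 * integral V (\<lambda>y. \<bar>f y\<bar> * \<bar>g y\<bar>) * t + integral V (\<lambda>y. (g y)\<^sup>2)"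
      by (simp add: algebra_simps)
  next
    show "0 \<le> integral V (\<lambda>y. (f y)\<^sup>2)"
      by (rule integral_V_nonneg) (intro continuous_intros c, simp)
  qed
  then show ?thesis by (simp add: real_le_rsqrt flip: real_sqrt_mult)
qed

text \<open>\<open>LI i (G i)\<close> is constant in direction \<open>i\<close>. Integration over
  coordinate 1, and likewise over coordinate 2, pulls out the factor that is constant there and
  separates the other two by Cauchy-Schwarz. By then the third factor is a constant, and a last
  Cauchy-Schwarz inequality in direction 3 separates the first two.\<close>

lemma loomis_whitney:
  fixes G :: "3 \<Rightarrow> real^3 \<Rightarrow> real"
  assumes c: "\<And>i. continuous_on V (G i)" and n: "\<And>i y. y \<in> V \<Longrightarrow> 0 \<le> G i y"
  shows "integral V (\<lambda>x. sqrt (LI 1 (G 1) x) * sqrt (LI 2 (G 2) x) * sqrt (LI 3 (G 3) x))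
    \<le> sqrt (integral V (G 1)) * sqrt (integral V (G 2)) * sqrt (integral V (G 3))"
proof -
  let ?F = "\<lambda>i. LI i (G i)"
  note ci [continuous_intros] = c LI_continuous
  have nn [simp]: "0 \<le> LI i g x" if "continuous_on V g" "\<And>y. y \<in> V \<Longrightarrow> 0 \<le> g y" "x \<in> V" for i g x
    using LI_nonneg that by blast
  have nF: "0 \<le> ?F i x" if "x \<in> V" for i x by (rule nn) (use that c n in auto)
  have nFF: "0 \<le> LI j (?F i) x" if "x \<in> V" for i j x by (rule nn) (use that c nF in \<open>auto intro: LI_continuous\<close>)
  have s1: "LI 1 (\<lambda>x. sqrt (?F 1 x) * (sqrt (?F 2 x) * sqrt (?F 3 x))) x
      \<le> sqrt (?F 1 x) * (sqrt (LI 1 (?F 2) x) * sqrt (LI 1 (?F 3) x))" if x: "x \<in> V" for x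
  proof -
    have "LI 1 (\<lambda>x. sqrt (?F 1 x) * (sqrt (?F 2 x) * sqrt (?F 3 x))) x
        = sqrt (?F 1 x) * LI 1 (\<lambda>x. sqrt (?F 2 x) * sqrt (?F 3 x)) x"
      by (rule LI_mult_indep) (simp_all add: LI_indep x)
    also have "\<dots> \<le> sqrt (?F 1 x) * (sqrt (LI 1 (?F 2) x) * sqrt (LI 1 (?F 3) x))"
      by (intro mult_left_mono LI_sqrt_mult_le ci x nF) (use nF x in auto)
    finally show ?thesis .
  qed
  \<comment> \<open>The third function has now been integrated in all three directions, which makes
    its factor a constant.\<close>
  have G3: "LI 2 (LI 1 (?F 3)) x = integral V (G 3)" if "x \<in> V" for x
    using fubini[OF c, of 3 x] LI_commute[OF ci(2)[OF c] that, of 3 3 1 2] that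
    by (simp add: LI_commute[OF LI_continuous[OF c] that, of 2 1])
  have s2: "LI 2 (\<lambda>x. sqrt (?F 1 x) * (sqrt (LI 1 (?F 2) x) * sqrt (LI 1 (?F 3) x))) x
      \<le> sqrt (integral V (G 3)) * (sqrt (LI 2 (?F 1) x) * sqrt (LI 1 (?F 2) x))" if x: "x \<in> V" for x
  proof -
    have "LI 2 (\<lambda>x. sqrt (?F 1 x) * (sqrt (LI 1 (?F 2) x) * sqrt (LI 1 (?F 3) x))) x
      = LI 2 (\<lambda>x. sqrt (LI 1 (?F 2) x) * (sqrt (?F 1 x) * sqrt (LI 1 (?F 3) x))) x"
      by (simp add: mult_ac)
    also have "\<dots> = sqrt (LI 1 (?F 2) x) * LI 2 (\<lambda>x. sqrt (?F 1 x) * sqrt (LI 1 (?F 3) x)) x"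
    proof (rule LI_mult_indep[OF _ x])
      show "sqrt (LI 1 (?F 2) (upd y 2 s)) = sqrt (LI 1 (?F 2) y)" if "y \<in> V" "s \<in> {0..L $ 2}" for y s
        using that upd_V[of y s 2] by (simp add: LI_commute[OF c, of _ 1 2] LI_indep)
    qed
    also have "\<dots> \<le> sqrt (LI 1 (?F 2) x) * (sqrt (LI 2 (?F 1) x) * sqrt (LI 2 (LI 1 (?F 3)) x))"
      by (intro mult_left_mono LI_sqrt_mult_le ci x nF nFF) (use nFF x in auto)
    finally show ?thesis by (simp add: G3 x mult_ac)
  qed
  have "integral V (\<lambda>x. sqrt (?F 1 x) * sqrt (?F 2 x) * sqrt (?F 3 x))
      = LI 3 (LI 2 (LI 1 (\<lambda>x. sqrt (?F 1 x) * (sqrt (?F 2 x) * sqrt (?F 3 x))))) 0"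
    by (subst fubini_perm(1)[OF _ zero_V]) (auto intro!: continuous_intros ci simp: mult_ac)
  also have "\<dots> \<le> LI 3 (LI 2 (\<lambda>x. sqrt (?F 1 x) * (sqrt (LI 1 (?F 2) x) * sqrt (LI 1 (?F 3) x)))) 0"
    by (intro LI_mono zero_V continuous_intros ci s1)
  also have "\<dots> \<le> LI 3 (\<lambda>x. sqrt (integral V (G 3)) * (sqrt (LI 2 (?F 1) x) * sqrt (LI 1 (?F 2) x))) 0"
    by (intro LI_mono zero_V continuous_intros ci s2)
  also have "\<dots> = sqrt (integral V (G 3)) * LI 3 (\<lambda>x. sqrt (LI 2 (?F 1) x) * sqrt (LI 1 (?F 2) x)) 0"
    by (simp only: LI_cmult)
  also have "\<dots> \<le> sqrt (integral V (G 3)) * (sqrt (LI 3 (LI 2 (?F 1)) 0) * sqrt (LI 3 (LI 1 (?F 2)) 0))"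
    by (intro mult_left_mono LI_sqrt_mult_le ci zero_V nFF) (auto intro!: integral_V_nonneg c n)
  also have "\<dots> = sqrt (integral V (G 3)) * (sqrt (integral V (G 1)) * sqrt (integral V (G 2)))"
    using fubini_perm(1)[OF c zero_V, of 1] fubini_perm(3)[OF c zero_V, of 2] by simp
  finally show ?thesis by (simp add: mult_ac)
qed

definition L2 :: "(real^3 \<Rightarrow> real) \<Rightarrow> real" where
  "L2 f = sqrt (integral V (\<lambda>x. (f x)\<^sup>2))"

lemma L2_nonneg: "continuous_on V f \<Longrightarrow> 0 \<le> L2 f"
  unfolding L2_def by (auto intro!: integral_V_nonneg continuous_intros)

lemma L2_squared: "continuous_on V f \<Longrightarrow> (L2 f)\<^sup>2 = integral V (\<lambda>x. (f x)\<^sup>2)"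
  unfolding L2_def by (intro real_sqrt_pow2 integral_V_nonneg continuous_intros) auto

text \<open>The Gagliardo-Nirenberg argument: the bound on lines is applied to \<open>f\<^sup>4\<close>.\<close>

lemma sobolev_of_line_bounds:
  assumes c: "continuous_on V f" "\<And>i. continuous_on V (fd i)"
    and k: "\<And>i. 0 \<le> k i" "\<And>i. 0 \<le> w i"
    and sup: "\<And>i x. x \<in> V \<Longrightarrow>
      f x ^ 4 \<le> k i / L $ i * LI i (\<lambda>y. f y ^ 4) x + w i * LI i (\<lambda>y. \<bar>4 * f y ^ 3 * fd i y\<bar>) x"
  shows "integral V (\<lambda>x. f x ^ 6) \<le> (\<Prod>i\<in>UNIV. k i / L $ i * L2 f + 4 * w i * L2 (fd i))\<^sup>2"
proof -
  define K where "K i = k i / L $ i" for i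
  have K: "0 \<le> K i" for i using k(1)[of i] L_pos[of i] by (simp add: K_def)
  note sup = sup[folded K_def]
  define G where "G i y = K i * f y ^ 4 + w i * \<bar>4 * f y ^ 3 * fd i y\<bar>" for i y
  have cG: "continuous_on V (G i)" for i unfolding G_def by (intro continuous_intros c)
  have nG: "0 \<le> G i y" for i y unfolding G_def using K k(2) by (simp add: less_imp_le)
  have F: "f x ^ 4 \<le> LI i (G i) x" if "x \<in> V" for i x
  proof -
    have "LI i (G i) x = K i * LI i (\<lambda>y. f y ^ 4) x + w i * LI i (\<lambda>y. \<bar>4 * f y ^ 3 * fd i y\<bar>) x"
      unfolding G_def by (subst LI_add) (simp_all only: LI_cmult that, (intro continuous_intros c)+)
    then show ?thesis using sup[OF that] by simp
  qed
  define N where "N = sqrt (integral V (\<lambda>x. f x ^ 6))"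
  define m where "m i = K i * L2 f + 4 * w i * L2 (fd i)" for i
  have N0: "0 \<le> N" unfolding N_def by (auto intro!: integral_V_nonneg continuous_intros c)
  have NN: "N\<^sup>2 = integral V (\<lambda>x. f x ^ 6)"
    unfolding N_def by (intro real_sqrt_pow2 integral_V_nonneg continuous_intros c) auto
  have m0: "0 \<le> m i" for i unfolding m_def using K k(2) L2_nonneg c by (simp add: less_imp_le)
  have cs: "integral V (\<lambda>y. \<bar>f y ^ 3\<bar> * \<bar>g y\<bar>) \<le> N * L2 g" if "continuous_on V g" for g
    using integral_cauchy_schwarz[of "\<lambda>y. f y ^ 3" g] that c
    by (simp add: N_def L2_def continuous_intros flip: power_mult)
  \<comment> \<open>\<open>N\<close> is the cube of the L6 norm of \<open>f\<close>. Both terms of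
    \<open>G i\<close> contain \<open>f^3\<close>, so Cauchy-Schwarz splits off \<open>N\<close> and
    leaves L2 norms.\<close>
  have Gm: "integral V (G i) \<le> N * m i" for i
  proof -
    have Gi: "G i = (\<lambda>y. K i * (\<bar>f y ^ 3\<bar> * \<bar>f y\<bar>) + (4 * w i) * (\<bar>f y ^ 3\<bar> * \<bar>fd i y\<bar>))"
      by (auto simp: G_def abs_mult fun_eq_iff power_abs simp flip: power_Suc2)
    have "integral V (G i) = K i * integral V (\<lambda>y. \<bar>f y ^ 3\<bar> * \<bar>f y\<bar>)
        + (4 * w i) * integral V (\<lambda>y. \<bar>f y ^ 3\<bar> * \<bar>fd i y\<bar>)"
      unfolding Gi by (subst integral_V_add) (simp_all, (intro continuous_intros c)+)
    also have "\<dots> \<le> K i * (N * L2 f) + (4 * w i) * (N * L2 (fd i))"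
      by (intro add_mono mult_left_mono cs c) (use K k(2) in auto)
    finally show ?thesis by (simp add: m_def algebra_simps)
  qed
  have "N\<^sup>2 \<le> integral V (\<lambda>x. sqrt (LI 1 (G 1) x) * sqrt (LI 2 (G 2) x) * sqrt (LI 3 (G 3) x))"
    unfolding NN
  proof (rule integral_V_mono)
    fix x assume x: "x \<in> V"
    have "f x ^ 6 = sqrt (f x ^ 4) * sqrt (f x ^ 4) * sqrt (f x ^ 4)"
    proof -
      have "sqrt (f x ^ 4) = f x ^ 2" by (rule real_sqrt_unique) (simp_all flip: power_mult)
      then show ?thesis by (simp flip: power_add)
    qed
    also have "\<dots> \<le> sqrt (LI 1 (G 1) x) * sqrt (LI 2 (G 2) x) * sqrt (LI 3 (G 3) x)"
      by (intro mult_mono real_sqrt_le_mono F x) (auto intro!: mult_nonneg_nonneg LI_nonneg cG nG x)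
    finally show "f x ^ 6 \<le> sqrt (LI 1 (G 1) x) * sqrt (LI 2 (G 2) x) * sqrt (LI 3 (G 3) x)" .
  qed (intro continuous_intros c LI_continuous cG)+
  also have "\<dots> \<le> sqrt (integral V (G 1)) * sqrt (integral V (G 2)) * sqrt (integral V (G 3))"
    by (rule loomis_whitney) (simp_all add: cG nG)
  also have "\<dots> \<le> sqrt (N * m 1) * sqrt (N * m 2) * sqrt (N * m 3)"
    by (intro mult_mono real_sqrt_le_mono Gm) (auto intro!: integral_V_nonneg cG nG mult_nonneg_nonneg N0 m0)
  finally have "(N\<^sup>2)\<^sup>2 \<le> (sqrt (N * m 1) * sqrt (N * m 2) * sqrt (N * m 3))\<^sup>2"
    by (rule power_mono) simp
  also have "\<dots> = N ^ 3 * (m 1 * m 2 * m 3)"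
    using N0 m0 by (simp add: power_mult_distrib power3_eq_cube)
  finally have le: "N * N ^ 3 \<le> (m 1 * m 2 * m 3) * N ^ 3" by (simp add: mult_ac power_numeral_reduce)
  \<comment> \<open>Three of the four powers of \<open>N\<close> cancel; the exponent four on the
    lines is chosen so that exactly \<open>f^6\<close> appears on both sides.\<close>
  have "N \<le> m 1 * m 2 * m 3"
  proof (cases "N = 0")
    case False then show ?thesis using le N0 by simp
  qed (use m0 in simp)
  then have "N\<^sup>2 \<le> (m 1 * m 2 * m 3)\<^sup>2" using N0 by (rule power_mono)
  then show ?thesis by (simp add: NN prod_UNIV_3 m_def K_def)
qed

text \<open>The three oscillation bounds on an interval, applied to \<open>f^4\<close> on a line.
  The trivial coefficients 1 and 0 are kept so that the bounds have the shape
  \<open>k / L $ i\<close> and \<open>w\<close> expected by the Sobolev argument.\<close>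

lemma line_bounds:
  assumes f: "has_pd i f f'" and c: "continuous_on slab f" "continuous_on slab f'" and x: "x \<in> V"
  shows "f x ^ 4 \<le> 1 / L $ i * LI i (\<lambda>y. f y ^ 4) x + 1 * LI i (\<lambda>y. \<bar>4 * f y ^ 3 * f' y\<bar>) x"
    and "matching i f \<Longrightarrow>
      f x ^ 4 \<le> 1 / L $ i * LI i (\<lambda>y. f y ^ 4) x + 1 / 2 * LI i (\<lambda>y. \<bar>4 * f y ^ 3 * f' y\<bar>) x"
    and "(\<And>y. y \<in> V \<Longrightarrow> f (upd y i 0) = 0 \<and> f (upd y i (L $ i)) = 0) \<Longrightarrow>
      f x ^ 4 \<le> 0 / L $ i * LI i (\<lambda>y. f y ^ 4) x + 1 / 2 * LI i (\<lambda>y. \<bar>4 * f y ^ 3 * f' y\<bar>) x"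
proof -
  let ?g = "\<lambda>s. f (upd x i s) ^ 4" and ?g' = "\<lambda>s. 4 * f (upd x i s) ^ 3 * f' (upd x i s)"
  have d: "(?g has_real_derivative ?g' s) (at s within {0..L $ i})" if "s \<in> {0..L $ i}" for s
    using has_pd_slice_V[OF has_pd_power[OF f, of 4] x that] by simp
  have cg: "continuous_on {0..L $ i} ?g'"
    by (intro continuous_intros slice_continuous x continuous_V c)
  have s: "x $ i \<in> {0..L $ i}" using x by (auto simp: mem_V)
  note b = sup_le_mean_plus_variation[OF L_pos d cg s, simplified upd_same]
  show "f x ^ 4 \<le> 1 / L $ i * LI i (\<lambda>y. f y ^ 4) x + 1 * LI i (\<lambda>y. \<bar>4 * f y ^ 3 * f' y\<bar>) x"
    using b(1) by (simp add: LI_def)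
  show "f x ^ 4 \<le> 1 / L $ i * LI i (\<lambda>y. f y ^ 4) x + 1 / 2 * LI i (\<lambda>y. \<bar>4 * f y ^ 3 * f' y\<bar>) x"
    if "matching i f"
    using b(2) that x by (simp add: LI_def matching_def)
  show "f x ^ 4 \<le> 0 / L $ i * LI i (\<lambda>y. f y ^ 4) x + 1 / 2 * LI i (\<lambda>y. \<bar>4 * f y ^ 3 * f' y\<bar>) x"
    if "\<And>y. y \<in> V \<Longrightarrow> f (upd y i 0) = 0 \<and> f (upd y i (L $ i)) = 0"
    using b(3) that[OF x] by (simp add: LI_def)
qed

section \<open>Poincare inequalities from the inequalities of Wirtinger type\<close>

lemma poincare_dirichlet:
  assumes f: "has_pd i f f'" and c: "continuous_on slab f" "continuous_on slab f'"
    and z: "\<And>y. y \<in> V \<Longrightarrow> f (upd y i 0) = 0 \<and> f (upd y i (L $ i)) = 0"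
  shows "integral V (\<lambda>x. (f x)\<^sup>2) \<le> (L $ i / pi)\<^sup>2 * integral V (\<lambda>x. (f' x)\<^sup>2)"
proof -
  have "integral V (\<lambda>x. (f x)\<^sup>2) \<le> integral V (\<lambda>x. (L $ i / pi)\<^sup>2 * (f' x)\<^sup>2)"
  proof (rule integral_le_of_slices[where i = i])
    fix x assume x: "x \<in> V"
    show "LI i (\<lambda>x. (f x)\<^sup>2) x \<le> LI i (\<lambda>x. (L $ i / pi)\<^sup>2 * (f' x)\<^sup>2) x"
      using wirtinger_dirichlet[OF L_pos[of i] has_pd_slice_V[OF f x] slice_continuous[OF continuous_V[OF c(2)] x]] z[OF x]
      by (simp add: LI_def)
  qed (intro continuous_intros continuous_V c)+
  then show ?thesis by simp
qed

lemma periodic_slice: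
  assumes "periodic i f" "i \<noteq> 3" "x \<in> slab"
  shows "f (upd x i (s + L $ i)) = f (upd x i s)"
  using assms(1)[unfolded periodic_def, rule_format, OF upd_slab[OF assms(3), of s i]] assms(2)
  by (simp add: axis_range_def)

lemma LI_wirtinger:
  assumes f: "has_pd i f f'" and c: "continuous_on slab f'" and p: "periodic i f" and i: "i \<noteq> 3" and x: "x \<in> V"
  shows "LI i (\<lambda>x. (f x)\<^sup>2) x \<le> (L $ i / (2 * pi))\<^sup>2 * LI i (\<lambda>x. (f' x)\<^sup>2) x + 1 / L $ i * (LI i f x)\<^sup>2"
proof -
  have xs: "x \<in> slab" using x V_slab by auto
  have r: "axis_range i = UNIV" using i by (simp add: axis_range_def)
  have "continuous_on UNIV (\<lambda>s. f' (upd x i s))"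
    by (rule continuous_on_compose2[OF c]) (auto intro!: continuous_intros upd_slab xs simp: r)
  then show ?thesis
    using wirtinger_periodic[OF L_pos[of i], of "\<lambda>s. f (upd x i s)" "\<lambda>s. f' (upd x i s)"]
      has_pd_slice[OF f xs, unfolded r] periodic_slice[OF p i xs]
    by (simp add: LI_def)
qed

text \<open>Wirtinger's inequality in direction 1 leaves the square of the line mean
  \<open>LI 1 f\<close>. This mean is periodic in direction 2 and has mean zero there, so the
  inequality applies to it again. Its derivative is \<open>LI 1 f2\<close>, and the factor
  \<open>Lx\<close> lost in returning to \<open>f2\<close> by Cauchy-Schwarz cancels the
  \<open>1 / Lx\<close> in front of the mean term.\<close>

lemma poincare_horizontal:
  assumes f: "has_pd 1 f f1" "has_pd 2 f f2"
    and c: "continuous_on slab f" "continuous_on slab f1" "continuous_on slab f2"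
    and p: "periodic 1 f" "periodic 2 f"
    and mean: "\<And>x. x \<in> V \<Longrightarrow> LI 2 (LI 1 f) x = 0"
  shows "integral V (\<lambda>x. (f x)\<^sup>2) \<le> (Lx / (2 * pi))\<^sup>2 * integral V (\<lambda>x. (f1 x)\<^sup>2)
    + (Ly / (2 * pi))\<^sup>2 * integral V (\<lambda>x. (f2 x)\<^sup>2)"
proof -
  note cV = c[THEN continuous_V]
  note ci = continuous_intros cV LI_continuous
  let ?A = "(Lx / (2 * pi))\<^sup>2" and ?B = "(Ly / (2 * pi))\<^sup>2"
  define r where "r = 1 / Lx"
  have r: "r > 0" "r * Lx = 1" using Lx by (simp_all add: r_def)
  have W: "LI 1 (\<lambda>x. (f x)\<^sup>2) x \<le> ?A * LI 1 (\<lambda>x. (f1 x)\<^sup>2) x + r * (LI 1 f x)\<^sup>2" if "x \<in> V" for x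
    using LI_wirtinger[OF f(1) c(2) p(1) _ that] by (simp add: r_def)
  have h: "has_pd 2 (LI 1 f) (LI 1 f2)" by (rule has_pd_LI[OF f(2) c(1,3)]) simp
  have ph: "periodic 2 (LI 1 f)"
    unfolding periodic_def
  proof
    fix x assume x: "x \<in> slab"
    show "LI 1 f (upd x 2 (x $ 2 + L $ 2)) = LI 1 f x"
      unfolding LI_def
    proof (rule integral_cong)
      fix s
      have "upd x 1 s \<in> slab" using x by (rule upd_slab) (simp add: axis_range_def)
      then show "f (upd (upd x 2 (x $ 2 + L $ 2)) 1 s) = f (upd x 1 s)"
        using p(2)[unfolded periodic_def, rule_format, of "upd x 1 s"] by (simp add: upd_commute[of 2 1])
    qed
  qed
  have slices: "LI 2 (LI 1 (\<lambda>x. (f x)\<^sup>2)) x \<le> LI 2 (LI 1 (\<lambda>x. ?A * (f1 x)\<^sup>2 + ?B * (f2 x)\<^sup>2)) x" if x: "x \<in> V" for x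
  proof -
    have "LI 2 (LI 1 (\<lambda>x. (f x)\<^sup>2)) x \<le> LI 2 (\<lambda>x. ?A * LI 1 (\<lambda>x. (f1 x)\<^sup>2) x + r * (LI 1 f x)\<^sup>2) x"
      by (rule LI_mono[OF _ _ x]) (use W in \<open>auto intro!: ci\<close>)
    also have "\<dots> = LI 2 (\<lambda>x. ?A * LI 1 (\<lambda>x. (f1 x)\<^sup>2) x) x + r * LI 2 (\<lambda>x. (LI 1 f x)\<^sup>2) x"
      by (subst LI_add) (auto intro!: ci x simp: LI_cmult)
    also have "\<dots> \<le> LI 2 (\<lambda>x. ?A * LI 1 (\<lambda>x. (f1 x)\<^sup>2) x) x + r * (?B * LI 2 (\<lambda>x. (LI 1 f2 x)\<^sup>2) x)"
      using LI_wirtinger[OF h LI_continuous_slab[OF c(3)] ph _ x] mean[OF x] r(1)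
      by (intro add_left_mono mult_left_mono) simp_all
    also have "\<dots> \<le> LI 2 (\<lambda>x. ?A * LI 1 (\<lambda>x. (f1 x)\<^sup>2) x) x + r * (?B * LI 2 (\<lambda>x. Lx * LI 1 (\<lambda>x. (f2 x)\<^sup>2) x) x)"
    proof (intro add_left_mono mult_left_mono LI_mono x ci)
      fix y assume y: "y \<in> V"
      show "(LI 1 f2 y)\<^sup>2 \<le> Lx * LI 1 (\<lambda>x. (f2 x)\<^sup>2) y"
        using LI_cauchy_schwarz[OF continuous_on_const cV(3) y, of 1 1] Lx by (simp add: LI_def)
    qed (use r in auto)
    also have "\<dots> = LI 2 (\<lambda>x. ?A * LI 1 (\<lambda>x. (f1 x)\<^sup>2) x) x + ?B * LI 2 (LI 1 (\<lambda>x. (f2 x)\<^sup>2)) x"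
    proof -
      have "r * (?B * (Lx * q)) = ?B * q" for q using r(2) by (metis mult.assoc mult.commute mult_1)
      then show ?thesis by (simp add: LI_cmult)
    qed
    also have "\<dots> = LI 2 (LI 1 (\<lambda>x. ?A * (f1 x)\<^sup>2 + ?B * (f2 x)\<^sup>2)) x"
    proof -
      have "LI 2 (LI 1 (\<lambda>x. ?A * (f1 x)\<^sup>2 + ?B * (f2 x)\<^sup>2)) x
          = LI 2 (\<lambda>x. ?A * LI 1 (\<lambda>x. (f1 x)\<^sup>2) x + ?B * LI 1 (\<lambda>x. (f2 x)\<^sup>2) x) x"
        by (rule LI_cong[OF x]) (subst LI_add; (intro ci)?; simp add: LI_cmult)
      also have "\<dots> = LI 2 (\<lambda>x. ?A * LI 1 (\<lambda>x. (f1 x)\<^sup>2) x) x + ?B * LI 2 (LI 1 (\<lambda>x. (f2 x)\<^sup>2)) x"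
        by (subst LI_add) (auto intro!: ci x simp: LI_cmult)
      finally show ?thesis by simp
    qed
    finally show ?thesis .
  qed
  have "LI 3 (LI 2 (LI 1 (\<lambda>x. (f x)\<^sup>2))) 0 \<le> LI 3 (LI 2 (LI 1 (\<lambda>x. ?A * (f1 x)\<^sup>2 + ?B * (f2 x)\<^sup>2))) 0"
    by (rule LI_mono[OF _ _ zero_V slices]) (intro ci)+
  then have "integral V (\<lambda>x. (f x)\<^sup>2) \<le> integral V (\<lambda>x. ?A * (f1 x)\<^sup>2 + ?B * (f2 x)\<^sup>2)"
    by (subst fubini_perm(1)[OF _ zero_V], (intro ci)[1], subst fubini_perm(1)[OF _ zero_V], (intro ci)[1])
  also have "\<dots> = ?A * integral V (\<lambda>x. (f1 x)\<^sup>2) + ?B * integral V (\<lambda>x. (f2 x)\<^sup>2)"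
    by (subst integral_V_add, (intro ci)+) simp
  finally show ?thesis .
qed

end

section \<open>Comparison with the constants\<close>

lemma am_gm_3:
  fixes u v w :: real
  assumes "0 \<le> u" "0 \<le> v" "0 \<le> w"
  shows "27 * (u * v * w) \<le> (u + v + w) ^ 3"
proof -
  have "(u + v + w) ^ 3 - 27 * (u * v * w) =
      1 / 2 * ((u + v + w) * ((u - v)\<^sup>2 + (v - w)\<^sup>2 + (u - w)\<^sup>2))
      + 3 * (u * (v - w)\<^sup>2 + v * (u - w)\<^sup>2 + w * (u - v)\<^sup>2)"
    by (simp add: power2_eq_square power3_eq_cube algebra_simps)
  also have "\<dots> \<ge> 0" using assms by simp
  finally show ?thesis by simp
qed

lemma C_3_cubed: "(2 * sqrt 2 * C_3) ^ 3 = 64 * sqrt 6 / (9 * pi\<^sup>2)"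
proof -
  have p: "(2 powr (2/3)) ^ 3 = (4 :: real)" "(pi powr (2/3)) ^ 3 = pi\<^sup>2"
    by (simp_all add: powr_power powr_numeral)
  have s: "sqrt 6 = sqrt 2 * sqrt 3" by (simp flip: real_sqrt_mult)
  have "(2 * sqrt 2 * C_3) ^ 3 = 8 * (2 * sqrt 2) * (4 / (pi\<^sup>2 * (3 * sqrt 3)))"
    by (simp add: C_3_def power_mult_distrib power_divide p power3_eq_cube[of "sqrt _"])
  also have "\<dots> = 64 * sqrt 6 / (9 * pi\<^sup>2)"
    unfolding s by (simp add: field_simps)
  finally show ?thesis .
qed

text \<open>Cubing removes the fractional powers of \<open>C_3\<close>, and the Sobolev estimates
  are compared with \<open>C_S\<close> on the level of cubes. The exact value is about 1.7649, so
  nearly nothing is given away here.\<close>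

lemma C_3_lower: "1.764 \<le> (2 * sqrt 2 * C_3) ^ 3"
proof -
  have pi: "pi \<le> 3.1416" using pi_approx by simp
  have "pi\<^sup>2 \<le> 3.1416\<^sup>2" using pi by (intro power_mono) auto
  then have "1.764 * (9 * pi\<^sup>2) \<le> 64 * 2.449" by (simp add: power2_eq_square)
  also have "2.449 \<le> sqrt 6" by (rule real_le_rsqrt) (simp add: power2_eq_square)
  finally have "1.764 * (9 * pi\<^sup>2) \<le> 64 * sqrt 6" by simp
  then show ?thesis unfolding C_3_cubed by (simp add: pos_le_divide_eq)
qed

lemma sum_two_le_sqrt:
  fixes a b :: real
  shows "a + b \<le> sqrt 2 * sqrt (a\<^sup>2 + b\<^sup>2)"
proof -
  have "(a + b)\<^sup>2 \<le> 2 * (a\<^sup>2 + b\<^sup>2)"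
    using zero_le_power2[of "a - b"] by (simp add: power2_sum power2_diff)
  then show ?thesis by (metis real_le_rsqrt real_sqrt_mult)
qed

lemma sum_three_le_sqrt:
  fixes a b c :: real
  shows "a + b + c \<le> sqrt 3 * sqrt (a\<^sup>2 + b\<^sup>2 + c\<^sup>2)"
proof -
  have "0 \<le> (a - b)\<^sup>2 + (b - c)\<^sup>2 + (a - c)\<^sup>2" by simp
  then have "(a + b + c)\<^sup>2 \<le> 3 * (a\<^sup>2 + b\<^sup>2 + c\<^sup>2)"
    by (simp add: power2_eq_square algebra_simps)
  then show ?thesis by (metis real_le_rsqrt real_sqrt_mult)
qed

text \<open>Intended for \<open>a\<close>, \<open>b\<close>, \<open>c\<close> the L2 norms of the
  partial derivatives, \<open>n\<close> that of the function, \<open>x = 1 / Lx\<close>,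
  \<open>y = 1 / Ly\<close>, and \<open>q\<close> the summand next to 1 in \<open>C_S\<close>. The
  vertical factor \<open>2 * c\<close> has no mean term. The inequality of the means and
  Cauchy-Schwarz lead to the factor \<open>8 * sqrt 3 / 9\<close>, about 1.54, which leaves ample
  room below 1.764.\<close>

lemma dirichlet_product_bound:
  fixes a b c n x y q D :: real
  assumes nn: "0 \<le> a" "0 \<le> b" "0 \<le> c" "0 \<le> n" "0 \<le> x" "0 \<le> y" "0 \<le> q"
    and D: "D = sqrt (a\<^sup>2 + b\<^sup>2 + c\<^sup>2)" and n: "n * sqrt (1 + x\<^sup>2 + y\<^sup>2) \<le> q * D"
  shows "(x * n + 2 * a) * (y * n + 2 * b) * (2 * c) \<le> 1.764 * (1 + q) ^ 3 * D ^ 3"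
proof -
  have D0: "0 \<le> D" by (simp add: D)
  have xy: "(x + y) * n \<le> sqrt 2 * (q * D)"
  proof -
    have "(x + y) * n \<le> (sqrt 2 * sqrt (1 + x\<^sup>2 + y\<^sup>2)) * n"
      using sum_two_le_sqrt[of x y] nn
      by (intro mult_right_mono) (auto elim!: order_trans)
    also have "\<dots> \<le> sqrt 2 * (q * D)" using n by (simp add: mult_ac)
    finally show ?thesis .
  qed
  have s2: "sqrt 2 \<le> 2 * sqrt 3" by (rule order_trans[of _ "sqrt 3"]) auto
  have "27 * ((x * n / 2 + a) * (y * n / 2 + b) * c) \<le> ((x * n / 2 + a) + (y * n / 2 + b) + c) ^ 3"
    by (rule am_gm_3) (use nn in auto)
  also have "\<dots> \<le> (sqrt 3 * D * (1 + q)) ^ 3"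
  proof (rule power_mono)
    have "(x * n / 2 + a) + (y * n / 2 + b) + c \<le> sqrt 3 * D + sqrt 2 * (q * D) / 2"
      using xy sum_three_le_sqrt[of a b c] D by (simp add: algebra_simps)
    also have "\<dots> \<le> sqrt 3 * D + sqrt 3 * (q * D)"
      using mult_right_mono[OF s2, of "q * D"] nn D0 by simp
    finally show "(x * n / 2 + a) + (y * n / 2 + b) + c \<le> sqrt 3 * D * (1 + q)" by (simp add: algebra_simps)
  qed (use nn in auto)
  also have "\<dots> = 3 * sqrt 3 * ((1 + q) ^ 3 * D ^ 3)"
    by (simp add: power_mult_distrib power3_eq_cube[of "sqrt 3"])
  also have "\<dots> \<le> 3 * 1.7321 * ((1 + q) ^ 3 * D ^ 3)"
    by (intro mult_right_mono mult_left_mono real_le_lsqrt) (use nn D0 in \<open>auto simp: power2_eq_square\<close>)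
  finally have "27 * ((x * n / 2 + a) * (y * n / 2 + b) * c) \<le> 3 * 1.7321 * ((1 + q) ^ 3 * D ^ 3)" .
  moreover have "0 \<le> (1 + q) ^ 3 * D ^ 3" using nn D0 by simp
  moreover have "8 * P \<le> 1.764 * R" if "27 * P \<le> 3 * 1.7321 * R" "0 \<le> R" for P R :: real
    using that by simp
  ultimately have "8 * ((x * n / 2 + a) * (y * n / 2 + b) * c) \<le> 1.764 * ((1 + q) ^ 3 * D ^ 3)" by blast
  moreover have "(x * n + 2 * a) * (y * n + 2 * b) * (2 * c) = 8 * ((x * n / 2 + a) * (y * n / 2 + b) * c)"
    by (simp add: algebra_simps)
  ultimately show ?thesis by (simp only: mult.assoc)
qed

text \<open>
  Here \<open>e\<close> and \<open>v\<close> are the offsets of \<open>\<eta> = sqrt (1 / Lx\<^sup>2 + 1 / Ly\<^sup>2) / \<lambda>\<^sub>1\<close> and \<open>\<nu> = 1 / \<lambda>\<^sub>1\<close> from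
  (roughly) their values at the extremal case \<open>Lx = Ly = 2\<close>, which leaves three per cent to spare;
  the hypothesis on \<open>q\<close> is the tangent to \<open>sqrt (\<eta>\<^sup>2 + \<nu>\<^sup>2)\<close> at that point.
\<close>

lemma extremal_polynomial_bound:
  fixes e v q :: real
  assumes e: "0 \<le> e" "0 \<le> v" and q: "577 / 1000 * (e + 9 / 40) + 102 / 125 * (v + 159 / 500) \<le> q"
  shows "2 * (1 + (e + 9 / 40) / 2)\<^sup>2 * (v + 159 / 500 + 77 / 50) \<le> 441 / 250 * (1 + q) ^ 3"
proof -
  \<comment> \<open>\<open>A\<close> bounds \<open>1 + q\<close> from below at \<open>v = 0\<close>:
    its constant is \<open>1 + 0.577 * 0.225 + 0.816 * 0.318\<close>, rounded down.\<close>
  define A Q where "A = 1389 / 1000 + 577 / 1000 * e" and "Q = 1 + (e + 9 / 40) / 2"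
  have Q: "0 \<le> Q" "Q \<le> A" using e by (auto simp: A_def Q_def field_simps)
  have ee: "0 \<le> e\<^sup>2" "0 \<le> e ^ 3" using e by auto
  have A3: "A ^ 3 = (1389 / 1000) ^ 3 + 3 * (1389 / 1000)\<^sup>2 * (577 / 1000) * e
      + 3 * (1389 / 1000) * (577 / 1000)\<^sup>2 * e\<^sup>2 + (577 / 1000) ^ 3 * e ^ 3"
    by (simp add: A_def power2_eq_square power3_eq_cube algebra_simps)
  have Q2: "Q\<^sup>2 = (89 / 80)\<^sup>2 + 89 / 80 * e + 1 / 4 * e\<^sup>2"
    by (simp add: Q_def power2_eq_square field_simps)
  \<comment> \<open>The number 2.11 lies just above \<open>2 * 1.858 / 1.764\<close>, where
    \<open>1.858 = 0.318 + 1.54\<close> is the last factor on the left at \<open>v = 0\<close>. The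
    cubic inequality in \<open>e\<close> is checked coefficient by coefficient.\<close>
  have "211 / 100 * ((89 / 80)\<^sup>2 + 89 / 80 * e + 1 / 4 * X) \<le> (1389 / 1000) ^ 3
      + 3 * (1389 / 1000)\<^sup>2 * (577 / 1000) * e + 3 * (1389 / 1000) * (577 / 1000)\<^sup>2 * X + (577 / 1000) ^ 3 * Y"
    if "0 \<le> X" "0 \<le> Y" for X Y :: real
    using that e by (simp add: power2_eq_square power3_eq_cube field_simps)
  from this[OF ee] have "211 / 100 * Q\<^sup>2 \<le> A ^ 3" unfolding A3 Q2 .
  then have 1: "2 * Q\<^sup>2 * (929 / 500) \<le> 441 / 250 * A ^ 3"
  proof -
    have "2 * X * (929 / 500) \<le> 441 / 250 * Y" if "211 / 100 * X \<le> Y" "0 \<le> X" for X Y :: real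
      using that by simp
    from this[OF \<open>211 / 100 * Q\<^sup>2 \<le> A ^ 3\<close> zero_le_power2] show ?thesis .
  qed
  have "2 * Q\<^sup>2 * v \<le> 441 / 250 * (3 * A\<^sup>2 * (102 / 125 * v))"
  proof -
    have "Q\<^sup>2 * v \<le> A\<^sup>2 * v" using Q e by (intro mult_right_mono power_mono) auto
    moreover have "0 \<le> A\<^sup>2 * v" using e by simp
    ultimately show ?thesis by (simp add: mult_ac)
  qed
  with 1 have "2 * Q\<^sup>2 * (v + 159 / 500 + 77 / 50) \<le> 441 / 250 * (A ^ 3 + 3 * A\<^sup>2 * (102 / 125 * v))"
    by (simp add: algebra_simps)
  also have "\<dots> \<le> 441 / 250 * (A + 102 / 125 * v) ^ 3"
  proof -
    have cube: "A ^ 3 + 3 * A\<^sup>2 * w \<le> (A + w) ^ 3" if "0 \<le> w" for w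
    proof -
      have "(A + w) ^ 3 = A ^ 3 + 3 * A\<^sup>2 * w + (3 * (A * w\<^sup>2) + w ^ 3)"
        by (simp add: power2_eq_square power3_eq_cube algebra_simps)
      moreover have "0 \<le> 3 * (A * w\<^sup>2) + w ^ 3" using Q that by simp
      ultimately show ?thesis by linarith
    qed
    show ?thesis by (rule mult_left_mono[OF cube]) (use e in auto)
  qed
  also have "\<dots> \<le> 441 / 250 * (1 + q) ^ 3"
    by (intro mult_left_mono power_mono) (use e q in \<open>auto simp: A_def field_simps\<close>)
  finally show ?thesis by (simp add: Q_def)
qed

text \<open>The counterpart for the vertical component, with \<open>\<nu>\<close> the reciprocal of
  \<open>lambda1\<close>. Here the vertical factor carries a mean term and the full variation. In
  return \<open>n\<close> is controlled by the horizontal derivatives alone, that is by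
  \<open>t\<close>. The two horizontal factors are combined by the inequality of the means, and what
  remains to be bounded is \<open>t^2 * n\<close> and \<open>t^2 * c\<close>.\<close>

lemma neumann_product_bound:
  fixes a b c n x y \<nu> q t D :: real
  assumes nn: "0 \<le> a" "0 \<le> b" "0 \<le> c" "0 \<le> n" "0 \<le> x" "0 \<le> y"
    and t: "t = sqrt (a\<^sup>2 + b\<^sup>2)" and D: "D = sqrt (a\<^sup>2 + b\<^sup>2 + c\<^sup>2)"
    and n: "n \<le> \<nu> * t" and \<nu>: "1 / pi \<le> \<nu>" "1 / (2 * pi) \<le> x * \<nu>" "1 / (2 * pi) \<le> y * \<nu>"
    and q: "q = sqrt (1 + x\<^sup>2 + y\<^sup>2) * \<nu>"
  shows "(x * n + 2 * a) * (y * n + 2 * b) * (n + 4 * c) \<le> 1.764 * (1 + q) ^ 3 * D ^ 3"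
proof -
  define \<eta> where "\<eta> = sqrt (x\<^sup>2 + y\<^sup>2) * \<nu>"
  have pi: "pi \<le> 3.1416" using pi_approx by simp
  have p1: "0.318 \<le> 1 / pi" using pi by (simp add: pos_le_divide_eq)
  have v: "0.318 \<le> \<nu>" using p1 \<nu>(1) by simp
  have t0: "0 \<le> t" and D0: "0 \<le> D" and tD: "t \<le> D" by (auto simp: t D)
  have tt: "t\<^sup>2 = a\<^sup>2 + b\<^sup>2" and DD: "D\<^sup>2 = t\<^sup>2 + c\<^sup>2" by (auto simp: t D)
  \<comment> \<open>Both \<open>x * \<nu>\<close> and \<open>y * \<nu>\<close> are at least
    \<open>1 / (2 * pi)\<close>, hence \<open>\<eta>\<close> is at least
    \<open>sqrt 2 / (2 * pi)\<close>, about 0.2251.\<close>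
  have e: "0.225 \<le> \<eta>"
  proof -
    have "0.15915 \<le> 1 / (2 * pi)" using pi by (simp add: pos_le_divide_eq)
    then have "0.15915\<^sup>2 \<le> (x * \<nu>)\<^sup>2" "0.15915\<^sup>2 \<le> (y * \<nu>)\<^sup>2"
      using \<nu>(2,3) by (intro power_mono; simp)+
    then have "0.225\<^sup>2 \<le> (x * \<nu>)\<^sup>2 + (y * \<nu>)\<^sup>2" by (simp add: power2_eq_square)
    also have "\<dots> = \<eta>\<^sup>2" by (simp add: \<eta>_def power_mult_distrib distrib_right)
    finally show ?thesis
      by (rule power2_le_imp_le) (use v in \<open>simp add: \<eta>_def\<close>)
  qed
  \<comment> \<open>\<open>q\<close> is the length of the vector with entries \<open>\<eta>\<close>
    and \<open>\<nu>\<close>. The claim is Cauchy-Schwarz against a rounded unit vector in direction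
    \<open>(1, sqrt 2)\<close>, the direction of that vector for \<open>Lx = Ly = 2\<close>.\<close>
  have q': "0.577 * \<eta> + 0.816 * \<nu> \<le> q"
  proof (rule power2_le_imp_le)
    have qq: "q\<^sup>2 = \<eta>\<^sup>2 + \<nu>\<^sup>2" by (simp add: q \<eta>_def power_mult_distrib add_ac distrib_right)
    have le_diff: "A - (X :: real)\<^sup>2 \<le> A" for A X by simp
    have eq: "(0.577 * \<eta> + 0.816 * \<nu>)\<^sup>2 = 0.998785 * (\<eta>\<^sup>2 + \<nu>\<^sup>2) - (0.816 * \<eta> - 0.577 * \<nu>)\<^sup>2"
      by (simp add: power2_eq_square algebra_simps)
    have "(0.577 * \<eta> + 0.816 * \<nu>)\<^sup>2 \<le> 0.998785 * (\<eta>\<^sup>2 + \<nu>\<^sup>2)"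
      unfolding eq by (rule le_diff)
    also have "\<dots> \<le> 1 * (\<eta>\<^sup>2 + \<nu>\<^sup>2)" by (rule mult_right_mono) auto
    finally show "(0.577 * \<eta> + 0.816 * \<nu>)\<^sup>2 \<le> q\<^sup>2" unfolding qq by simp
    show "0 \<le> q" using v by (simp add: q)
  qed
  have xy: "(x * n + 2 * a) * (y * n + 2 * b) \<le> 2 * t\<^sup>2 * (1 + \<eta> / 2)\<^sup>2"
  proof -
    have "(x * n + 2 * a) + (y * n + 2 * b) \<le> 2 * sqrt 2 * t * (1 + \<eta> / 2)"
    proof -
      have "(x + y) * n \<le> (sqrt 2 * sqrt (x\<^sup>2 + y\<^sup>2)) * (\<nu> * t)"
        using sum_two_le_sqrt[of x y] nn n by (intro mult_mono) auto
      moreover have "a + b \<le> sqrt 2 * t" using sum_two_le_sqrt[of a b] t by simp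
      ultimately show ?thesis by (simp add: \<eta>_def algebra_simps)
    qed
    then have "((x * n + 2 * a) + (y * n + 2 * b))\<^sup>2 \<le> (2 * sqrt 2 * t * (1 + \<eta> / 2))\<^sup>2"
      using nn by (intro power_mono) auto
    also have "\<dots> = 8 * t\<^sup>2 * (1 + \<eta> / 2)\<^sup>2" by (simp add: power_mult_distrib)
    finally have "((x * n + 2 * a) + (y * n + 2 * b))\<^sup>2 \<le> 8 * t\<^sup>2 * (1 + \<eta> / 2)\<^sup>2" .
    moreover have "4 * ((x * n + 2 * a) * (y * n + 2 * b)) \<le> ((x * n + 2 * a) + (y * n + 2 * b))\<^sup>2"
    proof -
      have "4 * (u * v) \<le> (u + v)\<^sup>2" for u v :: real
        using zero_le_power2[of "u - v"] by (simp add: power2_sum power2_diff)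
      then show ?thesis by blast
    qed
    ultimately show ?thesis by simp
  qed
  \<comment> \<open>For fixed \<open>D\<close> the product \<open>t^2 * c\<close> is largest when
    \<open>t^2 = 2 * c^2\<close>; splitting \<open>t^2\<close> into two halves makes the inequality
    of the means sharp there. The optimal constant \<open>8 / (3 * sqrt 3)\<close> is rounded up to
    1.54.\<close>
  have tc: "4 * (t\<^sup>2 * c) \<le> 1.54 * D ^ 3"
  proof (rule power2_le_imp_le)
    have "27 * (t\<^sup>2 / 2 * (t\<^sup>2 / 2) * c\<^sup>2) \<le> (t\<^sup>2 / 2 + t\<^sup>2 / 2 + c\<^sup>2) ^ 3" by (rule am_gm_3) auto
    then have "27 * (t\<^sup>2 * c)\<^sup>2 \<le> 4 * (D ^ 3)\<^sup>2"
      by (simp add: DD[symmetric] power_mult_distrib power2_eq_square[of "t\<^sup>2"] flip: power_mult)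
    moreover have "16 * A \<le> 2.3716 * B" if "27 * A \<le> 4 * B" "0 \<le> B" for A B :: real
      using that by simp
    ultimately have "16 * (t\<^sup>2 * c)\<^sup>2 \<le> 2.3716 * (D ^ 3)\<^sup>2" by (meson zero_le_power2)
    then show "(4 * (t\<^sup>2 * c))\<^sup>2 \<le> (1.54 * D ^ 3)\<^sup>2"
      unfolding power_mult_distrib[of 4] power_mult_distrib[of "1.54"]
      by (simp add: power2_eq_square[of "77 / 50"])
  qed (use D0 in simp)
  have "t\<^sup>2 * (n + 4 * c) \<le> (\<nu> + 1.54) * D ^ 3"
  proof -
    have "t\<^sup>2 * n \<le> t\<^sup>2 * (\<nu> * t)" using n by (intro mult_left_mono) auto
    also have "\<dots> = \<nu> * t ^ 3" by (simp add: power2_eq_square power3_eq_cube)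
    also have "\<dots> \<le> \<nu> * D ^ 3" using tD t0 v by (intro mult_left_mono power_mono) auto
    finally show ?thesis using tc by (simp add: algebra_simps)
  qed
  then have "(x * n + 2 * a) * (y * n + 2 * b) * (n + 4 * c) \<le> 2 * (1 + \<eta> / 2)\<^sup>2 * ((\<nu> + 1.54) * D ^ 3)"
  proof -
    assume le: "t\<^sup>2 * (n + 4 * c) \<le> (\<nu> + 1.54) * D ^ 3"
    have "(x * n + 2 * a) * (y * n + 2 * b) * (n + 4 * c) \<le> 2 * t\<^sup>2 * (1 + \<eta> / 2)\<^sup>2 * (n + 4 * c)"
      by (rule mult_right_mono[OF xy]) (use nn in simp)
    also have "\<dots> = 2 * (1 + \<eta> / 2)\<^sup>2 * (t\<^sup>2 * (n + 4 * c))" by (simp add: mult_ac)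
    also have "\<dots> \<le> 2 * (1 + \<eta> / 2)\<^sup>2 * ((\<nu> + 1.54) * D ^ 3)" by (rule mult_left_mono[OF le]) simp
    finally show ?thesis .
  qed
  also have "\<dots> = (2 * (1 + \<eta> / 2)\<^sup>2 * (\<nu> + 1.54)) * D ^ 3" by simp
  also have "\<dots> \<le> (1.764 * (1 + q) ^ 3) * D ^ 3"
  proof (rule mult_right_mono)
    show "2 * (1 + \<eta> / 2)\<^sup>2 * (\<nu> + 1.54) \<le> 1.764 * (1 + q) ^ 3"
      using extremal_polynomial_bound[of "\<eta> - 9 / 40" "\<nu> - 159 / 500" q] e v q' by (simp add: add.commute)
  qed (use D0 in simp)
  finally show ?thesis .
qed

section \<open>Poincare and Sobolev inequalities for single components of the field\<close>

context layer
begin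

abbreviation "lam \<equiv> lambda1 Lx Ly"

lemma lambda1_bounds: "0 < lam" "lam \<le> pi" "lam \<le> 2 * pi / Lx" "lam \<le> 2 * pi / Ly"
  using Lx Ly by (auto simp: lambda1_def)

lemma C_S_cubed: "1.764 * (1 + sqrt (1 + 1 / Lx\<^sup>2 + 1 / Ly\<^sup>2) / lam) ^ 3 \<le> C_S Lx Ly ^ 3"
  unfolding C_S_def power_mult_distrib[of "2 * sqrt 2 * C_3"]
  by (rule mult_right_mono[OF C_3_lower]) (use lambda1_bounds(1) in simp)

definition dirichlet_energy :: "(3 \<Rightarrow> real^3 \<Rightarrow> real) \<Rightarrow> real" where
  "dirichlet_energy fd = (\<Sum>i\<in>UNIV. integral V (\<lambda>x. (fd i x)\<^sup>2))"

lemma dirichlet_energy_eq: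
  assumes "\<And>i. continuous_on slab (fd i)"
  shows "dirichlet_energy fd = (L2 (fd 1))\<^sup>2 + (L2 (fd 2))\<^sup>2 + (L2 (fd 3))\<^sup>2"
  using assms by (simp add: dirichlet_energy_def sum_3 L2_squared continuous_V)

lemma sobolev_from_cube:
  assumes "integral V (\<lambda>x. f x ^ 6) \<le> p\<^sup>2" "0 \<le> p" "p \<le> K ^ 3 * sqrt E ^ 3" "0 \<le> E"
  shows "integral V (\<lambda>x. f x ^ 6) \<le> K ^ 6 * E ^ 3"
proof -
  have "p\<^sup>2 \<le> (K ^ 3 * sqrt E ^ 3)\<^sup>2" using assms by (intro power_mono) auto
  also have "\<dots> = K ^ 6 * ((sqrt E)\<^sup>2) ^ 3" by (simp add: power_mult_distrib flip: power_mult)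
  finally show ?thesis using assms by simp
qed

text \<open>Serves the horizontal components of the field. Vanishing on both walls gives Poincare's
  inequality on vertical lines and deletes the mean term of the vertical factor.\<close>

lemma dirichlet_component:
  fixes fd :: "3 \<Rightarrow> real^3 \<Rightarrow> real"
  assumes f: "\<And>i. has_pd i f (fd i)" and c: "continuous_on slab f" "\<And>i. continuous_on slab (fd i)"
    and p: "periodic 1 f" "periodic 2 f"
    and z: "\<And>x. x \<in> slab \<Longrightarrow> x $ 3 = 0 \<or> x $ 3 = 1 \<Longrightarrow> f x = 0"
  shows "lam\<^sup>2 * integral V (\<lambda>x. (f x)\<^sup>2) \<le> dirichlet_energy fd"
    and "integral V (\<lambda>x. f x ^ 6) \<le> C_S Lx Ly ^ 6 * dirichlet_energy fd ^ 3"
proof -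
  note cV = c[THEN continuous_V]
  have nL: "0 \<le> L2 g" if "continuous_on slab g" for g using that L2_nonneg continuous_V by blast
  have z': "f (upd y 3 0) = 0 \<and> f (upd y 3 (L $ 3)) = 0" if "y \<in> V" for y
  proof -
    have "upd y 3 0 \<in> slab" "upd y 3 1 \<in> slab" by (auto simp: slab_def)
    then show ?thesis using z by simp
  qed
  let ?a = "L2 (fd 1)" and ?b = "L2 (fd 2)" and ?c = "L2 (fd 3)" and ?n = "L2 f"
  define D where "D = sqrt (?a\<^sup>2 + ?b\<^sup>2 + ?c\<^sup>2)"
  have E: "dirichlet_energy fd = ?a\<^sup>2 + ?b\<^sup>2 + ?c\<^sup>2" by (rule dirichlet_energy_eq[OF c(2)])
  have "?n\<^sup>2 \<le> (1 / pi)\<^sup>2 * ?c\<^sup>2"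
    using poincare_dirichlet[OF f c(1) c(2) z'] by (simp add: L2_squared cV)
  then have nc: "pi\<^sup>2 * ?n\<^sup>2 \<le> ?c\<^sup>2" by (simp add: power_divide field_simps)
  have "lam\<^sup>2 * ?n\<^sup>2 \<le> pi\<^sup>2 * ?n\<^sup>2"
    using lambda1_bounds by (intro mult_right_mono power_mono) auto
  then have lE: "lam\<^sup>2 * ?n\<^sup>2 \<le> ?a\<^sup>2 + ?b\<^sup>2 + ?c\<^sup>2" using nc by (smt (verit) zero_le_power2)
  then show "lam\<^sup>2 * integral V (\<lambda>x. (f x)\<^sup>2) \<le> dirichlet_energy fd"
    by (simp add: E L2_squared cV)
  have "(lam * ?n)\<^sup>2 \<le> ?a\<^sup>2 + ?b\<^sup>2 + ?c\<^sup>2" using lE by (simp add: power_mult_distrib)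
  then have lD: "lam * ?n \<le> D" unfolding D_def by (rule real_le_rsqrt)
  define s where "s = sqrt (1 + (1 / Lx)\<^sup>2 + (1 / Ly)\<^sup>2)"
  have ns: "?n * s \<le> s / lam * D"
    using mult_left_mono[OF lD, of "s / lam"] lambda1_bounds(1) by (simp add: s_def mult.commute)
  define k :: "3 \<Rightarrow> real" where "k i = (if i = 3 then 0 else 1)" for i
  have sup: "f x ^ 4 \<le> k i / L $ i * LI i (\<lambda>y. f y ^ 4) x + 1 / 2 * LI i (\<lambda>y. \<bar>4 * f y ^ 3 * fd i y\<bar>) x"
    if x: "x \<in> V" for i x
  proof (cases "i = 3")
    case True
    then show ?thesis using line_bounds(3)[OF f c x] z' by (simp add: k_def)
  next
    case False
    then have "matching i f" using exhaust_3[of i] p periodic_matching by auto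
    then show ?thesis using line_bounds(2)[OF f c x] False by (simp add: k_def)
  qed
  have "integral V (\<lambda>x. f x ^ 6) \<le> (\<Prod>i\<in>UNIV. k i / L $ i * ?n + 4 * (1 / 2) * L2 (fd i))\<^sup>2"
    by (rule sobolev_of_line_bounds[where w = "\<lambda>_. 1 / 2"]) (use cV sup in \<open>auto simp: k_def\<close>)
  also have "\<dots> = ((1 / Lx * ?n + 2 * ?a) * (1 / Ly * ?n + 2 * ?b) * (2 * ?c))\<^sup>2"
    by (simp add: prod_UNIV_3 k_def)
  finally have "integral V (\<lambda>x. f x ^ 6) \<le> ((1 / Lx * ?n + 2 * ?a) * (1 / Ly * ?n + 2 * ?b) * (2 * ?c))\<^sup>2" .
  then show "integral V (\<lambda>x. f x ^ 6) \<le> C_S Lx Ly ^ 6 * dirichlet_energy fd ^ 3"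
  proof (rule sobolev_from_cube)
    have "(1 / Lx * ?n + 2 * ?a) * (1 / Ly * ?n + 2 * ?b) * (2 * ?c) \<le> 1.764 * (1 + s / lam) ^ 3 * D ^ 3"
      by (rule dirichlet_product_bound)
         (use nL c Lx Ly lambda1_bounds(1) ns in \<open>auto simp: s_def D_def\<close>)
    also have "\<dots> \<le> C_S Lx Ly ^ 3 * D ^ 3"
      using C_S_cubed by (intro mult_right_mono) (auto simp: s_def D_def power_divide)
    finally show "(1 / Lx * ?n + 2 * ?a) * (1 / Ly * ?n + 2 * ?b) * (2 * ?c)
        \<le> C_S Lx Ly ^ 3 * sqrt (dirichlet_energy fd) ^ 3"
      by (simp add: E D_def)
    show "0 \<le> (1 / Lx * ?n + 2 * ?a) * (1 / Ly * ?n + 2 * ?b) * (2 * ?c)"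
      using nL c Lx Ly by (intro mult_nonneg_nonneg add_nonneg_nonneg) auto
  qed (simp add: E)
qed

text \<open>Serves the vertical component, which has no prescribed values on the walls. Poincare's
  inequality comes from the horizontal planes and bounds the L2 norm by \<open>t / lam\<close>,
  stronger than the bound by \<open>D / lam\<close>; this pays for the weaker vertical line
  bound.\<close>

lemma mean_free_component:
  fixes fd :: "3 \<Rightarrow> real^3 \<Rightarrow> real"
  assumes f: "\<And>i. has_pd i f (fd i)" and c: "continuous_on slab f" "\<And>i. continuous_on slab (fd i)"
    and p: "periodic 1 f" "periodic 2 f"
    and mean: "\<And>x. x \<in> V \<Longrightarrow> LI 2 (LI 1 f) x = 0"
  shows "lam\<^sup>2 * integral V (\<lambda>x. (f x)\<^sup>2) \<le> dirichlet_energy fd"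
    and "integral V (\<lambda>x. f x ^ 6) \<le> C_S Lx Ly ^ 6 * dirichlet_energy fd ^ 3"
proof -
  note cV = c[THEN continuous_V]
  have nL: "0 \<le> L2 g" if "continuous_on slab g" for g using that L2_nonneg continuous_V by blast
  let ?a = "L2 (fd 1)" and ?b = "L2 (fd 2)" and ?c = "L2 (fd 3)" and ?n = "L2 f"
  define D t where "D = sqrt (?a\<^sup>2 + ?b\<^sup>2 + ?c\<^sup>2)" and "t = sqrt (?a\<^sup>2 + ?b\<^sup>2)"
  have E: "dirichlet_energy fd = ?a\<^sup>2 + ?b\<^sup>2 + ?c\<^sup>2" by (rule dirichlet_energy_eq[OF c(2)])
  have l0: "0 < lam" by (rule lambda1_bounds)
  have le: "r / (2 * pi) \<le> 1 / lam" if "0 < r" "lam \<le> 2 * pi / r" for r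
    using that l0 by (simp add: field_simps)
  have "?n\<^sup>2 \<le> (Lx / (2 * pi))\<^sup>2 * ?a\<^sup>2 + (Ly / (2 * pi))\<^sup>2 * ?b\<^sup>2"
    using poincare_horizontal[OF f f c(1) c(2) c(2) p mean] by (simp add: L2_squared cV)
  also have "\<dots> \<le> (1 / lam)\<^sup>2 * ?a\<^sup>2 + (1 / lam)\<^sup>2 * ?b\<^sup>2"
    using le[OF Lx lambda1_bounds(3)] le[OF Ly lambda1_bounds(4)] Lx Ly
    by (intro add_mono mult_right_mono power_mono) auto
  finally have lE: "lam\<^sup>2 * ?n\<^sup>2 \<le> ?a\<^sup>2 + ?b\<^sup>2"
    using l0 by (simp add: power_divide field_simps)
  then have "lam\<^sup>2 * ?n\<^sup>2 \<le> ?a\<^sup>2 + ?b\<^sup>2 + ?c\<^sup>2" by (smt (verit) zero_le_power2)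
  then show "lam\<^sup>2 * integral V (\<lambda>x. (f x)\<^sup>2) \<le> dirichlet_energy fd"
    by (simp add: E L2_squared cV)
  have "(lam * ?n)\<^sup>2 \<le> ?a\<^sup>2 + ?b\<^sup>2" using lE by (simp add: power_mult_distrib)
  then have "lam * ?n \<le> t" unfolding t_def by (rule real_le_rsqrt)
  then have nt: "?n \<le> 1 / lam * t" using l0 by (simp add: field_simps)
  define s where "s = sqrt (1 + (1 / Lx)\<^sup>2 + (1 / Ly)\<^sup>2)"
  define w :: "3 \<Rightarrow> real" where "w i = (if i = 3 then 1 else 1 / 2)" for i
  have sup: "f x ^ 4 \<le> 1 / L $ i * LI i (\<lambda>y. f y ^ 4) x + w i * LI i (\<lambda>y. \<bar>4 * f y ^ 3 * fd i y\<bar>) x"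
    if x: "x \<in> V" for i x
  proof (cases "i = 3")
    case True
    then show ?thesis using line_bounds(1)[OF f c x, of i] by (simp add: w_def)
  next
    case False
    then have "matching i f" using exhaust_3[of i] p periodic_matching by auto
    then show ?thesis using line_bounds(2)[OF f c x] False by (simp add: w_def)
  qed
  have "integral V (\<lambda>x. f x ^ 6) \<le> (\<Prod>i\<in>UNIV. 1 / L $ i * ?n + 4 * w i * L2 (fd i))\<^sup>2"
    by (rule sobolev_of_line_bounds[where k = "\<lambda>_. 1"]) (use cV sup in \<open>auto simp: w_def\<close>)
  also have "\<dots> = ((1 / Lx * ?n + 2 * ?a) * (1 / Ly * ?n + 2 * ?b) * (?n + 4 * ?c))\<^sup>2"
    by (simp add: prod_UNIV_3 w_def)
  finally have "integral V (\<lambda>x. f x ^ 6) \<le> ((1 / Lx * ?n + 2 * ?a) * (1 / Ly * ?n + 2 * ?b) * (?n + 4 * ?c))\<^sup>2" .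
  then show "integral V (\<lambda>x. f x ^ 6) \<le> C_S Lx Ly ^ 6 * dirichlet_energy fd ^ 3"
  proof (rule sobolev_from_cube)
    have "(1 / Lx * ?n + 2 * ?a) * (1 / Ly * ?n + 2 * ?b) * (?n + 4 * ?c) \<le> 1.764 * (1 + s / lam) ^ 3 * D ^ 3"
    proof (rule neumann_product_bound[OF _ _ _ _ _ _ t_def D_def nt])
      show "1 / pi \<le> 1 / lam" using lambda1_bounds by (simp add: frac_le)
      show "1 / (2 * pi) \<le> 1 / Lx * (1 / lam)" "1 / (2 * pi) \<le> 1 / Ly * (1 / lam)"
        using lambda1_bounds Lx Ly by (simp_all add: field_simps)
    qed (use nL c Lx Ly in \<open>auto simp: s_def\<close>)
    also have "\<dots> \<le> C_S Lx Ly ^ 3 * D ^ 3"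
      using C_S_cubed by (intro mult_right_mono) (auto simp: s_def D_def power_divide)
    finally show "(1 / Lx * ?n + 2 * ?a) * (1 / Ly * ?n + 2 * ?b) * (?n + 4 * ?c)
        \<le> C_S Lx Ly ^ 3 * sqrt (dirichlet_energy fd) ^ 3"
      by (simp add: E D_def)
    show "0 \<le> (1 / Lx * ?n + 2 * ?a) * (1 / Ly * ?n + 2 * ?b) * (?n + 4 * ?c)"
      using nL c Lx Ly by (intro mult_nonneg_nonneg add_nonneg_nonneg) auto
  qed (simp add: E)
qed

end

section \<open>Hoelder's inequality\<close>

text \<open>Jensen's inequality from the tangent of \<open>exp\<close> at the barycentre
  \<open>m\<close>.\<close>

lemma exp_convex_combination:
  fixes \<alpha> t :: "nat \<Rightarrow> real"
  assumes "\<And>i. i < n \<Longrightarrow> 0 \<le> \<alpha> i" "(\<Sum>i<n. \<alpha> i) = 1"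
  shows "exp (\<Sum>i<n. \<alpha> i * t i) \<le> (\<Sum>i<n. \<alpha> i * exp (t i))"
proof -
  define m where "m = (\<Sum>i<n. \<alpha> i * t i)"
  have "exp m = exp m * ((\<Sum>i<n. \<alpha> i) + (\<Sum>i<n. \<alpha> i * t i) - m * (\<Sum>i<n. \<alpha> i))"
    using assms by (simp add: m_def)
  also have "\<dots> = (\<Sum>i<n. \<alpha> i * (exp m * (1 + (t i - m))))"
    by (simp add: sum_distrib_left algebra_simps sum.distrib sum_subtractf)
  also have "\<dots> \<le> (\<Sum>i<n. \<alpha> i * exp (t i))"
  proof (intro sum_mono mult_left_mono)
    fix i
    have "exp m * (1 + (t i - m)) \<le> exp m * exp (t i - m)"
      by (intro mult_left_mono exp_ge_add_one_self) simp
    then show "exp m * (1 + (t i - m)) \<le> exp (t i)" by (simp flip: exp_add)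
  qed (use assms in auto)
  finally show ?thesis by (simp add: m_def)
qed

text \<open>The weighted inequality of the means, with weights that sum to 1. They are the Hoelder
  weights for L2, L2, L6 and Lp once a function \<open>b\<close> is written as
  \<open>b powr ((p - 3) / p) * b powr (3 / p)\<close>, the first power being measured in L2 and the
  second in L6.\<close>

lemma young_four:
  fixes u v w r p :: real
  assumes "0 < u" "0 < v" "0 < w" "0 < r" and p: "3 \<le> p"
  shows "u * v powr ((p - 3) / p) * w powr (3 / p) * r
    \<le> 1 / 2 * u\<^sup>2 + (p - 3) / (2 * p) * v\<^sup>2 + 1 / (2 * p) * w ^ 6 + 1 / p * r powr p"
proof -
  define \<alpha> t where "\<alpha> i = [1 / 2, (p - 3) / (2 * p), 1 / (2 * p), 1 / p] ! i"
    and "t i = [2 * ln u, 2 * ln v, 6 * ln w, p * ln r] ! i" for i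
  have sum: "(\<Sum>i<4. h i) = h 0 + h 1 + h 2 + h (3 :: nat)" for h :: "nat \<Rightarrow> real"
    by (simp add: eval_nat_numeral)
  have "exp (\<Sum>i<4. \<alpha> i * t i) \<le> (\<Sum>i<4. \<alpha> i * exp (t i))"
  proof (rule exp_convex_combination)
    show "0 \<le> \<alpha> i" if "i < 4" for i
      using that p by (auto simp: \<alpha>_def eval_nat_numeral less_Suc_eq)
    show "(\<Sum>i<4. \<alpha> i) = 1" using p by (simp add: sum \<alpha>_def field_simps eval_nat_numeral)
  qed
  moreover have "exp (\<Sum>i<4. \<alpha> i * t i) = u * v powr ((p - 3) / p) * w powr (3 / p) * r"
  proof -
    have "(\<Sum>i<4. \<alpha> i * t i) = ln u + (p - 3) / p * ln v + 3 / p * ln w + ln r"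
      using p by (simp add: sum \<alpha>_def t_def eval_nat_numeral)
    then show ?thesis using assms by (simp add: exp_add powr_def)
  qed
  moreover have "exp (2 * ln u) = u\<^sup>2" "exp (2 * ln v) = v\<^sup>2" "exp (6 * ln w) = w ^ 6" "exp (p * ln r) = r powr p"
    using assms exp_of_nat_mult[of 2 "ln u"] exp_of_nat_mult[of 2 "ln v"] exp_of_nat_mult[of 6 "ln w"]
    by (simp_all add: powr_def)
  ultimately show ?thesis by (simp add: sum \<alpha>_def t_def eval_nat_numeral)
qed

lemma cube_convex_three:
  fixes X w :: "3 \<Rightarrow> real"
  assumes X: "\<And>j. 0 \<le> X j" and w: "\<And>j. 0 < w j" "(\<Sum>j\<in>UNIV. w j) = 1"
  shows "(\<Sum>j\<in>UNIV. X j) ^ 3 \<le> (\<Sum>j\<in>UNIV. X j ^ 3 / (w j)\<^sup>2)"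
proof -
  have "(\<Sum>j\<in>UNIV. w j *\<^sub>R (X j / w j)) ^ 3 \<le> (\<Sum>j\<in>UNIV. w j * (X j / w j) ^ 3)"
  proof (rule convex_on_sum)
    show "convex_on {0..} (\<lambda>x::real. x ^ 3)"
      by (rule convex_power_odd) simp
  qed (use assms in \<open>auto simp: less_imp_le\<close>)
  moreover have "w j *\<^sub>R (X j / w j) = X j" "w j * (X j / w j) ^ 3 = X j ^ 3 / (w j)\<^sup>2" for j
    using w(1)[of j] by (auto simp: power_divide power2_eq_square power3_eq_cube)
  ultimately show ?thesis by simp
qed

context layer
begin

text \<open>This is Minkowski's inequality in L3 for the squares of the components, so that no
  constant is lost in passing from components to the vector. It follows from convexity of the cube
  with weights proportional to the bounds \<open>E j\<close>. The shift by \<open>e\<close> keeps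
  the weights positive and is sent to 0 at the end.\<close>

lemma vector_sixth_power_bound:
  fixes f :: "3 \<Rightarrow> real^3 \<Rightarrow> real" and E :: "3 \<Rightarrow> real"
  assumes c: "\<And>j. continuous_on V (f j)" and K: "0 \<le> K" and E: "\<And>j. 0 \<le> E j"
    and le: "\<And>j. integral V (\<lambda>x. f j x ^ 6) \<le> K * E j ^ 3"
  shows "integral V (\<lambda>x. (\<Sum>j\<in>UNIV. (f j x)\<^sup>2) ^ 3) \<le> K * (\<Sum>j\<in>UNIV. E j) ^ 3"
proof -
  have eps: "integral V (\<lambda>x. (\<Sum>j\<in>UNIV. (f j x)\<^sup>2) ^ 3) \<le> K * (\<Sum>j\<in>UNIV. E j + e) ^ 3" if e: "0 < e" for e
  proof -
    define S w where "S = (\<Sum>j\<in>UNIV. E j + e)" and "w j = (E j + e) / S" for j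
    have Ee: "0 < E j + e" for j using E[of j] e by simp
    have S: "0 < S" unfolding S_def by (rule sum_pos) (use Ee in auto)
    have w: "0 < w j" for j using Ee S by (simp add: w_def)
    have wn: "w j \<noteq> 0" for j using w[of j] by simp
    have w1: "(\<Sum>j\<in>UNIV. w j) = 1" using S by (simp add: w_def S_def flip: sum_divide_distrib)
    have "integral V (\<lambda>x. (\<Sum>j\<in>UNIV. (f j x)\<^sup>2) ^ 3) \<le> integral V (\<lambda>x. \<Sum>j\<in>UNIV. 1 / (w j)\<^sup>2 * f j x ^ 6)"
    proof (rule integral_V_mono)
      show "(\<Sum>j\<in>UNIV. (f j y)\<^sup>2) ^ 3 \<le> (\<Sum>j\<in>UNIV. 1 / (w j)\<^sup>2 * f j y ^ 6)" for y
        using cube_convex_three[of "\<lambda>j. (f j y)\<^sup>2" w, OF _ w w1] by (simp flip: power_mult)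
    qed (auto intro!: continuous_intros c simp: wn)
    also have "\<dots> = (\<Sum>j\<in>UNIV. integral V (\<lambda>x. 1 / (w j)\<^sup>2 * f j x ^ 6))"
      by (rule integral_sum) (auto intro!: integrable_V continuous_intros c simp: wn)
    also have "\<dots> \<le> (\<Sum>j\<in>UNIV. K * S\<^sup>2 * (E j + e))"
    proof (rule sum_mono)
      fix j
      have "integral V (\<lambda>x. 1 / (w j)\<^sup>2 * f j x ^ 6) = 1 / (w j)\<^sup>2 * integral V (\<lambda>x. f j x ^ 6)"
        by (rule integral_mult_right)
      also have "\<dots> \<le> 1 / (w j)\<^sup>2 * (K * (E j + e) ^ 3)"
        using le[of j] mult_left_mono[OF power_mono[of "E j" "E j + e" 3] K] E[of j] e
        by (intro mult_left_mono) auto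
      also have "\<dots> = K * S\<^sup>2 * (E j + e)"
        using Ee[of j] S by (simp add: w_def power_divide power2_eq_square power3_eq_cube)
      finally show "integral V (\<lambda>x. 1 / (w j)\<^sup>2 * f j x ^ 6) \<le> K * S\<^sup>2 * (E j + e)" .
    qed
    also have "\<dots> = K * S ^ 3"
      by (simp add: S_def power2_eq_square power3_eq_cube flip: sum_distrib_left)
    finally show ?thesis by (simp add: S_def)
  qed
  have "((\<lambda>e. K * (\<Sum>j\<in>UNIV. E j + e) ^ 3) \<longlongrightarrow> K * (\<Sum>j\<in>UNIV. E j + 0) ^ 3) (at_right 0)"
    by (intro tendsto_intros)
  moreover have "\<forall>\<^sub>F e in at_right 0. integral V (\<lambda>x. (\<Sum>j\<in>UNIV. (f j x)\<^sup>2) ^ 3) \<le> K * (\<Sum>j\<in>UNIV. E j + e) ^ 3"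
    using eps by (auto simp: eventually_at_right_less eventually_at_filter)
  ultimately show ?thesis
    using tendsto_lowerbound by fastforce
qed

lemma C_S_pos: "0 < C_S Lx Ly"
  using lambda1_bounds(1) by (auto simp: C_S_def C_3_def intro!: mult_pos_pos divide_pos_pos add_pos_nonneg)

text \<open>After division by the positive bounds, Young's inequality gives the integrand pointwise
  as at most \<open>M * R x\<close>, and the integral of \<open>R\<close> is at most the sum of the
  weights, which is 1.\<close>

lemma holder_finite:
  fixes j b g :: "real^3 \<Rightarrow> real"
  assumes p: "3 \<le> p" and c: "continuous_on V j" "continuous_on V b" "continuous_on V g"
    and nn: "\<And>x. 0 \<le> j x" "\<And>x. 0 \<le> b x" "\<And>x. 0 \<le> g x"
    and a: "0 < a" and \<beta>: "0 < \<beta>" and \<gamma>: "0 < \<gamma>" and G: "0 < G"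
    and le: "integral V (\<lambda>x. (j x)\<^sup>2) \<le> a\<^sup>2" "integral V (\<lambda>x. (b x)\<^sup>2) \<le> \<beta>\<^sup>2"
      "integral V (\<lambda>x. b x ^ 6) \<le> \<gamma> ^ 6" "integral V (\<lambda>x. g x powr p) \<le> G powr p"
  shows "integral V (\<lambda>x. j x * b x * g x) \<le> a * (\<beta> powr ((p - 3) / p) * \<gamma> powr (3 / p)) * G"
proof -
  define M where "M = a * (\<beta> powr ((p - 3) / p) * \<gamma> powr (3 / p)) * G"
  have M: "0 < M" using a \<beta> \<gamma> G by (simp add: M_def)
  define R where "R x = 1 / 2 * (1 / a\<^sup>2 * (j x)\<^sup>2) + (p - 3) / (2 * p) * (1 / \<beta>\<^sup>2 * (b x)\<^sup>2)
      + 1 / (2 * p) * (1 / \<gamma> ^ 6 * b x ^ 6) + 1 / p * (1 / G powr p * g x powr p)" for x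
  have cp: "continuous_on V (\<lambda>x. g x powr p)"
    by (rule continuous_on_powr') (use c nn p in \<open>auto intro: continuous_intros\<close>)
  have cT: "continuous_on V (\<lambda>x. 1 / 2 * (1 / a\<^sup>2 * (j x)\<^sup>2))"
    "continuous_on V (\<lambda>x. (p - 3) / (2 * p) * (1 / \<beta>\<^sup>2 * (b x)\<^sup>2))"
    "continuous_on V (\<lambda>x. 1 / (2 * p) * (1 / \<gamma> ^ 6 * b x ^ 6))"
    "continuous_on V (\<lambda>x. 1 / p * (1 / G powr p * g x powr p))"
    by (intro continuous_on_mult_left continuous_on_power c cp)+
  note cT2 = continuous_on_add[OF cT(1,2)] and cT3 = continuous_on_add[OF continuous_on_add[OF cT(1,2)] cT(3)]
  have cR: "continuous_on V R" unfolding R_def by (rule continuous_on_add[OF cT3 cT(4)])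
  have pt: "j x * b x * g x \<le> M * R x" for x
  proof (cases "j x = 0 \<or> b x = 0 \<or> g x = 0")
    case True
    have "0 \<le> R x" unfolding R_def using p nn by (intro add_nonneg_nonneg mult_nonneg_nonneg) auto
    then show ?thesis using True M by auto
  next
    case False
    then have pos: "0 < j x" "0 < b x" "0 < g x" using nn[of x] by (auto simp: less_le)
    have "j x / a * (b x / \<beta>) powr ((p - 3) / p) * (b x / \<gamma>) powr (3 / p) * (g x / G) \<le> R x"
      using young_four[of "j x / a" "b x / \<beta>" "b x / \<gamma>" "g x / G" p] pos a \<beta> \<gamma> G p
      by (simp add: R_def power_divide powr_divide)
    moreover have "b x powr ((p - 3) / p) * b x powr (3 / p) = b x"
    proof -
      have "(p - 3) / p + 3 / p = 1" using p by (simp flip: add_divide_distrib)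
      then show ?thesis using pos by (simp flip: powr_add)
    qed
    then have "j x / a * (b x / \<beta>) powr ((p - 3) / p) * (b x / \<gamma>) powr (3 / p) * (g x / G) = j x * b x * g x / M"
      using pos \<beta> \<gamma> by (simp add: M_def powr_divide mult_ac)
    ultimately show ?thesis using M by (simp add: pos_divide_le_eq mult.commute)
  qed
  have "integral V R = 1 / 2 * (1 / a\<^sup>2 * integral V (\<lambda>x. (j x)\<^sup>2))
      + (p - 3) / (2 * p) * (1 / \<beta>\<^sup>2 * integral V (\<lambda>x. (b x)\<^sup>2))
      + 1 / (2 * p) * (1 / \<gamma> ^ 6 * integral V (\<lambda>x. b x ^ 6)) + 1 / p * (1 / G powr p * integral V (\<lambda>x. g x powr p))"
    unfolding R_def integral_V_add[OF cT3 cT(4)] integral_V_add[OF cT2 cT(3)] integral_V_add[OF cT(1,2)]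
      integral_mult_right ..
  also have "\<dots> \<le> 1 / 2 * 1 + (p - 3) / (2 * p) * 1 + 1 / (2 * p) * 1 + 1 / p * 1"
    by (intro add_mono mult_left_mono) (use le a \<beta> \<gamma> G p in \<open>auto simp: pos_divide_le_eq\<close>)
  also have "\<dots> = 1" using p by (simp add: field_simps)
  finally have "integral V R \<le> 1" .
  with M have "M * integral V R \<le> M" by simp
  moreover have "integral V (\<lambda>x. j x * b x * g x) \<le> integral V (\<lambda>x. M * R x)"
    by (rule integral_V_mono) (use pt in \<open>auto intro!: continuous_intros c cR\<close>)
  ultimately show ?thesis by (simp add: M_def)
qed

lemma AE_le_esssup:
  fixes g :: "real^3 \<Rightarrow> 'b::real_normed_vector"
  assumes c: "continuous_on V g"
  shows "AE x in lebesgue_on V. norm (g x) \<le> Lp_norm \<infinity> V g"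
proof -
  let ?M = "lebesgue_on V" and ?f = "\<lambda>x. ereal (norm (g x))"
  have V: "V \<in> sets lebesgue" "compact V" by (simp_all add: cell_def)
  have cn: "continuous_on V (\<lambda>x. norm (g x))" by (intro continuous_intros c)
  have m: "(\<lambda>x. norm (g x)) \<in> borel_measurable ?M"
    by (rule continuous_imp_measurable_on_sets_lebesgue[OF cn V(1)])
  then have mf: "?f \<in> borel_measurable ?M" by measurable
  obtain K where K: "norm (g x) \<le> K" if "x \<in> V" for x
    using compact_imp_bounded[OF compact_continuous_image[OF cn V(2)]] by (auto simp: bounded_iff)
  \<comment> \<open>Boundedness on the compact cell excludes the value infinity, at which
    \<open>real_of_ereal\<close> would return 0.\<close>
  have up: "esssup ?M ?f \<le> ereal K" by (rule esssup_I[OF mf]) (use K in \<open>auto intro!: AE_I2\<close>)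
  have ae: "AE x in ?M. ?f x \<le> esssup ?M ?f" by (rule esssup_AE)
  show ?thesis
  proof (cases "esssup ?M ?f = - \<infinity>")
    \<comment> \<open>No norm lies below minus infinity, so in this case almost every point
      satisfies a contradiction and any bound follows.\<close>
    case True
    then show ?thesis using ae by (auto elim: eventually_mono)
  next
    case False
    then obtain r where "esssup ?M ?f = ereal r" using up by (cases "esssup ?M ?f") auto
    then show ?thesis using ae by (simp add: Lp_norm_def)
  qed
qed

lemma holder_infinite:
  fixes j b :: "real^3 \<Rightarrow> real" and g :: "real^3 \<Rightarrow> real^2"
  assumes c: "continuous_on V j" "continuous_on V b" "continuous_on V g"
    and nn: "\<And>x. 0 \<le> j x" "\<And>x. 0 \<le> b x"
  shows "integral V (\<lambda>x. j x * b x * norm (g x)) \<le> Lp_norm \<infinity> V g * integral V (\<lambda>x. j x * b x)"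
proof -
  let ?M = "lebesgue_on V" and ?K = "Lp_norm \<infinity> V g"
  have V: "V \<in> sets lebesgue" by (simp add: cell_def)
  have int: "integrable ?M h" if "continuous_on V h" for h :: "real^3 \<Rightarrow> real"
    using that continuous_imp_integrable cell_def by metis
  have "integral\<^sup>L ?M (\<lambda>x. j x * b x * norm (g x)) \<le> integral\<^sup>L ?M (\<lambda>x. ?K * (j x * b x))"
  proof (rule integral_mono_AE)
    show "AE x in ?M. j x * b x * norm (g x) \<le> ?K * (j x * b x)"
      using AE_le_esssup[OF c(3)]
    proof eventually_elim
      case (elim x)
      then show ?case using mult_left_mono[OF elim, of "j x * b x"] nn by (simp add: mult.commute)
    qed
  qed (intro int continuous_intros c)+
  moreover have "integral\<^sup>L ?M h = integral V h" if "continuous_on V h" for h :: "real^3 \<Rightarrow> real"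
    using lebesgue_integral_eq_integral[OF int[OF that] V] .
  moreover have "continuous_on V (\<lambda>x. j x * b x * norm (g x))" "continuous_on V (\<lambda>x. j x * b x)"
    by (intro continuous_intros c)+
  ultimately show ?thesis by simp
qed

text \<open>With \<open>j\<close> and \<open>b\<close> equal to 1, Hoelder's inequality bounds a
  nonnegative integral by the norm times the positive volume \<open>Lx * Ly\<close>.\<close>

lemma Lp_norm_infinity_nonneg:
  fixes g :: "real^3 \<Rightarrow> real^2"
  assumes c: "continuous_on V g"
  shows "0 \<le> Lp_norm \<infinity> V g"
proof -
  have "integral V (\<lambda>_. 1 :: real) = Lx * Ly"
    unfolding fubini[OF continuous_on_const, of _ 0] LI_def using Lx Ly by simp
  moreover have "0 \<le> integral V (\<lambda>x. norm (g x))"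
    by (auto intro!: integral_V_nonneg continuous_intros c)
  ultimately have "0 \<le> Lp_norm \<infinity> V g * (Lx * Ly)"
    using holder_infinite[of "\<lambda>_. 1" "\<lambda>_. 1" g] c by simp
  then show ?thesis using mult_pos_pos[OF Lx Ly] by (auto simp: zero_le_mult_iff)
qed

text \<open>\<open>A_const\<close> is the constant of interpolation between the L2 bound
  \<open>C_P * sqrt E\<close> and the L6 bound \<open>C_S * sqrt E\<close>; the powers of
  \<open>sqrt E\<close> recombine to \<open>E\<close>. The number \<open>G\<close> lies strictly
  above the norm, because the normalisation in Hoelder's inequality divides by it and the norm may
  be 0.\<close>

lemma holder_A_const:
  fixes j b :: "real^3 \<Rightarrow> real" and g :: "real^3 \<Rightarrow> real^2" and p :: ereal
  assumes p: "3 \<le> p" and c: "continuous_on V j" "continuous_on V b" "continuous_on V g"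
    and nn: "\<And>x. 0 \<le> j x" "\<And>x. 0 \<le> b x"
    and E: "0 < E" "integral V (\<lambda>x. (j x)\<^sup>2) \<le> E" "lam\<^sup>2 * integral V (\<lambda>x. (b x)\<^sup>2) \<le> E"
      "integral V (\<lambda>x. b x ^ 6) \<le> C_S Lx Ly ^ 6 * E ^ 3"
    and G: "Lp_norm p V g < G"
  shows "integral V (\<lambda>x. j x * b x * norm (g x)) \<le> A_const Lx Ly p * G * E"
proof -
  define a where "a = sqrt E"
  have a: "0 < a" "a\<^sup>2 = E" using E(1) by (auto simp: a_def)
  have a6: "a ^ 6 = E ^ 3" unfolding a(2)[symmetric] by (simp flip: power_mult)
  have l: "0 < lam" "C_P Lx Ly = 1 / lam" using lambda1_bounds by (auto simp: C_P_def)
  have b2: "integral V (\<lambda>x. (b x)\<^sup>2) \<le> (C_P Lx Ly * a)\<^sup>2"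
    using E(3) l(1) unfolding l(2) by (simp add: power_mult_distrib a(2) power_divide pos_le_divide_eq mult.commute)
  show ?thesis
  proof (cases "p = \<infinity>")
    case True
    have "integral V (\<lambda>x. j x * b x) \<le> C_P Lx Ly * E"
    proof -
      have "integral V (\<lambda>x. j x * b x) \<le> sqrt (integral V (\<lambda>x. (j x)\<^sup>2)) * sqrt (integral V (\<lambda>x. (b x)\<^sup>2))"
        using integral_cauchy_schwarz[OF c(1,2)] nn by simp
      also have "\<dots> \<le> a * (C_P Lx Ly * a)"
        by (intro mult_mono real_le_lsqrt) (use b2 E a l in \<open>auto intro!: integral_V_nonneg continuous_intros c\<close>)
      also have "\<dots> = C_P Lx Ly * a\<^sup>2" by (simp add: power2_eq_square)
      finally show ?thesis by (simp only: a(2))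
    qed
    have jb: "0 \<le> integral V (\<lambda>x. j x * b x)"
      using nn by (auto intro!: integral_V_nonneg continuous_intros c)
    have "integral V (\<lambda>x. j x * b x * norm (g x)) \<le> Lp_norm \<infinity> V g * integral V (\<lambda>x. j x * b x)"
      by (rule holder_infinite) (use c nn in auto)
    also have "\<dots> \<le> G * (C_P Lx Ly * E)"
      by (intro mult_mono) (use G True \<open>_ \<le> C_P Lx Ly * E\<close> jb Lp_norm_infinity_nonneg[OF c(3)] in auto)
    finally show ?thesis using True by (simp add: A_const_def mult_ac)
  next
    case False
    then obtain r where r: "p = ereal r" "3 \<le> r" using p by (cases p) auto
    have N: "Lp_norm p V g = integral V (\<lambda>x. norm (g x) powr r) powr (1 / r)" by (simp add: Lp_norm_def r)
    then have G0: "0 < G" using G powr_ge_zero by (metis order_le_less_trans)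
    have cp: "continuous_on V (\<lambda>x. norm (g x) powr r)"
      by (rule continuous_on_powr') (use c r in \<open>auto intro!: continuous_intros\<close>)
    have "integral V (\<lambda>x. norm (g x) powr r) = (Lp_norm p V g) powr r"
      unfolding N using r(2) integral_V_nonneg[OF cp] by (simp add: powr_powr)
    also have "\<dots> \<le> G powr r" by (rule powr_mono2) (use r G N in auto)
    finally have "integral V (\<lambda>x. norm (g x) powr r) \<le> G powr r" .
    then have "integral V (\<lambda>x. j x * b x * norm (g x))
        \<le> a * ((C_P Lx Ly * a) powr ((r - 3) / r) * (C_S Lx Ly * a) powr (3 / r)) * G"
      by (intro holder_finite) (use r c nn a l C_S_pos G0 E b2 in \<open>auto intro!: continuous_intros simp: power_mult_distrib a6\<close>)
    also have "(C_P Lx Ly * a) powr ((r - 3) / r) * (C_S Lx Ly * a) powr (3 / r) = A_const Lx Ly p * a"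
    proof -
      have "(r - 3) / r + 3 / r = 1" using r by (simp flip: add_divide_distrib)
      then have "a powr ((r - 3) / r) * a powr (3 / r) = a" using a by (simp flip: powr_add)
      moreover have "0 \<le> C_P Lx Ly" using l by simp
      then have "(C_P Lx Ly * a) powr ((r - 3) / r) * (C_S Lx Ly * a) powr (3 / r)
          = A_const Lx Ly p * (a powr ((r - 3) / r) * a powr (3 / r))"
        using a(1) C_S_pos by (simp add: A_const_def r powr_mult)
      ultimately show ?thesis by simp
    qed
    also have "a * (A_const Lx Ly p * a) * G = A_const Lx Ly p * G * a\<^sup>2" by (simp add: power2_eq_square)
    finally show ?thesis by (simp only: a(2))
  qed
qed

end

section \<open>Regularity of the fields\<close>

lemma convex_slab: "convex slab"
proof -
  have eq: "slab = {x. axis 3 1 \<bullet> x \<ge> 0} \<inter> {x. axis 3 1 \<bullet> x \<le> (1 :: real)}"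
    by (auto simp: slab_def inner_axis' )
  show ?thesis unfolding eq
    by (intro convex_Int convex_halfspace_ge convex_halfspace_le)
qed

lemma has_vector_derivative_slice:
  assumes f: "(f has_derivative D) (at x within slab)" and x: "x \<in> slab"
  shows "((\<lambda>s. f (upd x i s)) has_vector_derivative D (axis i 1)) (at (x $ i) within axis_range i)"
proof -
  have "((\<lambda>s. x + (s - x $ i) *\<^sub>R axis i 1) has_derivative (\<lambda>h. h *\<^sub>R axis i 1)) (at (x $ i) within axis_range i)"
    by (auto intro!: derivative_eq_intros)
  moreover have u: "x + (s - x $ i) *\<^sub>R axis i 1 = upd x i s" for s
    by (simp add: upd_add_axis)
  ultimately have d: "(upd x i has_derivative (\<lambda>h. h *\<^sub>R axis i 1)) (at (x $ i) within axis_range i)"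
    by simp
  have "((\<lambda>s. f (upd x i s)) has_derivative (\<lambda>h. D (h *\<^sub>R axis i 1))) (at (x $ i) within axis_range i)"
  proof (rule has_derivative_in_compose[OF d])
    have "upd x i ` axis_range i \<subseteq> slab" using x by (auto intro: upd_slab)
    from has_derivative_subset[OF f this]
    show "(f has_derivative D) (at (upd x i (x $ i)) within upd x i ` axis_range i)" by simp
  qed
  moreover have "D (h *\<^sub>R axis i 1) = h *\<^sub>R D (axis i 1)" for h
    using has_derivative_linear[OF f] linear_scale by blast
  ultimately show ?thesis by (simp add: has_vector_derivative_def)
qed

text \<open>\<open>frechet_derivative\<close> within \<open>slab\<close> is a choice. On a
  coordinate line it becomes a one-variable derivative at a limit point of
  \<open>axis_range i\<close>, and is therefore determined on the axis vectors.\<close>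

lemma pd_eq:
  assumes f: "(f has_derivative D) (at x within slab)" and x: "x \<in> slab"
  shows "pd i f x = D (axis i 1)"
proof -
  have "(f has_derivative frechet_derivative f (at x within slab)) (at x within slab)"
    using f differentiableI frechet_derivative_works by blast
  then show ?thesis
    using has_vector_derivative_slice[OF _ x, of f] f
      vector_derivative_unique_within[OF axis_range_limpt[OF slab_nth[OF x]]]
    unfolding pd_def by blast
qed

definition differentiable_slab :: "(real^3 \<Rightarrow> 'b::real_normed_vector) \<Rightarrow> bool" where
  "differentiable_slab f \<longleftrightarrow> (\<forall>x\<in>slab. f differentiable (at x within slab))"

lemma has_pd_pd:
  assumes "differentiable_slab f"
  shows "has_pd i f (pd i f)"
  unfolding has_pd_def
proof
  fix x assume x: "x \<in> slab"
  then obtain D where D: "(f has_derivative D) (at x within slab)"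
    using assms unfolding differentiable_slab_def differentiable_def by blast
  show "((\<lambda>s. f (upd x i s)) has_real_derivative pd i f x) (at (x $ i) within axis_range i)"
    using has_vector_derivative_slice[OF D x] pd_eq[OF D x]
    by (simp add: has_real_derivative_iff_has_vector_derivative)
qed

lemma pd_component:
  fixes F :: "real^3 \<Rightarrow> real^3"
  assumes "differentiable_slab F" "x \<in> slab"
  shows "pd i F x $ j = pd i (\<lambda>y. F y $ j) x"
proof -
  obtain D where D: "(F has_derivative D) (at x within slab)"
    using assms unfolding differentiable_slab_def differentiable_def by blast
  have "((\<lambda>y. F y $ j) has_derivative (\<lambda>v. D v $ j)) (at x within slab)"
    by (rule bounded_linear.has_derivative[OF bounded_linear_vec_nth D])
  then show ?thesis using pd_eq[OF D] pd_eq assms(2) by metis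
qed

lemma differentiable_slab_transform:
  assumes "differentiable_slab f" "\<And>x. x \<in> slab \<Longrightarrow> g x = f x"
  shows "differentiable_slab g"
  using assms has_derivative_transform unfolding differentiable_slab_def differentiable_def by metis

lemma pd_cong:
  assumes f: "differentiable_slab f" and eq: "\<And>x. x \<in> slab \<Longrightarrow> g x = f x" and x: "x \<in> slab"
  shows "pd i g x = pd i f x"
proof -
  obtain D where D: "(f has_derivative D) (at x within slab)"
    using f x unfolding differentiable_slab_def differentiable_def by blast
  have "(g has_derivative D) (at x within slab)" by (rule has_derivative_transform[OF x eq D])
  then show ?thesis using pd_eq D x by metis
qed

section \<open>Slices of fields that are smooth in space and time\<close>

lemma Ck_on_cong: "Ck_on k S f \<Longrightarrow> (\<And>x. x \<in> S \<Longrightarrow> g x = f x) \<Longrightarrow> Ck_on k S g"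
proof (induction k arbitrary: f g)
  case 0
  then show ?case by (simp cong: continuous_on_cong)
next
  case (Suc k)
  then obtain f' where f': "\<forall>x\<in>S. (f has_derivative f' x) (at x within S)" "\<forall>v. Ck_on k S (\<lambda>x. f' x v)"
    by auto
  have "\<forall>x\<in>S. (g has_derivative f' x) (at x within S)"
    using f'(1) Suc.prems(2) has_derivative_transform by metis
  then show ?case using f'(2) by auto
qed

lemma Ck_on_component: "Ck_on k S F \<Longrightarrow> Ck_on k S (\<lambda>z. F z $ j)"
proof (induction k arbitrary: F)
  case 0
  then show ?case by (auto intro!: continuous_intros)
next
  case (Suc k)
  then obtain f' where f': "\<forall>x\<in>S. (F has_derivative f' x) (at x within S)" "\<forall>v. Ck_on k S (\<lambda>x. f' x v)"
    by auto
  have "\<forall>x\<in>S. ((\<lambda>z. F z $ j) has_derivative (\<lambda>v. f' x v $ j)) (at x within S)"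
    using f'(1) bounded_linear.has_derivative[OF bounded_linear_vec_nth] by blast
  then show ?case using f'(2) Suc.IH by (auto intro!: exI[of _ "\<lambda>x v. f' x v $ j"])
qed

lemma smooth_on_component: "smooth_on S F \<Longrightarrow> smooth_on S (\<lambda>z. F z $ j)"
  unfolding smooth_on_def using Ck_on_component by blast

lemma smooth_on_continuous: "smooth_on S f \<Longrightarrow> continuous_on S f"
  unfolding smooth_on_def using Ck_on.simps(1) by blast

abbreviation spacetime :: "real set \<Rightarrow> (real \<times> (real^3)) set" where
  "spacetime J \<equiv> Sigma J (\<lambda>_. slab)"

lemma has_derivative_space_slice:
  assumes "((\<lambda>(t, x). F t x) has_derivative D) (at (t, x) within spacetime J)" "t \<in> J"
  shows "(F t has_derivative (\<lambda>v. D (0, v))) (at x within slab)"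
proof -
  have d: "((\<lambda>y. (t, y)) has_derivative (\<lambda>v. (0, v))) (at x within slab)"
    by (auto intro!: derivative_eq_intros)
  have "((\<lambda>y. (\<lambda>(t, x). F t x) (t, y)) has_derivative (\<lambda>v. D (0, v))) (at x within slab)"
    by (rule has_derivative_in_compose[OF d has_derivative_subset[OF assms(1)]]) (use assms(2) in auto)
  then show ?thesis by simp
qed

lemma has_derivative_time_slice:
  assumes "((\<lambda>(t, x). F t x) has_derivative D) (at (t, x) within spacetime J)" "x \<in> slab"
  shows "((\<lambda>s. F s x) has_vector_derivative D (1, 0)) (at t within J)"
proof -
  have d: "((\<lambda>s. (s, x)) has_derivative (\<lambda>h. (h, 0))) (at t within J)"
    by (auto intro!: derivative_eq_intros)
  have "((\<lambda>s. (\<lambda>(t, x). F t x) (s, x)) has_derivative (\<lambda>h. D (h, 0))) (at t within J)"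
    by (rule has_derivative_in_compose[OF d has_derivative_subset[OF assms(1)]]) (use assms(2) in auto)
  moreover have "(\<lambda>h. D (h, 0)) = (\<lambda>h. h *\<^sub>R D (1, 0))"
  proof
    fix h show "D (h, 0) = h *\<^sub>R D (1, 0)"
      using linear_scale[OF has_derivative_linear[OF assms(1)], of h "(1, 0)"] by simp
  qed
  ultimately show ?thesis by (simp only: has_vector_derivative_def prod.case)
qed

lemma smooth_on_spacetime:
  assumes s: "smooth_on (spacetime J) (\<lambda>(t, x). F t x)" and t: "t \<in> J"
  shows "differentiable_slab (F t)"
    and "continuous_on slab (F t)"
proof -
  have "Ck_on (Suc 0) (spacetime J) (\<lambda>(t, x). F t x)" using s by (simp only: smooth_on_def)
  then obtain D where D: "\<forall>z\<in>spacetime J. ((\<lambda>(t, x). F t x) has_derivative D z) (at z within spacetime J)"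
    by auto
  show d: "differentiable_slab (F t)"
    unfolding differentiable_slab_def differentiable_def
    using D t has_derivative_space_slice by blast
  show "continuous_on slab (F t)"
    using d unfolding differentiable_slab_def continuous_on_eq_continuous_within
    by (auto intro: differentiable_imp_continuous_within)
qed

text \<open>The spatial derivative is the space-time derivative in the direction
  \<open>(0, axis i 1)\<close>, so each order of smoothness of it comes from the next order of
  \<open>F\<close>.\<close>

lemma smooth_on_spacetime_pd:
  assumes s: "smooth_on (spacetime J) (\<lambda>(t, x). F t x)"
  shows "smooth_on (spacetime J) (\<lambda>(t, x). pd i (F t) x)"
  unfolding smooth_on_def
proof
  fix k
  have "Ck_on (Suc k) (spacetime J) (\<lambda>(t, x). F t x)" using s by (simp only: smooth_on_def)
  then obtain D where D: "\<forall>z\<in>spacetime J. ((\<lambda>(t, x). F t x) has_derivative D z) (at z within spacetime J)"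
      "\<forall>v. Ck_on k (spacetime J) (\<lambda>z. D z v)"
    by auto
  show "Ck_on k (spacetime J) (\<lambda>(t, x). pd i (F t) x)"
  proof (rule Ck_on_cong)
    show "Ck_on k (spacetime J) (\<lambda>z. D z (0, axis i 1))" using D(2) by blast
    show "(\<lambda>(t, x). pd i (F t) x) z = D z (0, axis i 1)" if z: "z \<in> spacetime J" for z
    proof -
      obtain t x where tx: "z = (t, x)" "t \<in> J" "x \<in> slab" using z by auto
      have "((\<lambda>(t, x). F t x) has_derivative D (t, x)) (at (t, x) within spacetime J)" using D(1) z tx by blast
      from pd_eq[OF has_derivative_space_slice[OF this tx(2)] tx(3)] show ?thesis by (simp add: tx)
    qed
  qed
qed

lemma smooth_on_spacetime_time_derivative:
  assumes s: "smooth_on (spacetime J) (\<lambda>(t, x). F t x)"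
  obtains F' where "continuous_on (spacetime J) F'"
    "\<And>t x. t \<in> J \<Longrightarrow> x \<in> slab \<Longrightarrow> ((\<lambda>s. F s x) has_vector_derivative F' (t, x)) (at t within J)"
proof -
  have "Ck_on (Suc 0) (spacetime J) (\<lambda>(t, x). F t x)" using s by (simp only: smooth_on_def)
  then obtain D where D: "\<forall>z\<in>spacetime J. ((\<lambda>(t, x). F t x) has_derivative D z) (at z within spacetime J)"
      "\<forall>v. Ck_on 0 (spacetime J) (\<lambda>z. D z v)"
    by auto
  show ?thesis
  proof (rule that)
    show "continuous_on (spacetime J) (\<lambda>z. D z (1, 0))" using D(2) by simp
    show "((\<lambda>s. F s x) has_vector_derivative D (t, x) (1, 0)) (at t within J)" if "t \<in> J" "x \<in> slab" for t x
      using D(1) that has_derivative_time_slice by blast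
  qed
qed

section \<open>Regularity of the vertical primitive of the temperature\<close>

lemma mult_slab: "x \<in> slab \<Longrightarrow> 0 \<le> \<sigma> \<Longrightarrow> \<sigma> \<le> 1 \<Longrightarrow> upd x 3 (x $ 3 * \<sigma>) \<in> slab"
  by (auto simp: slab_def mult_le_one)

text \<open>The substitution \<open>s = x $ 3 * \<sigma>\<close> moves the variable upper limit into
  the integrand, after which differentiation under an integral over a fixed interval
  applies.\<close>

lemma Tbar_rescaled:
  assumes c: "continuous_on slab T" and x: "x \<in> slab"
  shows "Tbar T x = x $ 3 * integral {0..1} (\<lambda>\<sigma>. T (upd x 3 (x $ 3 * \<sigma>)))"
proof -
  have eq: "vector [x $ 1, x $ 2, s] = upd x 3 s" for s by (simp add: vec_eq_iff forall_3)
  show ?thesis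
  proof (cases "x $ 3 = 0")
    case False
    then have z: "0 < x $ 3" using x by (simp add: slab_def)
    have "(\<lambda>s. T (upd x 3 s)) integrable_on {0..x $ 3}"
      by (rule integrable_continuous_real, rule continuous_on_compose2[OF c])
         (use x in \<open>auto intro!: continuous_intros simp: slab_def\<close>)
    then have "((\<lambda>s. T (upd x 3 s)) has_integral Tbar T x) (cbox 0 (x $ 3))"
      by (simp add: Tbar_def eq integrable_integral)
    from has_integral_affinity'[OF this z, of 0]
    have "((\<lambda>\<sigma>. T (upd x 3 (x $ 3 * \<sigma>))) has_integral Tbar T x / x $ 3) {0..1}"
      using z by (simp add: divide_inverse mult.commute)
    then show ?thesis using z by (simp add: integral_unique)
  qed (simp add: Tbar_def)
qed

lemma continuous_rescaled:
  assumes c: "continuous_on slab f"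
  shows "continuous_on slab (\<lambda>x. x $ 3 * integral {0..1} (\<lambda>\<sigma>. f (upd x 3 (x $ 3 * \<sigma>)) :: real))"
proof -
  have "continuous_on slab (\<lambda>x. integral (cbox 0 1) (\<lambda>\<sigma>. f (upd x 3 (x $ 3 * \<sigma>))))"
    by (rule integral_continuous_on_param)
       (auto simp: case_prod_beta' intro!: continuous_on_compose2[OF c] continuous_intros mult_slab)
  then show ?thesis by (auto intro!: continuous_intros)
qed

text \<open>\<open>pd\<close> is defined through the Frechet derivative, so
  \<open>pd i (Tbar T)\<close> is meaningful only once \<open>Tbar T\<close> is totally
  differentiable. This is the Leibniz rule for the rescaled integral, with the derivative of the
  integrand packed into the bounded linear function \<open>A x \<sigma>\<close>.\<close>

lemma Tbar_differentiable:
  assumes T: "differentiable_slab T" and c: "continuous_on slab T" "\<And>i. continuous_on slab (pd i T)"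
  shows "differentiable_slab (Tbar T)"
proof -
  define N where "N i = Blinfun (\<lambda>v::real^3. v $ i)" for i
  have N: "blinfun_apply (N i) v = v $ i" for i v
    unfolding N_def by (simp add: bounded_linear_Blinfun_apply bounded_linear_vec_nth)
  \<comment> \<open>The diagonal entries of the linear map that contracts the vertical coordinate by
    \<open>\<sigma>\<close>; they are the chain rule factors.\<close>
  define r where "r i \<sigma> = (if i = (3 :: 3) then \<sigma> else 1 :: real)" for i \<sigma>
  define A where "A x \<sigma> = (\<Sum>i\<in>UNIV. (r i \<sigma> * pd i T (upd x 3 (x $ 3 * \<sigma>))) *\<^sub>R N i)" for x :: "real^3" and \<sigma>
  have dT: "(T has_derivative (\<lambda>v. \<Sum>i\<in>UNIV. v $ i * pd i T y)) (at y within slab)" if y: "y \<in> slab" for y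
  proof -
    obtain D where D: "(T has_derivative D) (at y within slab)"
      using T y unfolding differentiable_slab_def differentiable_def by blast
    have "D v = (\<Sum>i\<in>UNIV. v $ i * pd i T y)" for v
    proof -
      have l: "linear D" by (rule has_derivative_linear[OF D])
      have "D v = D (\<Sum>i\<in>UNIV. v $ i *\<^sub>R axis i 1)" using basis_expansion[of v] by (simp add: scalar_mult_eq_scaleR)
      also have "\<dots> = (\<Sum>i\<in>UNIV. v $ i * pd i T y)"
        by (simp add: linear_sum[OF l] linear_scale[OF l] pd_eq[OF D y])
      finally show ?thesis .
    qed
    then show ?thesis using D by presburger
  qed
  have "((\<lambda>x. integral (cbox 0 1) (\<lambda>\<sigma>. T (upd x 3 (x $ 3 * \<sigma>)))) has_derivative
      blinfun_apply (integral (cbox 0 1) (A x))) (at x within slab)" if x: "x \<in> slab" for x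
  proof (rule leibniz_rule[OF _ _ _ x convex_slab])
    fix y :: "real^3" and \<sigma> :: real assume y: "y \<in> slab" and \<sigma>: "\<sigma> \<in> cbox 0 1"
    have "((\<lambda>x. \<chi> i. r i \<sigma> * x $ i) has_derivative (\<lambda>v. \<chi> i. r i \<sigma> * v $ i)) (at y within slab)"
      by (rule bounded_linear_imp_has_derivative, rule linear_conv_bounded_linear[THEN iffD1], rule linearI)
         (simp_all add: vec_eq_iff algebra_simps)
    moreover have u: "(\<chi> i. r i \<sigma> * x $ i) = upd x 3 (x $ 3 * \<sigma>)" for x
      by (simp add: vec_eq_iff r_def)
    ultimately have d: "((\<lambda>x. upd x 3 (x $ 3 * \<sigma>)) has_derivative (\<lambda>v. upd v 3 (v $ 3 * \<sigma>))) (at y within slab)"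
      by simp
    have sub: "(\<lambda>x. upd x 3 (x $ 3 * \<sigma>)) ` slab \<subseteq> slab" using \<sigma> by (auto intro!: mult_slab)
    have "upd y 3 (y $ 3 * \<sigma>) \<in> slab" using y sub by blast
    from has_derivative_in_compose[OF d has_derivative_subset[OF dT[OF this] sub]]
    have "((\<lambda>x. T (upd x 3 (x $ 3 * \<sigma>))) has_derivative
        (\<lambda>v. \<Sum>i\<in>UNIV. upd v 3 (v $ 3 * \<sigma>) $ i * pd i T (upd y 3 (y $ 3 * \<sigma>)))) (at y within slab)" .
    moreover have "(\<lambda>v. \<Sum>i\<in>UNIV. upd v 3 (v $ 3 * \<sigma>) $ i * pd i T (upd y 3 (y $ 3 * \<sigma>))) = blinfun_apply (A y \<sigma>)"
      by (auto simp: fun_eq_iff A_def blinfun.add_left blinfun.scaleR_left N sum_3 r_def)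
    ultimately show "((\<lambda>x. T (upd x 3 (x $ 3 * \<sigma>))) has_derivative blinfun_apply (A y \<sigma>)) (at y within slab)"
      by simp
  next
    fix y :: "real^3" assume y: "y \<in> slab"
    show "(\<lambda>\<sigma>. T (upd y 3 (y $ 3 * \<sigma>))) integrable_on cbox 0 1"
      by (rule integrable_continuous, rule continuous_on_compose2[OF c(1)])
         (use y in \<open>auto intro!: continuous_intros mult_slab\<close>)
  next
    have cr: "continuous_on X (\<lambda>z. r i (snd z))" for X :: "((real^3) \<times> real) set" and i
      by (cases "i = 3") (auto simp: r_def intro!: continuous_intros)
    have "continuous_on (slab \<times> cbox 0 1) (\<lambda>z. pd i T (upd (fst z) 3 (fst z $ 3 * snd z)))" for i
      by (rule continuous_on_compose2[OF c(2)]) (auto intro!: continuous_intros mult_slab)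
    then show "continuous_on (slab \<times> cbox 0 1) (\<lambda>(x, \<sigma>). A x \<sigma>)"
      unfolding case_prod_beta' A_def by (intro continuous_intros cr)
  qed
  then have "differentiable_slab (\<lambda>x. integral {0..1} (\<lambda>\<sigma>. T (upd x 3 (x $ 3 * \<sigma>))))"
    unfolding differentiable_slab_def differentiable_def by auto
  then have "differentiable_slab (\<lambda>x. x $ 3 * integral {0..1} (\<lambda>\<sigma>. T (upd x 3 (x $ 3 * \<sigma>))))"
    unfolding differentiable_slab_def
    by (intro ballI differentiable_mult) (auto intro: bounded_linear_imp_differentiable bounded_linear_vec_nth)
  then show ?thesis
    by (rule differentiable_slab_transform) (use Tbar_rescaled[OF c(1)] in auto)
qed

lemma has_pd_Tbar_vertical:
  assumes c: "continuous_on slab T"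
  shows "has_pd 3 (Tbar T) T"
  unfolding has_pd_def
proof
  fix x assume x: "x \<in> slab"
  have eq: "vector [x $ 1, x $ 2, s] = upd x 3 s" for s by (simp add: vec_eq_iff forall_3)
  have "((\<lambda>z. integral {0..z} (\<lambda>s. T (upd x 3 s))) has_real_derivative T (upd x 3 (x $ 3))) (at (x $ 3) within {0..1})"
    by (rule integral_has_real_derivative, rule continuous_on_compose2[OF c])
       (use x in \<open>auto intro!: continuous_intros simp: slab_def\<close>)
  then show "((\<lambda>s. Tbar T (upd x 3 s)) has_real_derivative T x) (at (x $ 3) within axis_range 3)"
    by (simp add: Tbar_def eq axis_range_def)
qed

lemma has_pd_Tbar_horizontal:
  assumes f: "has_pd i T T'" and c: "continuous_on slab T" "continuous_on slab T'" and i: "i \<noteq> 3"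
  shows "has_pd i (Tbar T) (\<lambda>x. x $ 3 * integral {0..1} (\<lambda>\<sigma>. T' (upd x 3 (x $ 3 * \<sigma>))))"
proof (rule has_pd_cong)
  let ?p = "\<lambda>x \<sigma>. upd x 3 (x $ 3 * \<sigma>)"
  show "has_pd i (\<lambda>x. x $ 3 * integral {0..1} (\<lambda>\<sigma>. T (?p x \<sigma>))) (\<lambda>x. x $ 3 * integral {0..1} (\<lambda>\<sigma>. T' (?p x \<sigma>)))"
    unfolding has_pd_def
  proof
    fix x assume x: "x \<in> slab"
    have p: "?p (upd x i s) \<sigma> = upd (?p x \<sigma>) i s" for s \<sigma>
      using i by (simp add: upd_commute[of i 3])
    have mem: "upd (?p x \<sigma>) i s \<in> slab" if "s \<in> axis_range i" "\<sigma> \<in> {0..1}" for s \<sigma>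
      by (rule upd_slab) (use x that in \<open>auto intro: mult_slab\<close>)
    have "((\<lambda>s. integral (cbox 0 1) (\<lambda>\<sigma>. T (upd (?p x \<sigma>) i s))) has_real_derivative
        integral (cbox 0 1) (\<lambda>\<sigma>. T' (upd (?p x \<sigma>) i (x $ i)))) (at (x $ i) within axis_range i)"
    proof (rule leibniz_rule_field_derivative)
      show "((\<lambda>s. T (upd (?p x \<sigma>) i s)) has_real_derivative T' (upd (?p x \<sigma>) i s)) (at s within axis_range i)"
        if "s \<in> axis_range i" "\<sigma> \<in> cbox 0 1" for s \<sigma>
        by (rule has_pd_slice[OF f _ that(1)]) (use x that in \<open>auto intro: mult_slab\<close>)
      show "(\<lambda>\<sigma>. T (upd (?p x \<sigma>) i s)) integrable_on cbox 0 1" if "s \<in> axis_range i" for s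
        by (rule integrable_continuous, rule continuous_on_compose2[OF c(1)])
           (use mem that in \<open>auto intro!: continuous_intros\<close>)
      show "continuous_on (axis_range i \<times> cbox 0 1) (\<lambda>(s, \<sigma>). T' (upd (?p x \<sigma>) i s))"
        unfolding case_prod_beta'
        by (rule continuous_on_compose2[OF c(2)]) (use mem in \<open>auto intro!: continuous_intros\<close>)
    qed (use x in \<open>auto simp: slab_nth convex_axis_range\<close>)
    then have "((\<lambda>s. integral {0..1} (\<lambda>\<sigma>. T (?p (upd x i s) \<sigma>))) has_real_derivative
        integral {0..1} (\<lambda>\<sigma>. T' (?p x \<sigma>))) (at (x $ i) within axis_range i)"
      unfolding p using p[of "x $ i"] by (simp only: upd_same cbox_interval)
    from DERIV_cmult[OF this, of "x $ 3"]
    show "((\<lambda>s. upd x i s $ 3 * integral {0..1} (\<lambda>\<sigma>. T (?p (upd x i s) \<sigma>))) has_real_derivative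
        x $ 3 * integral {0..1} (\<lambda>\<sigma>. T' (?p x \<sigma>))) (at (x $ i) within axis_range i)"
      using i by simp
  qed
qed (use Tbar_rescaled[OF c(1)] in auto)

lemma Tbar_continuity:
  assumes T: "differentiable_slab T" and c: "continuous_on slab T" "\<And>i. continuous_on slab (pd i T)"
  shows "continuous_on slab (Tbar T)" "i \<noteq> 3 \<Longrightarrow> continuous_on slab (pd i (Tbar T))"
proof -
  show "continuous_on slab (Tbar T)"
    using continuous_rescaled[OF c(1)] Tbar_rescaled[OF c(1)] by (simp cong: continuous_on_cong)
  assume i: "i \<noteq> 3"
  have "pd i (Tbar T) x = x $ 3 * integral {0..1} (\<lambda>\<sigma>. pd i T (upd x 3 (x $ 3 * \<sigma>)))" if "x \<in> slab" for x
    using has_pd_unique[OF has_pd_pd[OF Tbar_differentiable[OF T c]] has_pd_Tbar_horizontal[OF has_pd_pd[OF T] c i] that] .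
  then show "continuous_on slab (pd i (Tbar T))"
    using continuous_rescaled[OF c(2)] by (simp cong: continuous_on_cong)
qed

section \<open>Energy balance\<close>

text \<open>The working class at one instant. It contains \<open>Tbar T\<close> and is closed under
  products and differences; second derivatives are handled by requiring \<open>pd i f\<close> to
  belong to it.\<close>

definition C1 :: "(real^3 \<Rightarrow> real) \<Rightarrow> bool" where
  "C1 f \<longleftrightarrow> differentiable_slab f \<and> continuous_on slab f \<and> (\<forall>i. continuous_on slab (pd i f))"

lemma C1_D:
  assumes "C1 f"
  shows "differentiable_slab f" "continuous_on slab f" "continuous_on slab (pd i f)" "has_pd i f (pd i f)"
  using assms has_pd_pd unfolding C1_def by auto

lemma C1_I:
  assumes "differentiable_slab f" "\<And>i. has_pd i f (f' i)" "continuous_on slab f" "\<And>i. continuous_on slab (f' i)"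
  shows "C1 f"
proof -
  have "continuous_on slab (pd i f)" for i
    using assms(4)[of i] has_pd_unique[OF has_pd_pd[OF assms(1)] assms(2)]
    by (simp cong: continuous_on_cong)
  then show ?thesis using assms by (simp add: C1_def)
qed

lemma C1_mult:
  assumes f: "C1 f" and g: "C1 g" shows "C1 (\<lambda>x. f x * g x)"
proof (rule C1_I)
  show "differentiable_slab (\<lambda>x. f x * g x)"
    using C1_D(1)[OF f] C1_D(1)[OF g] by (auto simp: differentiable_slab_def intro: differentiable_mult)
  show "has_pd i (\<lambda>x. f x * g x) (\<lambda>x. pd i f x * g x + f x * pd i g x)" for i
    by (intro has_pd_mult C1_D f g)
qed (intro continuous_intros C1_D f g)+

lemma C1_diff:
  assumes f: "C1 f" and g: "C1 g" shows "C1 (\<lambda>x. f x - g x)"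
proof (rule C1_I)
  show "differentiable_slab (\<lambda>x. f x - g x)"
    using C1_D(1)[OF f] C1_D(1)[OF g] by (auto simp: differentiable_slab_def intro: differentiable_diff)
  show "has_pd i (\<lambda>x. f x - g x) (\<lambda>x. pd i f x - pd i g x)" for i
    by (intro has_pd_diff C1_D f g)
qed (intro continuous_intros C1_D f g)+

lemma C1_Tbar:
  assumes T: "C1 T"
  shows "C1 (Tbar T)" "x \<in> slab \<Longrightarrow> pd 3 (Tbar T) x = T x"
proof -
  note T' = C1_D(1-3)[OF T]
  have eq: "pd 3 (Tbar T) x = T x" if "x \<in> slab" for x
    using has_pd_unique[OF has_pd_pd[OF Tbar_differentiable[OF T']] has_pd_Tbar_vertical[OF T'(2)] that] .
  have "continuous_on slab (pd i (Tbar T))" for i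
    using Tbar_continuity(2)[OF T', of i] eq T'(2) by (cases "i = 3") (simp_all cong: continuous_on_cong)
  then show "C1 (Tbar T)"
    using Tbar_continuity(1)[OF T'] Tbar_differentiable[OF T'] by (simp add: C1_def)
  show "pd 3 (Tbar T) x = T x" if "x \<in> slab" using eq[OF that] .
qed

lemma C1_smooth:
  assumes s: "smooth_on (spacetime J) (\<lambda>(t, x). F t x)" and t: "t \<in> J"
  shows "C1 (F t)"
  unfolding C1_def
  using smooth_on_spacetime[OF s t] smooth_on_spacetime(2)[OF smooth_on_spacetime_pd[OF s] t] by blast

definition wall :: "(real^3 \<Rightarrow> real) \<Rightarrow> bool" where
  "wall f \<longleftrightarrow> (\<forall>x. x $ 3 = 0 \<or> x $ 3 = 1 \<longrightarrow> f x = 0)"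

lemma wall_mult: "wall f \<Longrightarrow> wall (\<lambda>x. f x * g x)" "wall g \<Longrightarrow> wall (\<lambda>x. f x * g x)"
  by (auto simp: wall_def)

lemma wall_pd:
  assumes f: "C1 f" and w: "wall f" and i: "i \<noteq> 3"
  shows "wall (pd i f)"
  unfolding wall_def
proof (intro allI impI)
  fix x :: "real^3" assume x: "x $ 3 = 0 \<or> x $ 3 = 1"
  then have xs: "x \<in> slab" by (auto simp: slab_def)
  have "((\<lambda>s. f (upd x i s)) has_real_derivative pd i f x) (at (x $ i))"
    using C1_D(4)[OF f, of i] xs i unfolding has_pd_def axis_range_def by auto
  moreover have "(\<lambda>s. f (upd x i s)) = (\<lambda>_. 0)"
    using w x i by (auto simp: wall_def fun_eq_iff)
  ultimately show "pd i f x = 0" using DERIV_unique[OF _ DERIV_const] by metis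
qed

lemma divergence_eq: "divergence F x = pd 1 (\<lambda>y. F y $ 1) x + pd 2 (\<lambda>y. F y $ 2) x + pd 3 (\<lambda>y. F y $ 3) x"
  by (simp add: divergence_def sum_3)

lemma curl_nth:
  "curl F x $ 1 = pd 2 (\<lambda>y. F y $ 3) x - pd 3 (\<lambda>y. F y $ 2) x"
  "curl F x $ 2 = pd 3 (\<lambda>y. F y $ 1) x - pd 1 (\<lambda>y. F y $ 3) x"
  "curl F x $ 3 = pd 1 (\<lambda>y. F y $ 2) x - pd 2 (\<lambda>y. F y $ 1) x"
  by (simp_all add: curl_def)

lemma inner_3: "x \<bullet> y = x $ 1 * y $ 1 + x $ 2 * y $ 2 + x $ 3 * y $ 3" for x y :: "real^3"
  by (simp add: inner_vec_def sum_3)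

lemma cross3_nth:
  "cross3 x y $ 1 = x $ 2 * y $ 3 - x $ 3 * y $ 2"
  "cross3 x y $ 2 = x $ 3 * y $ 1 - x $ 1 * y $ 3"
  "cross3 x y $ 3 = x $ 1 * y $ 2 - x $ 2 * y $ 1"
  by (simp_all add: cross3_def)

text \<open>Integration by parts is available for scalar functions, hence the Laplacian of
  components; for smooth fields it agrees with \<open>laplacian\<close> on
  \<open>slab\<close>.\<close>

definition component_laplacian :: "(real^3 \<Rightarrow> real^3) \<Rightarrow> real^3 \<Rightarrow> real^3" where
  "component_laplacian b x = (\<chi> j. \<Sum>i\<in>UNIV. pd i (pd i (\<lambda>y. b y $ j)) x)"

section \<open>Integral identities for solenoidal fields and the energy balance\<close>

context layer
begin

lemma matching_wall:
  assumes "wall f" shows "matching 3 f"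
  using assms by (auto simp: matching_def wall_def)

lemma product_rule_integral:
  assumes f: "C1 f" and g: "C1 g" and m: "matching i (\<lambda>x. f x * g x)"
  shows "((\<lambda>x. pd i f x * g x + f x * pd i g x) has_integral 0) V"
proof -
  have c: "continuous_on V (\<lambda>x. pd i f x * g x + f x * pd i g x)"
    by (intro continuous_intros continuous_V C1_D f g)
  then show ?thesis
    using integral_pd_zero[OF has_pd_mult[OF C1_D(4)[OF f] C1_D(4)[OF g]] c m] integrable_integral[OF integrable_V[OF c]]
    by simp
qed

lemma jacobian_integral:
  assumes f: "C1 f" and g: "C1 g" "C1 (pd j g)" and ij: "i \<noteq> j" "j \<noteq> 3"
    and m: "matching i (\<lambda>x. f x * pd j g x)" "matching j (\<lambda>x. f x * pd i g x)"
  shows "((\<lambda>x. pd i f x * pd j g x - pd j f x * pd i g x) has_integral 0) V"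
proof -
  have c: "continuous_on V (\<lambda>x. pd i f x * pd j g x - pd j f x * pd i g x)"
    by (intro continuous_intros continuous_V C1_D f g)
  have "integral V (\<lambda>x. pd i f x * pd j g x - pd j f x * pd i g x) = 0"
    by (rule integral_jacobian_zero[of i f "pd i f" j "pd j f" g "pd i g" "pd j g" "pd i (pd j g)"])
       (intro C1_D f g ij m)+
  then show ?thesis using integrable_integral[OF integrable_V[OF c]] by simp
qed

text \<open>The integrand is the divergence of \<open>f\<close> times \<open>u\<close>, because
  \<open>u\<close> is solenoidal. For the pressure this says that it does no work; for
  \<open>Tbar\<close> it trades the buoyancy work against horizontal derivatives.\<close>

lemma advection_integral:
  assumes u: "\<And>j. C1 (\<lambda>x. u x $ j)" and f: "C1 f"
    and p: "\<And>i j. i \<noteq> 3 \<Longrightarrow> periodic i (\<lambda>x. u x $ j)" "\<And>i. i \<noteq> 3 \<Longrightarrow> periodic i f"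
    and w: "wall (\<lambda>x. u x $ 3)" and div: "\<And>x. x \<in> slab \<Longrightarrow> divergence u x = 0"
  shows "((\<lambda>x. u x $ 1 * pd 1 f x + u x $ 2 * pd 2 f x + u x $ 3 * pd 3 f x) has_integral 0) V"
proof -
  have "matching i (\<lambda>x. u x $ i * f x)" for i
    using p matching_wall[OF wall_mult(1)[OF w]] periodic_matching[OF periodic_mult]
    by (cases "i = 3") auto
  note h = product_rule_integral[OF u f this]
  have "((\<lambda>x. (pd 1 (\<lambda>x. u x $ 1) x * f x + u x $ 1 * pd 1 f x) + (pd 2 (\<lambda>x. u x $ 2) x * f x + u x $ 2 * pd 2 f x)
      + (pd 3 (\<lambda>x. u x $ 3) x * f x + u x $ 3 * pd 3 f x)) has_integral 0 + 0 + 0) V"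
    by (intro has_integral_add h)
  then have "((\<lambda>x. (pd 1 (\<lambda>x. u x $ 1) x * f x + u x $ 1 * pd 1 f x) + (pd 2 (\<lambda>x. u x $ 2) x * f x + u x $ 2 * pd 2 f x)
      + (pd 3 (\<lambda>x. u x $ 3) x * f x + u x $ 3 * pd 3 f x)) has_integral 0) V" by simp
  then show ?thesis
  proof (rule has_integral_eq[rotated])
    fix x assume "x \<in> V"
    then have "(pd 1 (\<lambda>x. u x $ 1) x + pd 2 (\<lambda>x. u x $ 2) x + pd 3 (\<lambda>x. u x $ 3) x) * f x = 0"
      using div V_slab unfolding divergence_eq by auto
    then show "(pd 1 (\<lambda>x. u x $ 1) x * f x + u x $ 1 * pd 1 f x) + (pd 2 (\<lambda>x. u x $ 2) x * f x + u x $ 2 * pd 2 f x)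
      + (pd 3 (\<lambda>x. u x $ 3) x * f x + u x $ 3 * pd 3 f x) = u x $ 1 * pd 1 f x + u x $ 2 * pd 2 f x + u x $ 3 * pd 3 f x"
      by (simp add: algebra_simps)
  qed
qed

text \<open>The integrand is the divergence of \<open>cross3 E b\<close>, whose vertical component
  involves \<open>b\<close> only through \<open>b $ 1\<close> and \<open>b $ 2\<close>, and these
  vanish on the walls.\<close>

lemma curl_integral_by_parts:
  assumes b: "\<And>j. C1 (\<lambda>x. b x $ j)" and E: "\<And>j. C1 (\<lambda>x. E x $ j)"
    and p: "\<And>i j. i \<noteq> 3 \<Longrightarrow> periodic i (\<lambda>x. b x $ j)" "\<And>i j. i \<noteq> 3 \<Longrightarrow> periodic i (\<lambda>x. E x $ j)"
    and w: "wall (\<lambda>x. b x $ 1)" "wall (\<lambda>x. b x $ 2)"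
  shows "((\<lambda>x. b x \<bullet> curl E x - E x \<bullet> curl b x) has_integral 0) V"
proof -
  define h where "h i j k x = pd i (\<lambda>x. b x $ j) x * E x $ k + b x $ j * pd i (\<lambda>x. E x $ k) x" for i j k x
  have m: "matching i (\<lambda>x. b x $ j * E x $ k)" if "i = 3 \<Longrightarrow> j = 1 \<or> j = 2" for i j k
    using p that w matching_wall[OF wall_mult(1)] periodic_matching[OF periodic_mult]
    by (cases "i = 3") auto
  have h: "(h i j k has_integral 0) V" if "i = 3 \<Longrightarrow> j = 1 \<or> j = 2" for i j k
    unfolding h_def by (rule product_rule_integral[OF b E m[OF that]])
  have "((\<lambda>x. h 2 1 3 x - h 3 1 2 x + (h 3 2 1 x - h 1 2 3 x) + (h 1 3 2 x - h 2 3 1 x))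
      has_integral 0 - 0 + (0 - 0) + (0 - 0)) V"
    by (intro has_integral_add has_integral_diff h) auto
  moreover have "(\<lambda>x. h 2 1 3 x - h 3 1 2 x + (h 3 2 1 x - h 1 2 3 x) + (h 1 3 2 x - h 2 3 1 x))
      = (\<lambda>x. b x \<bullet> curl E x - E x \<bullet> curl b x)"
    by (simp add: fun_eq_iff h_def inner_3 curl_nth algebra_simps)
  ultimately show ?thesis by simp
qed

text \<open>The Jacobians \<open>\<partial>\<^sub>i b\<^sub>j \<partial>\<^sub>j b\<^sub>i - \<partial>\<^sub>i b\<^sub>i \<partial>\<^sub>j b\<^sub>j\<close> make up the difference of the two integrands.\<close>

lemma gradient_curl_integral:
  assumes b: "\<And>j. C1 (\<lambda>x. b x $ j)" "\<And>i j. C1 (pd i (\<lambda>x. b x $ j))"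
    and p: "\<And>i j. i \<noteq> 3 \<Longrightarrow> periodic i (\<lambda>x. b x $ j)"
    and w: "wall (\<lambda>x. b x $ 1)" "wall (\<lambda>x. b x $ 2)" and div: "\<And>x. x \<in> slab \<Longrightarrow> divergence b x = 0"
  shows "((\<lambda>x. (\<Sum>j\<in>UNIV. \<Sum>i\<in>UNIV. (pd i (\<lambda>x. b x $ j) x)\<^sup>2) - (norm (curl b x))\<^sup>2) has_integral 0) V"
proof -
  define d where "d i j = pd i (\<lambda>x. b x $ j)" for i j
  have pd: "periodic i (d k j)" if "i \<noteq> 3" for i j k
    unfolding d_def using periodic_pd[OF C1_D(4)[OF b(1)] p that] that by blast
  have m: "matching i (\<lambda>x. b x $ j * d k l x)" if "i = 3 \<Longrightarrow> j = 1 \<or> j = 2" for i j k l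
    using p that w pd matching_wall[OF wall_mult(1)] periodic_matching[OF periodic_mult]
    by (cases "i = 3") auto
  define q where "q i j x = d i j x * d j i x - d j j x * d i i x" for i j x
  \<comment> \<open>The undifferentiated factor in the boundary terms is \<open>b $ j\<close>. As
    \<open>j\<close> is horizontal, it vanishes on the walls, which settles
    \<open>i = 3\<close>.\<close>
  have q: "(q i j has_integral 0) V" if "i \<noteq> j" "j \<noteq> 3" for i j
    unfolding q_def d_def
    by (rule jacobian_integral[OF b(1) b(1) b(2) that]; fold d_def; rule m)
       (use that exhaust_3[of j] in auto)
  have "((\<lambda>x. 2 * (q 1 2 x + q 3 1 x + q 3 2 x)) has_integral 2 * (0 + 0 + 0)) V"
    by (intro has_integral_mult_right has_integral_add q) auto
  then have "((\<lambda>x. 2 * (q 1 2 x + q 3 1 x + q 3 2 x)) has_integral 0) V" by simp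
  then show ?thesis
  proof (rule has_integral_eq[rotated])
    fix x assume "x \<in> V"
    then have "d 1 1 x + d 2 2 x + d 3 3 x = 0"
      using div V_slab unfolding divergence_eq d_def by auto
    then have "(d 1 1 x + d 2 2 x + d 3 3 x)\<^sup>2 = 0" by simp
    then show "2 * (q 1 2 x + q 3 1 x + q 3 2 x)
        = (\<Sum>j\<in>UNIV. \<Sum>i\<in>UNIV. (pd i (\<lambda>x. b x $ j) x)\<^sup>2) - (norm (curl b x))\<^sup>2"
      unfolding power2_norm_eq_inner inner_3 curl_nth sum_3 q_def d_def[symmetric]
      by (simp add: power2_eq_square algebra_simps)
  qed
qed

text \<open>The delicate boundary term is that of \<open>b $ 3\<close> and its vertical derivative.
  On the walls the tangential derivatives of the horizontal components vanish, so the solenoidal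
  condition forces the vertical derivative of \<open>b $ 3\<close> to vanish too.\<close>

lemma laplacian_integral:
  assumes b: "\<And>j. C1 (\<lambda>x. b x $ j)" "\<And>i j. C1 (pd i (\<lambda>x. b x $ j))"
    and p: "\<And>i j. i \<noteq> 3 \<Longrightarrow> periodic i (\<lambda>x. b x $ j)"
    and w: "wall (\<lambda>x. b x $ 1)" "wall (\<lambda>x. b x $ 2)" and div: "\<And>x. x \<in> slab \<Longrightarrow> divergence b x = 0"
  shows "((\<lambda>x. b x \<bullet> component_laplacian b x + (\<Sum>j\<in>UNIV. \<Sum>i\<in>UNIV. (pd i (\<lambda>x. b x $ j) x)\<^sup>2)) has_integral 0) V"
proof -
  define d where "d i j = pd i (\<lambda>x. b x $ j)" for i j
  have pd: "periodic i (d k j)" if "i \<noteq> 3" for i j k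
    unfolding d_def using periodic_pd[OF C1_D(4)[OF b(1)] p that] that by blast
  have "wall (d 3 3)"
    unfolding wall_def
  proof (intro allI impI)
    fix x :: "real^3" assume x: "x $ 3 = 0 \<or> x $ 3 = 1"
    then have "d 1 1 x = 0" "d 2 2 x = 0"
      using wall_pd[OF b(1) w(1), of 1] wall_pd[OF b(1) w(2), of 2] by (auto simp: wall_def d_def)
    moreover have "divergence b x = 0" by (rule div) (use x in \<open>auto simp: slab_def\<close>)
    ultimately show "d 3 3 x = 0" by (simp add: divergence_eq d_def)
  qed
  then have "wall (\<lambda>x. b x $ j * d 3 j x)" for j
    using wall_mult w exhaust_3[of j] by metis
  then have m: "matching i (\<lambda>x. b x $ j * d i j x)" for i j
    using p pd matching_wall periodic_matching[OF periodic_mult] by (cases "i = 3") auto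
  have h: "((\<lambda>x. d i j x * d i j x + b x $ j * pd i (d i j) x) has_integral 0) V" for i j
    using product_rule_integral[OF b(1) b(2) m[unfolded d_def], of i j] by (simp add: d_def)
  have "((\<lambda>x. \<Sum>j\<in>UNIV. \<Sum>i\<in>UNIV. d i j x * d i j x + b x $ j * pd i (d i j) x) has_integral (\<Sum>j\<in>(UNIV::3 set). \<Sum>i\<in>(UNIV::3 set). 0)) V"
    by (intro has_integral_sum h) auto
  moreover have "(\<lambda>x. \<Sum>j\<in>UNIV. \<Sum>i\<in>UNIV. d i j x * d i j x + b x $ j * pd i (d i j) x)
      = (\<lambda>x. b x \<bullet> component_laplacian b x + (\<Sum>j\<in>UNIV. \<Sum>i\<in>UNIV. (pd i (\<lambda>x. b x $ j) x)\<^sup>2))"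
    by (simp add: fun_eq_iff component_laplacian_def inner_vec_def sum_3 d_def power2_eq_square algebra_simps)
  ultimately show ?thesis by simp
qed

text \<open>Every equation is used pointwise, and all integrations by parts are gathered in one
  function \<open>H\<close> of integral zero. The Lorentz work enters through
  \<open>E \<bullet> curl b\<close>, which is minus the product of \<open>u\<close> with the Lorentz
  force.\<close>

lemma energy_balance:
  assumes b: "\<And>j. C1 (\<lambda>x. b x $ j)" "\<And>i j. C1 (pd i (\<lambda>x. b x $ j))" and u: "\<And>j. C1 (\<lambda>x. u x $ j)"
    and P: "C1 P" "\<And>i. C1 (pd i P)" and T: "C1 T"
    and p: "\<And>i j. i \<noteq> 3 \<Longrightarrow> periodic i (\<lambda>x. b x $ j)" "\<And>i j. i \<noteq> 3 \<Longrightarrow> periodic i (\<lambda>x. u x $ j)"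
      "\<And>i. i \<noteq> 3 \<Longrightarrow> periodic i P" "\<And>i. i \<noteq> 3 \<Longrightarrow> periodic i (Tbar T)"
    and w: "wall (\<lambda>x. b x $ 1)" "wall (\<lambda>x. b x $ 2)" "wall (\<lambda>x. u x $ 3)"
    and div: "\<And>x. x \<in> slab \<Longrightarrow> divergence b x = 0" "\<And>x. x \<in> slab \<Longrightarrow> divergence u x = 0"
    and \<Lambda>: "\<Lambda> > 0"
    and momentum: "\<And>x. x \<in> slab \<Longrightarrow> cross3 e_z (u x) + grad P x
        = \<Lambda> *\<^sub>R cross3 (curl b x) (b x) + (Ra * T x) *\<^sub>R e_z"
    and induction: "\<And>x. x \<in> slab \<Longrightarrow> bt x - curl (\<lambda>y. cross3 (u y) (b y)) x
        = (1 / Rm) *\<^sub>R component_laplacian b x"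
  defines "g \<equiv> grad_xy (Tbar T)"
  shows "integral V (\<lambda>x. b x \<bullet> bt x) = integral V (\<lambda>x. - Ra *
      (cross3 (curl b x) (b x) $ 2 * g x $ 1 - cross3 (curl b x) (b x) $ 1 * g x $ 2)
      - 1 / Rm * (norm (curl b x))\<^sup>2)"
proof -
  define E where "E y = cross3 (u y) (b y)" for y
  let ?F = "\<lambda>x. cross3 (curl b x) (b x)"
  have E: "C1 (\<lambda>x. E x $ j)" for j
    using exhaust_3[of j] unfolding E_def by (auto simp: cross3_nth intro!: C1_diff C1_mult u b)
  have pE: "periodic i (\<lambda>x. E x $ j)" if "i \<noteq> 3" for i j
    using exhaust_3[of j] p(1,2)[OF that] unfolding E_def periodic_def by (auto simp: cross3_nth)
  note TB = C1_Tbar[OF T]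
  have pP: "periodic i (pd k P)" if "i \<noteq> 3" for i k
    using periodic_pd[OF C1_D(4)[OF P(1)] p(3) that] that by blast
  have h1: "((\<lambda>x. b x \<bullet> curl E x - E x \<bullet> curl b x) has_integral 0) V"
    by (rule curl_integral_by_parts) (use b E p pE w in auto)
  have h2: "((\<lambda>x. b x \<bullet> component_laplacian b x + (norm (curl b x))\<^sup>2) has_integral 0) V"
    using has_integral_diff[OF laplacian_integral[OF b p(1) w(1,2) div(1)] gradient_curl_integral[OF b p(1) w(1,2) div(1)]]
    by simp
  have h3: "((\<lambda>x. u x $ 1 * pd 1 P x + u x $ 2 * pd 2 P x + u x $ 3 * pd 3 P x) has_integral 0) V"
    by (rule advection_integral) (use u P p w div in auto)
  have h4: "((\<lambda>x. u x $ 1 * pd 1 (Tbar T) x + u x $ 2 * pd 2 (Tbar T) x + u x $ 3 * pd 3 (Tbar T) x) has_integral 0) V"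
    by (rule advection_integral) (use u TB(1) p w div in auto)
  have h5: "((\<lambda>x. pd 2 (Tbar T) x * pd 1 P x - pd 1 (Tbar T) x * pd 2 P x) has_integral 0) V"
    by (rule jacobian_integral[OF TB(1) P]) (auto intro!: periodic_matching periodic_mult p pP)
  \<comment> \<open>The coefficients come from multiplying the momentum balance by
    \<open>u / \<Lambda>\<close>. The rows are induction, diffusion, pressure work, buoyancy work
    and the geostrophic Jacobian; the last two leave \<open>Ra\<close> times the determinant of the
    Lorentz force and \<open>g\<close>.\<close>
  define H where "H x = (b x \<bullet> curl E x - E x \<bullet> curl b x)
      + 1 / Rm * (b x \<bullet> component_laplacian b x + (norm (curl b x))\<^sup>2)
      - 1 / \<Lambda> * (u x $ 1 * pd 1 P x + u x $ 2 * pd 2 P x + u x $ 3 * pd 3 P x)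
      + Ra / \<Lambda> * (u x $ 1 * pd 1 (Tbar T) x + u x $ 2 * pd 2 (Tbar T) x + u x $ 3 * pd 3 (Tbar T) x)
      - Ra / \<Lambda> * (pd 2 (Tbar T) x * pd 1 P x - pd 1 (Tbar T) x * pd 2 P x)" for x
  have "(H has_integral 0 + 1 / Rm * 0 - 1 / \<Lambda> * 0 + Ra / \<Lambda> * 0 - Ra / \<Lambda> * 0) V"
    unfolding H_def
    by (intro has_integral_add has_integral_diff has_integral_mult_right h1 h2 h3 h4 h5)
  then have h: "(H has_integral 0) V" by simp
  let ?R = "\<lambda>x. - Ra * (?F x $ 2 * g x $ 1 - ?F x $ 1 * g x $ 2) - 1 / Rm * (norm (curl b x))\<^sup>2"
  have cR: "continuous_on V ?R"
    unfolding g_def grad_xy_def cross3_nth curl_nth vector_2 power2_norm_eq_inner inner_3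
    by (intro continuous_intros C1_D(2,3)[OF b(1), THEN continuous_V] C1_D(3)[OF TB(1), THEN continuous_V])
  have "((\<lambda>x. H x + ?R x) has_integral integral V ?R) V"
    using has_integral_add[OF h integrable_integral[OF integrable_V[OF cR]]] by simp
  then have "((\<lambda>x. b x \<bullet> bt x) has_integral integral V ?R) V"
  proof (rule has_integral_eq[rotated])
    fix x assume "x \<in> V"
    then have x: "x \<in> slab" using V_slab by blast
    have bt: "b x \<bullet> bt x = b x \<bullet> curl E x + 1 / Rm * (b x \<bullet> component_laplacian b x)"
    proof -
      have "bt x = curl E x + (1 / Rm) *\<^sub>R component_laplacian b x"
        using induction[OF x] by (simp add: E_def[abs_def] algebra_simps)
      then show ?thesis by (simp add: inner_add_right)
    qed
    have comp: "(cross3 e_z (u x) + grad P x) $ i = (\<Lambda> *\<^sub>R ?F x + (Ra * T x) *\<^sub>R e_z) $ i" for i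
      using momentum[OF x] by simp
    have m1: "- u x $ 2 + pd 1 P x = \<Lambda> * ?F x $ 1"
      using comp[of 1] by (simp add: cross3_nth grad_def axis_def)
    have m2: "u x $ 1 + pd 2 P x = \<Lambda> * ?F x $ 2"
      using comp[of 2] by (simp add: cross3_nth grad_def axis_def)
    have m3: "pd 3 P x = \<Lambda> * ?F x $ 3 + Ra * T x"
      using comp[of 3] by (simp add: cross3_nth grad_def axis_def)
    have EJ: "E x \<bullet> curl b x = - (u x $ 1 * ?F x $ 1 + u x $ 2 * ?F x $ 2 + u x $ 3 * ?F x $ 3)"
      unfolding E_def inner_3 cross3_nth by (simp add: algebra_simps)
    define l r where "l = 1 / \<Lambda>" and "r = 1 / Rm"
    have l: "1 / \<Lambda> = l" "Ra / \<Lambda> = Ra * l" by (simp_all add: l_def)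
    have F: "?F x $ 1 = l * (- u x $ 2 + pd 1 P x)" "?F x $ 2 = l * (u x $ 1 + pd 2 P x)"
      "?F x $ 3 = l * (pd 3 P x - Ra * T x)"
      using m1 m2 m3 \<Lambda> by (simp_all add: l_def field_simps)
    have g: "g x $ 1 = pd 1 (Tbar T) x" "g x $ 2 = pd 2 (Tbar T) x" by (simp_all add: g_def grad_xy_def)
    show "H x + ?R x = b x \<bullet> bt x"
      unfolding H_def bt EJ g F TB(2)[OF x] l r_def[symmetric] by (simp add: algebra_simps)
  qed
  then show ?thesis by (rule integral_unique)
qed

end

section \<open>The dynamo criterion\<close>

text \<open>Up to sign this is the planar determinant of the horizontal Lorentz force and
  \<open>g\<close>. By Lagrange's identity its square and that of their inner product add up to the
  product of the squared lengths.\<close>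

lemma jacobian_term_bound:
  fixes j b :: "real^3" and g :: "real^2"
  shows "\<bar>cross3 j b $ 2 * g $ 1 - cross3 j b $ 1 * g $ 2\<bar> \<le> norm j * norm b * norm g"
proof -
  have "(norm (cross3 j b))\<^sup>2 \<le> (norm j * norm b)\<^sup>2"
    by (simp add: norm_cross power_mult_distrib)
  then have F: "norm (cross3 j b) \<le> norm j * norm b" by (rule power2_le_imp_le) simp
  let ?F1 = "cross3 j b $ 1" and ?F2 = "cross3 j b $ 2"
  have "(?F2 * g $ 1 - ?F1 * g $ 2)\<^sup>2 + (?F1 * g $ 1 + ?F2 * g $ 2)\<^sup>2 = (?F1\<^sup>2 + ?F2\<^sup>2) * ((g $ 1)\<^sup>2 + (g $ 2)\<^sup>2)"
    by (simp add: power2_eq_square algebra_simps)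
  also have "\<dots> \<le> (norm (cross3 j b))\<^sup>2 * (norm g)\<^sup>2"
    unfolding power2_norm_eq_inner inner_3 inner_vec_def[of g] sum_2
    by (intro mult_mono) (auto simp: power2_eq_square)
  finally have "(?F2 * g $ 1 - ?F1 * g $ 2)\<^sup>2 \<le> (norm (cross3 j b) * norm g)\<^sup>2"
    unfolding power_mult_distrib using zero_le_power2[of "?F1 * g $ 1 + ?F2 * g $ 2"] by linarith
  then have "\<bar>?F2 * g $ 1 - ?F1 * g $ 2\<bar> \<le> norm (cross3 j b) * norm g"
    by (simp add: power2_le_iff_abs_le)
  also have "\<dots> \<le> norm j * norm b * norm g" using F by (rule mult_right_mono) simp
  finally show ?thesis .
qed

lemma continuous_on_vec_nthI:
  fixes F :: "'a::topological_space \<Rightarrow> real^'n"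
  assumes "\<And>j. continuous_on S (\<lambda>x. F x $ j)"
  shows "continuous_on S F"
  using continuous_on_vec_lambda[of S "\<lambda>j x. F x $ j"] assms by simp

lemma has_vector_derivative_norm_squared:
  fixes f :: "real \<Rightarrow> 'a::real_inner"
  assumes "(f has_vector_derivative f') (at t within S)"
  shows "((\<lambda>s. (norm (f s))\<^sup>2) has_vector_derivative 2 * (f t \<bullet> f')) (at t within S)"
  using bounded_bilinear.has_vector_derivative[OF bounded_bilinear_inner assms assms]
  by (simp add: power2_norm_eq_inner inner_commute)

context layer
begin

lemma A_const_nonneg: "0 \<le> A_const Lx Ly p"
  using lambda1_bounds(1) by (simp add: A_const_def C_P_def)

text \<open>The horizontal mean of the vertical component does not depend on the height, since the
  field is solenoidal and periodic; on the lower wall it is the flux.\<close>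

lemma horizontal_mean_zero:
  assumes b: "\<And>j. C1 (\<lambda>x. b x $ j)" and p: "\<And>i j. i \<noteq> 3 \<Longrightarrow> periodic i (\<lambda>x. b x $ j)"
    and div: "\<And>x. x \<in> slab \<Longrightarrow> divergence b x = 0" and flux: "flux_exact Lx Ly b" and x: "x \<in> V"
  shows "LI 2 (LI 1 (\<lambda>x. b x $ 3)) x = 0"
proof -
  let ?f = "\<lambda>x. b x $ 3" and ?d = "\<lambda>j. pd j (\<lambda>x. b x $ j)"
  define h where "h = LI 2 (LI 1 ?f)"
  have xs: "x \<in> slab" using x V_slab by blast
  note cs = C1_D(2,3)[OF b]
  note cV = cs[THEN continuous_V]
  have "has_pd 3 (LI 1 ?f) (LI 1 (?d 3))" by (rule has_pd_LI[OF C1_D(4)[OF b] cs]) simp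
  then have h: "has_pd 3 h (LI 2 (LI 1 (?d 3)))"
    unfolding h_def by (rule has_pd_LI) (auto intro!: LI_continuous_slab cs)
  have d0: "LI j (?d j) y = 0" if "j \<noteq> 3" "y \<in> V" for j y
    using LI_pd[OF C1_D(4)[OF b] that(2)] periodic_matching[OF p[OF that(1)]] that(2) by (simp add: matching_def)
  have z: "LI 2 (LI 1 (?d 3)) y = 0" if y: "y \<in> V" for y
  proof -
    have "LI 1 (?d 3) w = - 1 * LI 1 (?d 2) w" if w: "w \<in> V" for w
    proof -
      have "LI 1 (?d 3) w = LI 1 (\<lambda>v. - 1 * (?d 1 v + ?d 2 v)) w"
      proof (rule LI_cong[OF w])
        fix v assume "v \<in> V"
        then have "divergence b v = 0" using div V_slab by blast
        then show "?d 3 v = - 1 * (?d 1 v + ?d 2 v)" unfolding divergence_eq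
          by (simp add: eq_neg_iff_add_eq_0 add.commute add.left_commute)
      qed
      also have "\<dots> = - 1 * (LI 1 (?d 1) w + LI 1 (?d 2) w)"
        by (simp only: LI_cmult LI_add[OF cV(2) cV(2) w])
      finally show ?thesis using d0[of 1] w by simp
    qed
    then have "LI 2 (LI 1 (?d 3)) y = LI 2 (\<lambda>w. - 1 * LI 1 (?d 2) w) y" by (rule LI_cong[OF y])
    also have "\<dots> = - 1 * LI 1 (LI 2 (?d 2)) y"
      by (simp only: LI_cmult LI_commute[OF cV(2) y, of 2 1])
    also have "LI 1 (LI 2 (?d 2)) y = LI 1 (\<lambda>_. 0) y" by (rule LI_cong[OF y]) (simp add: d0)
    finally show ?thesis by (simp add: LI_def)
  qed
  have "\<exists>c. \<forall>s\<in>{0..1}. h (upd x 3 s) = c"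
  proof (rule has_field_derivative_zero_constant)
    fix s :: real assume s: "s \<in> {0..1}"
    have "upd x 3 s \<in> V" using upd_V[OF x, of s 3] s by simp
    then show "((\<lambda>s. h (upd x 3 s)) has_real_derivative 0) (at s within {0..1})"
      using has_pd_slice[OF h xs, of s] s z by (simp add: axis_range_def)
  qed simp
  then obtain c where c: "h (upd x 3 s) = c" if "s \<in> {0..1}" for s by blast
  have "h x = h (upd x 3 0)"
    using c[of "x $ 3"] c[of 0] xs by (simp add: slab_def)
  also have "\<dots> = LI 1 (LI 2 ?f) (upd x 3 0)"
    unfolding h_def by (rule LI_commute[OF cV(1)]) (use upd_V[OF x, of 0 3] in simp)
  also have "\<dots> = 0"
  proof -
    let ?G = "\<lambda>w :: real^2. b (vector [w $ 1, w $ 2, 0]) $ 3"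
    have eq: "vector [r, s, 0] = upd (upd (upd x 3 0) 1 r) 2 s" for r s by (simp add: vec_eq_iff forall_3)
    have mem: "vector [r, s, 0] \<in> V" if "0 \<le> r" "r \<le> Lx" "0 \<le> s" "s \<le> Ly" for r s
      using that by (simp add: mem_V forall_3)
    have z2: "vector [0, 0] = (0 :: real^2)" by (simp add: vec_eq_iff forall_2)
    have "continuous_on (cbox 0 (vector [Lx, Ly])) (\<lambda>w :: real^2. upd (upd (upd x 3 0) 1 (w $ 1)) 2 (w $ 2))"
      by (intro continuous_intros)
    then have "continuous_on (cbox 0 (vector [Lx, Ly])) ?G"
      unfolding eq by (rule continuous_on_compose2[OF cV(1)[of 3]])
        (auto simp: mem_box_cart forall_2 eq[symmetric] intro!: mem)
    then have "(?G has_integral integral (cbox 0 (vector [Lx, Ly])) ?G) (cbox 0 (vector [Lx, Ly]))"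
      by (intro integrable_integral integrable_continuous)
    moreover have "integral (cbox 0 (vector [Lx, Ly])) ?G = 0"
      using flux by (simp add: flux_exact_def inner_axis')
    ultimately have "(?G has_integral 0) (cbox (vector [0, 0]) (vector [Lx, Ly]))" by (simp add: z2)
    from has_integral_vector2[OF this]
    have "0 = integral (cbox (0, 0) (Lx, Ly)) (\<lambda>(r, s). b (vector [r, s, 0]) $ 3)"
      by (simp add: integral_unique)
    also have "\<dots> = integral (cbox 0 Lx) (\<lambda>r. integral (cbox 0 Ly) (\<lambda>s. b (vector [r, s, 0]) $ 3))"
    proof (subst integral_prod_continuous)
      have "continuous_on (cbox (0, 0) (Lx, Ly)) (\<lambda>q. upd (upd (upd x 3 0) 1 (fst q)) 2 (snd q))"
        by (intro continuous_intros)
      then show "continuous_on (cbox (0, 0) (Lx, Ly)) (\<lambda>(r, s). b (vector [r, s, 0]) $ 3)"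
        unfolding case_prod_beta' eq by (rule continuous_on_compose2[OF cV(1)[of 3]])
          (auto simp: cbox_Pair_iff eq[symmetric] intro!: mem)
    qed simp
    finally show ?thesis by (simp add: LI_def eq)
  qed
  finally show ?thesis by (simp add: h_def)
qed

text \<open>The statement at one instant, with the time derivative replaced by a field
  \<open>bt\<close> satisfying the induction equation. If the claim failed, the energy would decay
  strictly.\<close>

lemma dynamo_criterion:
  assumes b: "\<And>j. C1 (\<lambda>x. b x $ j)" "\<And>i j. C1 (pd i (\<lambda>x. b x $ j))" and u: "\<And>j. C1 (\<lambda>x. u x $ j)"
    and P: "C1 P" "\<And>i. C1 (pd i P)" and T: "C1 T"
    and p: "\<And>i j. i \<noteq> 3 \<Longrightarrow> periodic i (\<lambda>x. b x $ j)" "\<And>i j. i \<noteq> 3 \<Longrightarrow> periodic i (\<lambda>x. u x $ j)"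
      "\<And>i. i \<noteq> 3 \<Longrightarrow> periodic i P" "\<And>i. i \<noteq> 3 \<Longrightarrow> periodic i (Tbar T)"
    and w: "wall (\<lambda>x. b x $ 1)" "wall (\<lambda>x. b x $ 2)" "wall (\<lambda>x. u x $ 3)"
    and div: "\<And>x. x \<in> slab \<Longrightarrow> divergence b x = 0" "\<And>x. x \<in> slab \<Longrightarrow> divergence u x = 0"
    and pos: "\<Lambda> > 0" "Ra > 0" "Rm > 0"
    and momentum: "\<And>x. x \<in> slab \<Longrightarrow> cross3 e_z (u x) + grad P x
        = \<Lambda> *\<^sub>R cross3 (curl b x) (b x) + (Ra * T x) *\<^sub>R e_z"
    and induction: "\<And>x. x \<in> slab \<Longrightarrow> bt x - curl (\<lambda>y. cross3 (u y) (b y)) x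
        = (1 / Rm) *\<^sub>R component_laplacian b x"
    and flux: "flux_exact Lx Ly b" and nontrivial: "\<exists>x\<in>V. b x \<noteq> 0"
    and growth: "0 \<le> integral V (\<lambda>x. b x \<bullet> bt x)" and q: "3 \<le> q"
  shows "1 / Rm \<le> Ra * A_const Lx Ly q * Lp_norm q V (grad_xy (Tbar T))"
proof (rule ccontr)
  assume contra: "\<not> ?thesis"
  define g where "g = grad_xy (Tbar T)"
  define N A where "N = Lp_norm q V g" and "A = A_const Lx Ly q"
  have A0: "0 \<le> A" unfolding A_def by (rule A_const_nonneg)
  have gap: "Ra * A * N < 1 / Rm" using contra by (simp add: N_def A_def g_def)
  \<comment> \<open>The strict inequality leaves room for a bound strictly above the norm, as
    Hoelder's inequality requires.\<close>
  obtain G where G: "N < G" "Ra * A * G < 1 / Rm"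
  proof -
    have "((\<lambda>G. Ra * A * G) \<longlongrightarrow> Ra * A * N) (at_right N)" by (intro tendsto_intros)
    then have "\<forall>\<^sub>F G in at_right N. Ra * A * G < 1 / Rm" using gap by (rule order_tendstoD)
    moreover have "\<forall>\<^sub>F G in at_right N. N < G" by (simp add: eventually_at_right_less)
    ultimately have "\<forall>\<^sub>F G in at_right N. N < G \<and> Ra * A * G < 1 / Rm" by eventually_elim simp
    then show ?thesis using that eventually_happens trivial_limit_at_right_real by blast
  qed
  note cb = C1_D(2,3)[OF b(1), THEN continuous_V]
  have cn: "continuous_on V b" by (rule continuous_on_vec_nthI) (rule cb)
  have ccurl: "continuous_on V (curl b)"
  proof (rule continuous_on_vec_nthI)
    show "continuous_on V (\<lambda>x. curl b x $ j)" for j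
    proof -
      have "continuous_on V (\<lambda>x. curl b x $ 1)" "continuous_on V (\<lambda>x. curl b x $ 2)"
        "continuous_on V (\<lambda>x. curl b x $ 3)"
        unfolding curl_nth by (intro continuous_intros cb)+
      then show ?thesis by (metis exhaust_3)
    qed
  qed
  have cg: "continuous_on V g"
  proof (rule continuous_on_vec_nthI)
    show "continuous_on V (\<lambda>x. g x $ j)" for j
      using exhaust_2[of j] by (auto simp: g_def grad_xy_def intro!: C1_D(3)[OF C1_Tbar(1)[OF T], THEN continuous_V])
  qed
  define D where "D j = dirichlet_energy (\<lambda>i. pd i (\<lambda>x. b x $ j))" for j
  define E where "E = integral V (\<lambda>x. (norm (curl b x))\<^sup>2)"
  have D0: "0 \<le> D j" for j
    unfolding D_def dirichlet_energy_def by (intro sum_nonneg integral_V_nonneg continuous_intros cb) auto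
  \<comment> \<open>The Dirichlet energies of the components add up exactly to the squared norm of
    the curl, so bounds for components become bounds by the curl with the same constants.\<close>
  have DE: "(\<Sum>j\<in>UNIV. D j) = E"
  proof -
    have "integral V (\<lambda>x. (\<Sum>j\<in>UNIV. \<Sum>i\<in>UNIV. (pd i (\<lambda>x. b x $ j) x)\<^sup>2) - (norm (curl b x))\<^sup>2) = 0"
      using gradient_curl_integral[OF b p(1) w(1,2) div(1)] by (rule integral_unique)
    then have "integral V (\<lambda>x. \<Sum>j\<in>UNIV. \<Sum>i\<in>UNIV. (pd i (\<lambda>x. b x $ j) x)\<^sup>2) = E"
      by (subst (asm) integral_V_diff) (auto intro!: continuous_intros cb ccurl simp: E_def)
    moreover have "integral V (\<lambda>x. \<Sum>j\<in>UNIV. \<Sum>i\<in>UNIV. (pd i (\<lambda>x. b x $ j) x)\<^sup>2) = (\<Sum>j\<in>UNIV. D j)"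
      unfolding D_def dirichlet_energy_def
      by (subst integral_sum; (intro finite integrable_V continuous_intros cb)?)
         (rule sum.cong[OF refl], rule integral_sum, auto intro!: integrable_V continuous_intros cb)
    ultimately show ?thesis by simp
  qed
  have comp: "lam\<^sup>2 * integral V (\<lambda>x. (b x $ j)\<^sup>2) \<le> D j \<and> integral V (\<lambda>x. (b x $ j) ^ 6) \<le> C_S Lx Ly ^ 6 * D j ^ 3" for j
  proof (cases "j = 3")
    case True
    have m: "LI 2 (LI 1 (\<lambda>x. b x $ 3)) x = 0" if "x \<in> V" for x
      by (rule horizontal_mean_zero) (use b p div flux that in auto)
    show ?thesis unfolding D_def True
      using mean_free_component[OF C1_D(4)[OF b(1)] C1_D(2)[OF b(1)] C1_D(3)[OF b(1)] p(1) p(1) m] by simp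
  next
    case False
    then have wj: "wall (\<lambda>x. b x $ j)" using w exhaust_3[of j] by auto
    show ?thesis unfolding D_def
      using dirichlet_component[OF C1_D(4)[OF b(1)] C1_D(2)[OF b(1)] C1_D(3)[OF b(1)] p(1) p(1), of j] wj
      by (auto simp: wall_def)
  qed
  have nb: "(norm (b x))\<^sup>2 = (\<Sum>j\<in>UNIV. (b x $ j)\<^sup>2)" for x
    unfolding power2_norm_eq_inner inner_vec_def by (simp add: power2_eq_square)
  have b2: "lam\<^sup>2 * integral V (\<lambda>x. (norm (b x))\<^sup>2) \<le> E"
  proof -
    have "integral V (\<lambda>x. (norm (b x))\<^sup>2) = (\<Sum>j\<in>UNIV. integral V (\<lambda>x. (b x $ j)\<^sup>2))"
      unfolding nb by (rule integral_sum) (auto intro!: integrable_V continuous_intros cb)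
    then have "lam\<^sup>2 * integral V (\<lambda>x. (norm (b x))\<^sup>2) = (\<Sum>j\<in>UNIV. lam\<^sup>2 * integral V (\<lambda>x. (b x $ j)\<^sup>2))"
      by (simp add: sum_distrib_left)
    also have "\<dots> \<le> (\<Sum>j\<in>UNIV. D j)" by (rule sum_mono) (use comp in blast)
    finally show ?thesis by (simp add: DE)
  qed
  have b6: "integral V (\<lambda>x. norm (b x) ^ 6) \<le> C_S Lx Ly ^ 6 * E ^ 3"
  proof -
    have "norm (b x) ^ 6 = (\<Sum>j\<in>UNIV. (b x $ j)\<^sup>2) ^ 3" for x
      unfolding nb[symmetric] by (simp flip: power_mult)
    then show ?thesis
      using vector_sixth_power_bound[of "\<lambda>j x. b x $ j" "C_S Lx Ly ^ 6" D] cb D0 comp DE by simp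
  qed
  \<comment> \<open>If the curl vanished, Poincare's inequality and continuity would make the field
    vanish on the cell.\<close>
  have Epos: "0 < E"
  proof (rule ccontr)
    assume "\<not> 0 < E"
    then have "lam\<^sup>2 * integral V (\<lambda>x. (norm (b x))\<^sup>2) \<le> 0" using b2 by simp
    then have "integral V (\<lambda>x. (norm (b x))\<^sup>2) \<le> 0"
      using lambda1_bounds(1) by (simp add: mult_le_0_iff)
    moreover have cnn: "continuous_on V (\<lambda>x. (norm (b x))\<^sup>2)" by (intro continuous_intros cn)
    ultimately have "integral V (\<lambda>x. (norm (b x))\<^sup>2) = 0"
      using integral_V_nonneg[OF cnn] by simp
    then have "((\<lambda>x. (norm (b x))\<^sup>2) has_integral 0) V"
      using integrable_integral[OF integrable_V[OF cnn]] by simp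
    then have "(norm (b x))\<^sup>2 = 0" if "x \<in> V" for x
      using has_integral_0_cbox_imp_0[of 0 "vector [Lx, Ly, 1]" "\<lambda>x. (norm (b x))\<^sup>2" x] cnn that Lx Ly
      by (simp add: cell_def interval_ne_empty_cart forall_3)
    then show False using nontrivial by auto
  qed
  have "integral V (\<lambda>x. norm (curl b x) * norm (b x) * norm (g x)) \<le> A * G * E"
    unfolding A_def
    by (rule holder_A_const) (use q Epos b2 b6 G(1) cn ccurl cg in \<open>auto intro!: continuous_intros simp: E_def N_def\<close>)
  then have le: "Ra * integral V (\<lambda>x. norm (curl b x) * norm (b x) * norm (g x)) \<le> Ra * A * G * E"
    using pos(2) by (simp add: mult.assoc)
  have "integral V (\<lambda>x. b x \<bullet> bt x) = integral V (\<lambda>x. - Ra *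
      (cross3 (curl b x) (b x) $ 2 * g x $ 1 - cross3 (curl b x) (b x) $ 1 * g x $ 2)
      - 1 / Rm * (norm (curl b x))\<^sup>2)"
    unfolding g_def by (rule energy_balance) (use b u P T p w div pos momentum induction in auto)
  also have "\<dots> \<le> integral V (\<lambda>x. Ra * (norm (curl b x) * norm (b x) * norm (g x)) - 1 / Rm * (norm (curl b x))\<^sup>2)"
  proof (rule integral_V_mono)
    fix x
    let ?X = "cross3 (curl b x) (b x) $ 2 * g x $ 1 - cross3 (curl b x) (b x) $ 1 * g x $ 2"
    have "- ?X \<le> norm (curl b x) * norm (b x) * norm (g x)"
      using jacobian_term_bound[of "curl b x" "b x" "g x"] by linarith
    from mult_left_mono[OF this, of Ra] pos(2)
    have "- Ra * ?X \<le> Ra * (norm (curl b x) * norm (b x) * norm (g x))"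
      unfolding mult_minus_left mult_minus_right by simp
    then show "- Ra * ?X - 1 / Rm * (norm (curl b x))\<^sup>2
        \<le> Ra * (norm (curl b x) * norm (b x) * norm (g x)) - 1 / Rm * (norm (curl b x))\<^sup>2"
      by simp
  qed (intro continuous_intros continuous_on_cross cn ccurl cg)+
  also have "\<dots> = Ra * integral V (\<lambda>x. norm (curl b x) * norm (b x) * norm (g x)) - 1 / Rm * E"
    by (subst integral_V_diff) (use pos in \<open>auto intro!: continuous_intros cn ccurl cg simp: E_def\<close>)
  also have "\<dots> \<le> (Ra * A * G - 1 / Rm) * E" using le by (simp add: left_diff_distrib)
  also have "\<dots> < 0" using G(2) Epos by (intro mult_neg_pos) auto
  finally show False using growth by simp
qed

end

section \<open>Reduction of the evolution problem to a single instant\<close>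

theorem theorem3p3:
  fixes Lx Ly \<Lambda> Ra Rm :: real
    and J :: "real set" and t :: real
    and u B :: "real \<Rightarrow> real^3 \<Rightarrow> real^3"
    and P T :: "real \<Rightarrow> real^3 \<Rightarrow> real"
    and p :: ereal
  assumes "Lx > 0" "Ly > 0" "\<Lambda> > 0" "Ra > 0" "Rm > 0"
    and "is_interval J" "interior J \<noteq> {}"
    and "taylor_solution Lx Ly \<Lambda> Ra Rm J u B P T"
    and "\<forall>s\<in>J. flux_exact Lx Ly (B s)"
    and "t \<in> J"
    and "\<exists>x\<in>cell Lx Ly. B t x \<noteq> 0"
    and "vector_derivative (\<lambda>s. magnetic_energy Lx Ly (B s)) (at t within J) \<ge> 0"
    and "3 \<le> p"
  shows "Ra * A_const Lx Ly p * Lp_norm p (cell Lx Ly) (grad_xy (Tbar (T t))) \<ge> 1 / Rm"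
proof -
  interpret layer Lx Ly by standard (use assms in auto)
  note sol = assms(8)[unfolded taylor_solution_def]
  note t = assms(10)
  have s: "smooth_on (spacetime J) (\<lambda>(t, x). u t x)" "smooth_on (spacetime J) (\<lambda>(t, x). B t x)"
    "smooth_on (spacetime J) (\<lambda>(t, x). P t x)" "smooth_on (spacetime J) (\<lambda>(t, x). T t x)"
    using sol by blast+
  have cmp: "smooth_on (spacetime J) (\<lambda>(t, x). F t x $ j)"
    if "smooth_on (spacetime J) (\<lambda>(t, x). F t x)" for F :: "real \<Rightarrow> real^3 \<Rightarrow> real^3" and j
    using smooth_on_component[OF that, of j] by (simp add: case_prod_beta')
  have C1b: "C1 (\<lambda>x. B t x $ j)" "C1 (pd i (\<lambda>x. B t x $ j))" for i j
    using C1_smooth[OF cmp[OF s(2)] t] C1_smooth[OF smooth_on_spacetime_pd[OF cmp[OF s(2)]] t] by auto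
  have C1u: "C1 (\<lambda>x. u t x $ j)" for j using C1_smooth[OF cmp[OF s(1)] t] .
  have C1P: "C1 (P t)" "C1 (pd i (P t))" for i
    using C1_smooth[OF s(3) t] C1_smooth[OF smooth_on_spacetime_pd[OF s(3)] t] by auto
  have C1T: "C1 (T t)" using C1_smooth[OF s(4) t] .
  have per: "periodic_xy Lx Ly (u t)" "periodic_xy Lx Ly (B t)" "periodic_xy Lx Ly (P t)" "periodic_xy Lx Ly (T t)"
    using sol t by blast+
  have periodic: "F (upd x i (x $ i + L $ i)) = F x" if "periodic_xy Lx Ly F" "i \<noteq> 3" "x \<in> slab"
    for F :: "real^3 \<Rightarrow> 'b" and i x
    using that exhaust_3[of i] by (auto simp: periodic_xy_def upd_add_axis)
  have pb: "periodic i (\<lambda>x. B t x $ j)" "periodic i (\<lambda>x. u t x $ j)" "periodic i (P t)" if "i \<noteq> 3" for i j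
    unfolding periodic_def using periodic[OF per(1) that] periodic[OF per(2) that] periodic[OF per(3) that] by simp_all
  have pT: "periodic i (Tbar (T t))" if i: "i \<noteq> 3" for i
    unfolding periodic_def
  proof
    fix x assume x: "x \<in> slab"
    let ?y = "upd x i (x $ i + L $ i)"
    have eq: "vector [w $ 1, w $ 2, s] = upd w 3 s" for w :: "real^3" and s
      by (simp add: vec_eq_iff forall_3)
    have "integral {0..x $ 3} (\<lambda>s. T t (upd ?y 3 s)) = integral {0..x $ 3} (\<lambda>s. T t (upd x 3 s))"
    proof (rule integral_cong)
      fix s assume "s \<in> {0..x $ 3}"
      then have "upd x 3 s \<in> slab" using x by (auto simp: slab_def)
      from periodic[OF per(4) i this] show "T t (upd ?y 3 s) = T t (upd x 3 s)"
        using i by (simp add: upd_commute[of i 3])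
    qed
    then show "Tbar (T t) ?y = Tbar (T t) x" unfolding Tbar_def eq using i by simp
  qed
  have pde: "cross3 e_z (u t x) + grad (P t) x = \<Lambda> *\<^sub>R cross3 (curl (B t) x) (B t x) + (Ra * T t x) *\<^sub>R e_z"
    "divergence (u t) x = 0"
    "vector_derivative (\<lambda>s. B s x) (at t within J) - curl (\<lambda>y. cross3 (u t y) (B t y)) x = (1 / Rm) *\<^sub>R laplacian (B t) x"
    "divergence (B t) x = 0" if "x \<in> slab" for x
    using sol t that by blast+
  have bc: "u t x $ 3 = 0" "cross3 (B t x) e_z = 0" if "x $ 3 = 0 \<or> x $ 3 = 1" for x
  proof -
    have "u t x \<bullet> e_z = 0 \<and> cross3 (B t x) e_z = 0 \<or> u t x \<bullet> (- e_z) = 0 \<and> cross3 (B t x) (- e_z) = 0"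
      using sol t that by blast
    then show "u t x $ 3 = 0" "cross3 (B t x) e_z = 0" by (auto simp: inner_axis)
  qed
  have bw: "B t x $ 1 = 0" "B t x $ 2 = 0" if "x $ 3 = 0 \<or> x $ 3 = 1" for x
    using arg_cong[OF bc(2)[OF that], of "\<lambda>v. v $ 2"] arg_cong[OF bc(2)[OF that], of "\<lambda>v. v $ 1"]
    by (simp_all add: cross3_nth axis_def)
  have walls: "wall (\<lambda>x. B t x $ 1)" "wall (\<lambda>x. B t x $ 2)" "wall (\<lambda>x. u t x $ 3)"
    using bc(1) bw by (auto simp: wall_def)
  \<comment> \<open>An interval with interior points has no isolated point, so time derivatives
    within \<open>J\<close>, one-sided at its ends, are unique.\<close>
  have nb: "at t within J \<noteq> bot"
  proof -
    have "J \<noteq> {a}" for a using assms(7) by auto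
    then have "t islimpt J"
      using connected_imp_perfect[of J t] assms(6) t is_interval_connected by blast
    then show ?thesis by (simp add: trivial_limit_within)
  qed
  obtain B' where B': "continuous_on (spacetime J) B'"
    "\<And>t x. t \<in> J \<Longrightarrow> x \<in> slab \<Longrightarrow> ((\<lambda>s. B s x) has_vector_derivative B' (t, x)) (at t within J)"
    using smooth_on_spacetime_time_derivative[OF s(2)] by blast
  have vd: "vector_derivative (\<lambda>s. B s x) (at t within J) = B' (t, x)" if "x \<in> slab" for x
    using vector_derivative_within[OF nb B'(2)[OF t that]] .
  have lap: "laplacian (B t) x = component_laplacian (B t) x" if x: "x \<in> slab" for x
  proof -
    have d: "differentiable_slab (B t)" "differentiable_slab (pd i (B t))" for i
      using smooth_on_spacetime(1)[OF s(2) t] smooth_on_spacetime(1)[OF smooth_on_spacetime_pd[OF s(2)] t] by auto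
    have "pd i (pd i (B t)) x $ j = pd i (pd i (\<lambda>y. B t y $ j)) x" for i j
    proof -
      have "pd i (pd i (B t)) x $ j = pd i (\<lambda>y. pd i (B t) y $ j) x" by (rule pd_component[OF d(2) x])
      also have "\<dots> = pd i (pd i (\<lambda>y. B t y $ j)) x"
        by (rule pd_cong[OF C1_D(1)[OF C1b(2)] _ x]) (rule pd_component[OF d(1)])
      finally show ?thesis .
    qed
    then show ?thesis by (simp add: laplacian_def component_laplacian_def vec_eq_iff)
  qed
  have "((\<lambda>s. integral (cell Lx Ly) (\<lambda>x. (norm (B s x))\<^sup>2)) has_vector_derivative
      integral (cell Lx Ly) (\<lambda>x. 2 * (B t x \<bullet> B' (t, x)))) (at t within J)"
    unfolding cell_def
  proof (rule leibniz_rule_vector_derivative)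
    have sl: "x \<in> slab" if "x \<in> cbox 0 (vector [Lx, Ly, 1])" for x
      using that V_slab unfolding cell_def by blast
    show "((\<lambda>s. (norm (B s x))\<^sup>2) has_vector_derivative 2 * (B r x \<bullet> B' (r, x))) (at r within J)"
      if "r \<in> J" "x \<in> cbox 0 (vector [Lx, Ly, 1])" for r x
      by (rule has_vector_derivative_norm_squared) (use B'(2) that sl in blast)
    show "(\<lambda>x. (norm (B r x))\<^sup>2) integrable_on cbox 0 (vector [Lx, Ly, 1])" if "r \<in> J" for r
      using continuous_on_subset[OF smooth_on_spacetime(2)[OF s(2) that]] sl
      by (intro integrable_continuous continuous_intros) blast
    have sub: "J \<times> cbox 0 (vector [Lx, Ly, 1]) \<subseteq> spacetime J" using sl by auto
    show "continuous_on (J \<times> cbox 0 (vector [Lx, Ly, 1])) (\<lambda>(r, x). 2 * (B r x \<bullet> B' (r, x)))"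
      using continuous_on_subset[OF smooth_on_continuous[OF s(2)] sub] continuous_on_subset[OF B'(1) sub]
      by (auto simp: case_prod_beta' intro!: continuous_intros)
  qed (use t assms(6) is_interval_convex in auto)
  then have "((\<lambda>s. magnetic_energy Lx Ly (B s)) has_vector_derivative
      integral V (\<lambda>x. B t x \<bullet> B' (t, x))) (at t within J)"
    unfolding magnetic_energy_def
    using has_vector_derivative_mult_right[of _ "integral V (\<lambda>x. 2 * (B t x \<bullet> B' (t, x)))" "at t within J" "1 / 2"]
    by fastforce
  from vector_derivative_within[OF nb this]
  have growth: "0 \<le> integral V (\<lambda>x. B t x \<bullet> B' (t, x))"
    using assms(12) by (simp only:)
  show ?thesis
    by (rule dynamo_criterion[where b = "B t" and u = "u t" and P = "P t" and bt = "\<lambda>x. B' (t, x)" and \<Lambda> = \<Lambda>])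
       (use C1b C1u C1P C1T pb pT pde vd lap walls growth assms t in auto)
qed

end
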